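(* Let $(p^n)_{n\in\mathbb{N}_0}$ be the iterates of either the parallel decomposition algorithm (with $\sigma\in(0,\tfrac1M]$) or the sequential decomposition algorithm (with $\sigma\in(0,1]$), with parameter $\rho\in(0,1]$ and initial value $p^0\in K$, and let $\hat p\in K$ be a minimizer of $\mathcal{D}$ over $K$. Then $\mathcal{D}(p^n)\to\mathcal{D}(\hat p)$ as $n\to\infty$. More specifically, $$\mathcal{D}(p^n)-\mathcal{D}(\hat p)\le\begin{cases}\left(1-\frac{\rho\sigma}{2\alpha}\right)^n\big(\mathcal{D}(p^0)-\mathcal{D}(\hat p)\big)&\text{if } n\le n_0,\\[1ex] \frac{2\Phi^2}{\rho\sigma}\,\alpha^2\,(n-n_0+1)^{-1}&\text{if } n\ge n_0,\end{cases}$$ where $\alpha:=1+M\sigma\sqrt{2-\rho+2\sqrt{1-\rho}}$ for the sequential algorithm and $\alpha:=1$ for the parallel algorithm, $\Phi:=\sqrt{\|B^{-1}\|}\,\|\Lambda\|\,C_\theta R_{\hat p}$ with $C_\theta:=\big(\sum_{i=1}^M\|\theta_i\|^2\big)^{1/2}$ and $R_{\hat p}:=\sup\{\|p-\hat p\|_V: p\in K,\ \mathcal{D}(p)\le\mathcal{D}(p^0)\}<\infty$, and $n_0:=\min\{n\in\mathbb{N}_0:\mathcal{D}(p^n)-\mathcal{D}(\hat p)<\Phi^2\alpha\}$ (with the convention $n_0=\infty$ if this set is empty).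
   Context: Setting. $\Omega\subset\mathbb{R}^d$ ($d\in\mathbb{N}$) is open, bounded and simply connected with Lipschitz boundary, $m\in\mathbb{N}$, $\lambda>0$, $\beta\ge0$, $g\in L^2(\Omega)$, and $T:L^2(\Omega)^m\to L^2(\Omega)$ is bounded linear with adjoint $T^*$. $W:=L^2(\Omega)^m$; $V:=H_0^{\mathrm{div}}(\Omega)^m$ is the Hilbert space of $p\in L^2(\Omega)^{d\times m}$ whose columns have divergence in $L^2(\Omega)$ and vanishing normal trace on $\partial\Omega$, with norm $\|p\|_V^2=\|p\|_{L^2}^2+\|\mathrm{div}\,p\|_{L^2}^2$. $\Lambda:V\to W$, $\Lambda p=\mathrm{div}\,p$ (column-wise). $B:=T^*T+\beta I:W\to W$; it is assumed that there is $c_B>0$ with $\|Tu\|_{L^2}^2+\beta\|u\|_W^2\ge c_B\|u\|_W^2$ for all $u\in W$, so $B$ is boundedly invertible. $\|w\|_{B^{-1}}^2:=\langle w,B^{-1}w\rangle_W$. $K:=\{p\in V:|p(x)|_F\le\lambda\text{ for a.e. }x\in\Omega\}$ with $|\cdot|_F$ the Frobenius norm, and $\mathcal{D}(p):=\tfrac12\|\Lambda p-T^*g\|_{B^{-1}}^2$ for $p\in V$. $\|\cdot\|$ applied to operators is the operator norm. Decomposition. $M\in\mathbb{N}$ and $\theta_i:V\to V$, $i=1,\dots,M$, are bounded linear operators with $I=\sum_{i=1}^M\theta_i$ and $K=\sum_{i=1}^M\theta_iK$. Approximate minimizers. For a functional $F$ on a set $C$, $\rho\in(0,1]$ and a point $q$,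 $\arg\min^{\rho,q}_{v\in C}F(v)$ denotes the set of all $\tilde v\in C$ such that $F(q)-F(\tilde v)\ge\rho\,(F(q)-F(\hat v))$ where $\hat v\in\arg\min_{v\in C}F(v)$. Parallel decomposition algorithm ($p^0\in K$, $\sigma\in(0,\tfrac1M]$, $\rho\in(0,1]$): for $n=0,1,2,\dots$, for each $i=1,\dots,M$ choose $\tilde v_i^n\in\arg\min^{\rho,\theta_ip^n}_{v_i\in\theta_iK}\mathcal{D}\big(p^n+(v_i-\theta_ip^n)\big)$; set $p^{n+1}=p^n+\sum_{i=1}^M\sigma(\tilde v_i^n-\theta_ip^n)$. Sequential decomposition algorithm ($p^0\in K$, $\sigma\in(0,1]$, $\rho\in(0,1]$): for $n=0,1,2,\dots$ set $p_0^n=p^n$; for $i=1,\dots,M$ (in order) choose $\tilde v_i^n\in\arg\min^{\rho,\theta_ip^n}_{v_i\in\theta_iK}\mathcal{D}\big(p_{i-1}^n+(v_i-\theta_ip^n)\big)$ and set $p_i^n=p_{i-1}^n+\sigma(\tilde v_i^n-\theta_ip^n)$; finally set $p^{n+1}=p_M^n$. It is understood that the iterates are generated by the algorithm, i.e. all the selected elements exist. *)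

theory Defs
  imports "HOL-Analysis.Analysis"
begin

section \<open>Square-integrable functions modulo equality almost everywhere\<close>

definition square_integrable :: "('a::euclidean_space \<Rightarrow> 'b::euclidean_space) \<Rightarrow> bool" where
  "square_integrable f \<longleftrightarrow>
     f \<in> borel_measurable lebesgue \<and> integrable lebesgue (\<lambda>x. (norm (f x))\<^sup>2)"

definition L2_rel :: "('a::euclidean_space \<Rightarrow> 'b::euclidean_space) \<Rightarrow> ('a \<Rightarrow> 'b) \<Rightarrow> bool" where
  "L2_rel f g \<longleftrightarrow> square_integrable f \<and> square_integrable g \<and> (AE x in lebesgue. f x = g x)"

lemma square_integrable_zero: "square_integrable (\<lambda>_. 0)"
  by (simp add: square_integrable_def)

lemma square_integrable_add:
  assumes "square_integrable f" "square_integrable g"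
  shows "square_integrable (\<lambda>x. f x + g x)"
proof -
  note [measurable] = assms[unfolded square_integrable_def, THEN conjunct1]
  have "integrable lebesgue (\<lambda>x. 2 * (norm (f x))\<^sup>2 + 2 * (norm (g x))\<^sup>2)"
    using assms by (auto simp: square_integrable_def)
  then have "integrable lebesgue (\<lambda>x. (norm (f x + g x))\<^sup>2)"
  proof (rule Bochner_Integration.integrable_bound)
    show "AE x in lebesgue. norm ((norm (f x + g x))\<^sup>2)
        \<le> norm (2 * (norm (f x))\<^sup>2 + 2 * (norm (g x))\<^sup>2)"
    proof (rule AE_I2)
      fix x
      have "(norm (f x + g x))\<^sup>2 \<le> (norm (f x) + norm (g x))\<^sup>2"
        by (simp add: norm_triangle_ineq power_mono)
      also have "\<dots> \<le> 2 * (norm (f x))\<^sup>2 + 2 * (norm (g x))\<^sup>2"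
        using sum_squares_bound[of "norm (f x)" "norm (g x)"] by (simp add: power2_sum)
      finally show "norm ((norm (f x + g x))\<^sup>2)
          \<le> norm (2 * (norm (f x))\<^sup>2 + 2 * (norm (g x))\<^sup>2)"
        by simp
    qed
  qed simp
  then show ?thesis by (simp add: square_integrable_def)
qed

lemma square_integrable_scaleR:
  assumes "square_integrable f"
  shows "square_integrable (\<lambda>x. c *\<^sub>R f x)"
  using assms by (auto simp: square_integrable_def power_mult_distrib)

lemma square_integrable_uminus:
  "square_integrable f \<Longrightarrow> square_integrable (\<lambda>x. - f x)"
  using square_integrable_scaleR[of f "-1"] by simp

lemma square_integrable_diff:
  "square_integrable f \<Longrightarrow> square_integrable g \<Longrightarrow> square_integrable (\<lambda>x. f x - g x)"
  using square_integrable_add[of f "\<lambda>x. - g x"] square_integrable_uminus[of g] by simp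

lemma square_integrable_inner:
  assumes "square_integrable f" "square_integrable g"
  shows "integrable lebesgue (\<lambda>x. f x \<bullet> g x)"
proof -
  note [measurable] = assms[unfolded square_integrable_def, THEN conjunct1]
  have "integrable lebesgue (\<lambda>x. (norm (f x))\<^sup>2 + (norm (g x))\<^sup>2)"
    using assms by (auto simp: square_integrable_def)
  then show ?thesis
  proof (rule Bochner_Integration.integrable_bound)
    show "AE x in lebesgue. norm (f x \<bullet> g x) \<le> norm ((norm (f x))\<^sup>2 + (norm (g x))\<^sup>2)"
    proof (rule AE_I2)
      fix x
      have "\<bar>f x \<bullet> g x\<bar> \<le> norm (f x) * norm (g x)" by (rule Cauchy_Schwarz_ineq2)
      also have "\<dots> \<le> 2 * norm (f x) * norm (g x)" by simp
      also have "\<dots> \<le> (norm (f x))\<^sup>2 + (norm (g x))\<^sup>2" by (rule sum_squares_bound)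
      finally show "norm (f x \<bullet> g x) \<le> norm ((norm (f x))\<^sup>2 + (norm (g x))\<^sup>2)" by simp
    qed
  qed simp
qed

quotient_type (overloaded) ('a, 'b) L2 =
  "'a::euclidean_space \<Rightarrow> 'b::euclidean_space" / partial: L2_rel
proof (rule part_equivpI)
  show "\<exists>f::'a \<Rightarrow> 'b. L2_rel f f"
    by (rule exI[of _ "\<lambda>_. 0"]) (simp add: L2_rel_def square_integrable_zero)
  show "symp (L2_rel :: ('a \<Rightarrow> 'b) \<Rightarrow> _)"
    by (auto simp: symp_def L2_rel_def)
  show "transp (L2_rel :: ('a \<Rightarrow> 'b) \<Rightarrow> _)"
  proof (rule transpI)
    fix f g h :: "'a \<Rightarrow> 'b"
    assume fg: "L2_rel f g" and gh: "L2_rel g h"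
    from fg gh have "AE x in lebesgue. f x = g x" "AE x in lebesgue. g x = h x"
      by (simp_all add: L2_rel_def)
    then have "AE x in lebesgue. f x = h x" by eventually_elim simp
    with fg gh show "L2_rel f h" by (simp add: L2_rel_def)
  qed
qed

instantiation L2 :: (euclidean_space, euclidean_space) real_inner
begin

lift_definition zero_L2 :: "('a, 'b) L2" is "\<lambda>_. 0"
  by (simp add: L2_rel_def square_integrable_zero)

lift_definition plus_L2 :: "('a, 'b) L2 \<Rightarrow> ('a, 'b) L2 \<Rightarrow> ('a, 'b) L2" is "\<lambda>f g x. f x + g x"
  by (auto simp: L2_rel_def square_integrable_add elim: eventually_elim2)

lift_definition uminus_L2 :: "('a, 'b) L2 \<Rightarrow> ('a, 'b) L2" is "\<lambda>f x. - f x"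
  by (auto simp: L2_rel_def square_integrable_uminus)

lift_definition minus_L2 :: "('a, 'b) L2 \<Rightarrow> ('a, 'b) L2 \<Rightarrow> ('a, 'b) L2" is "\<lambda>f g x. f x - g x"
  by (auto simp: L2_rel_def square_integrable_diff elim: eventually_elim2)

lift_definition scaleR_L2 :: "real \<Rightarrow> ('a, 'b) L2 \<Rightarrow> ('a, 'b) L2" is "\<lambda>c f x. c *\<^sub>R f x"
  by (auto simp: L2_rel_def square_integrable_scaleR elim: eventually_mono)

lift_definition inner_L2 :: "('a, 'b) L2 \<Rightarrow> ('a, 'b) L2 \<Rightarrow> real"
  is "\<lambda>f g. LINT x|lebesgue. f x \<bullet> g x"
proof -
  fix f f' g g' :: "'a \<Rightarrow> 'b"
  assume H: "L2_rel f f'" "L2_rel g g'"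
  then have [measurable]: "f \<in> borel_measurable lebesgue" "f' \<in> borel_measurable lebesgue"
    "g \<in> borel_measurable lebesgue" "g' \<in> borel_measurable lebesgue"
    by (auto simp: L2_rel_def square_integrable_def)
  from H have "AE x in lebesgue. f x = f' x" "AE x in lebesgue. g x = g' x"
    by (simp_all add: L2_rel_def)
  then have "AE x in lebesgue. f x \<bullet> g x = f' x \<bullet> g' x" by eventually_elim simp
  then show "(LINT x|lebesgue. f x \<bullet> g x) = (LINT x|lebesgue. f' x \<bullet> g' x)"
    by (intro integral_cong_AE) auto
qed

definition norm_L2 :: "('a, 'b) L2 \<Rightarrow> real" where
  "norm_L2 f = sqrt (f \<bullet> f)"

definition dist_L2 :: "('a, 'b) L2 \<Rightarrow> ('a, 'b) L2 \<Rightarrow> real" where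
  "dist_L2 f g = norm (f - g)"

definition sgn_L2 :: "('a, 'b) L2 \<Rightarrow> ('a, 'b) L2" where
  "sgn_L2 f = inverse (norm f) *\<^sub>R f"

definition uniformity_L2 :: "(('a, 'b) L2 \<times> ('a, 'b) L2) filter" where
  "uniformity_L2 = (INF e\<in>{0 <..}. principal {(x, y). dist x y < e})"

definition open_L2 :: "('a, 'b) L2 set \<Rightarrow> bool" where
  "open_L2 U \<longleftrightarrow> (\<forall>x\<in>U. eventually (\<lambda>(x', y). x' = x \<longrightarrow> y \<in> U) uniformity)"

instance
proof
  fix a b c :: "('a, 'b) L2" and r s :: real and U :: "('a, 'b) L2 set"
  show "a + b + c = a + (b + c)"
    by transfer (auto simp: L2_rel_def add.assoc intro!: square_integrable_add)
  show "a + b = b + a"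
    by transfer (auto simp: L2_rel_def add.commute intro!: square_integrable_add)
  show "0 + a = a"
    by transfer (auto simp: L2_rel_def)
  show "- a + a = 0"
    by transfer (auto simp: L2_rel_def square_integrable_zero)
  show "a - b = a + - b"
    by transfer (auto simp: L2_rel_def square_integrable_diff)
  show "r *\<^sub>R (a + b) = r *\<^sub>R a + r *\<^sub>R b"
    by transfer (auto simp: L2_rel_def scaleR_add_right
        intro!: square_integrable_add square_integrable_scaleR)
  show "(r + s) *\<^sub>R a = r *\<^sub>R a + s *\<^sub>R a"
    by transfer (auto simp: L2_rel_def scaleR_add_left
        intro!: square_integrable_add square_integrable_scaleR)
  show "r *\<^sub>R s *\<^sub>R a = (r * s) *\<^sub>R a"
    by transfer (auto simp: L2_rel_def intro: square_integrable_scaleR)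
  show "1 *\<^sub>R a = a"
    by transfer (auto simp: L2_rel_def)
  show "dist a b = norm (a - b)" by (rule dist_L2_def)
  show "sgn a = inverse (norm a) *\<^sub>R a" by (rule sgn_L2_def)
  show "uniformity = (INF e\<in>{0 <..}. principal {(x :: ('a, 'b) L2, y). dist x y < e})"
    by (rule uniformity_L2_def)
  show "open U \<longleftrightarrow> (\<forall>x\<in>U. eventually (\<lambda>(x', y). x' = x \<longrightarrow> y \<in> U) uniformity)"
    by (rule open_L2_def)
  show "a \<bullet> b = b \<bullet> a"
    by transfer (simp add: inner_commute)
  show "(a + b) \<bullet> c = a \<bullet> c + b \<bullet> c"
    by transfer (simp add: L2_rel_def inner_add_left square_integrable_inner)
  show "(r *\<^sub>R a) \<bullet> b = r * (a \<bullet> b)"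
    by transfer simp
  show "0 \<le> a \<bullet> a"
    by transfer simp
  show "a \<bullet> a = 0 \<longleftrightarrow> a = 0"
  proof transfer
    fix f :: "'a \<Rightarrow> 'b"
    assume "L2_rel f f"
    then have f: "square_integrable f" by (simp add: L2_rel_def)
    have "(LINT x|lebesgue. f x \<bullet> f x) = 0 \<longleftrightarrow> (AE x in lebesgue. f x \<bullet> f x = 0)"
      by (rule integral_nonneg_eq_0_iff_AE) (auto intro: square_integrable_inner f)
    then show "(LINT x|lebesgue. f x \<bullet> f x) = 0 \<longleftrightarrow> L2_rel f (\<lambda>_. 0)"
      by (simp add: L2_rel_def f square_integrable_zero)
  qed
  show "norm a = sqrt (a \<bullet> a)" by (rule norm_L2_def)
qed

end

text \<open>An arbitrary representative; every use below is insensitive to the choice.\<close>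

definition L2_fun :: "('a::euclidean_space, 'b::euclidean_space) L2 \<Rightarrow> 'a \<Rightarrow> 'b" where
  "L2_fun = rep_L2"

text \<open>
  The space \<open>L\<^sup>2(\<Omega>)\<close> with values in \<open>'b\<close>, each element being extended by zero outside \<open>\<Omega>\<close>.
  This identification is isometric, so norm and inner product are those of the type \<open>L2\<close>.
  For \<open>'b = real^'m^'d\<close> the norm on \<open>'b\<close> is the Frobenius norm.
\<close>

definition L2_on :: "'a::euclidean_space set \<Rightarrow> ('a, 'b::euclidean_space) L2 set" where
  "L2_on \<Omega> = {u. AE x in lebesgue. x \<notin> \<Omega> \<longrightarrow> L2_fun u x = 0}"


section \<open>Lipschitz boundary and weak derivatives\<close>

text \<open>
  Near each boundary point \<open>\<Omega>\<close> is the set strictly above the graph of a Lipschitz function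
  over the hyperplane orthogonal to a unit vector \<open>\<nu>\<close>; \<open>x - (x \<bullet> \<nu>) *\<^sub>R \<nu>\<close> is the
  projection of \<open>x\<close> to this hyperplane. Only the values of \<open>\<gamma>\<close> on the hyperplane matter.
\<close>

definition lipschitz_boundary :: "'a::euclidean_space set \<Rightarrow> bool" where
  "lipschitz_boundary \<Omega> \<longleftrightarrow>
     (\<forall>z\<in>frontier \<Omega>. \<exists>U \<nu> \<gamma> L. open U \<and> z \<in> U \<and> norm \<nu> = 1 \<and> L-lipschitz_on UNIV \<gamma> \<and>
        \<Omega> \<inter> U = {x \<in> U. \<gamma> (x - (x \<bullet> \<nu>) *\<^sub>R \<nu>) < x \<bullet> \<nu>})"

fun C_k :: "nat \<Rightarrow> ('a::euclidean_space \<Rightarrow> real) \<Rightarrow> bool" where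
  "C_k 0 f \<longleftrightarrow> continuous_on UNIV f"
| "C_k (Suc k) f \<longleftrightarrow> (\<forall>x. f differentiable (at x)) \<and>
     (\<forall>v. C_k k (\<lambda>x. frechet_derivative f (at x) v))"

definition test_functions :: "'a::euclidean_space set \<Rightarrow> ('a \<Rightarrow> real) set" where
  "test_functions \<Omega> = {\<phi>. (\<forall>k. C_k k \<phi>) \<and> compact (closure {x. \<phi> x \<noteq> 0}) \<and>
     closure {x. \<phi> x \<noteq> 0} \<subseteq> \<Omega>}"

definition grad :: "(real^'d \<Rightarrow> real) \<Rightarrow> real^'d \<Rightarrow> real^'d" where
  "grad \<phi> x = (\<chi> i. frechet_derivative \<phi> (at x) (axis i 1))"

definition has_weak_grad ::
  "(real^'d) set \<Rightarrow> (real^'d, real) L2 \<Rightarrow> (real^'d, real^'d) L2 \<Rightarrow> bool" where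
  "has_weak_grad \<Omega> u G \<longleftrightarrow> (\<forall>\<phi>\<in>test_functions \<Omega>.
     (LINT x:\<Omega>|lebesgue. \<phi> x *\<^sub>R L2_fun G x) = - (LINT x:\<Omega>|lebesgue. L2_fun u x *\<^sub>R grad \<phi> x))"

definition H1 :: "(real^'d) set \<Rightarrow> (real^'d, real) L2 set" where
  "H1 \<Omega> = {u \<in> L2_on \<Omega>. \<exists>G\<in>L2_on \<Omega>. has_weak_grad \<Omega> u G}"

definition weak_grad :: "(real^'d) set \<Rightarrow> (real^'d, real) L2 \<Rightarrow> (real^'d, real^'d) L2" where
  "weak_grad \<Omega> u = (THE G. G \<in> L2_on \<Omega> \<and> has_weak_grad \<Omega> u G)"

text \<open>
  For a matrix field \<open>p\<close> with \<open>d\<close> rows and \<open>m\<close> columns, component \<open>j\<close> of \<open>v v* p x\<close> is the inner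
  product of \<open>v\<close> with column \<open>j\<close> of \<open>p x\<close>, so the following vector identities are
  column-wise statements.
\<close>

definition has_weak_div ::
  "(real^'d) set \<Rightarrow> (real^'d, real^'m^'d) L2 \<Rightarrow> (real^'d, real^'m) L2 \<Rightarrow> bool" where
  "has_weak_div \<Omega> p w \<longleftrightarrow> (\<forall>\<phi>\<in>test_functions \<Omega>.
     (LINT x:\<Omega>|lebesgue. \<phi> x *\<^sub>R L2_fun w x) = - (LINT x:\<Omega>|lebesgue. grad \<phi> x v* L2_fun p x))"

definition Hdiv :: "(real^'d) set \<Rightarrow> (real^'d, real^'m^'d) L2 set" where
  "Hdiv \<Omega> = {p \<in> L2_on \<Omega>. \<exists>w\<in>L2_on \<Omega>. has_weak_div \<Omega> p w}"

definition weak_div :: "(real^'d) set \<Rightarrow> (real^'d, real^'m^'d) L2 \<Rightarrow> (real^'d, real^'m) L2" where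
  "weak_div \<Omega> p = (THE w. w \<in> L2_on \<Omega> \<and> has_weak_div \<Omega> p w)"

text \<open>
  The normal trace of \<open>p\<close> as a functional on \<open>H\<^sup>1(\<Omega>)\<close>, defined by Green's formula: for smooth
  \<open>p\<close> and \<open>u\<close> it is the boundary integral of \<open>u\<close> times the normal components of the
  columns of \<open>p\<close>. It depends on \<open>u\<close> only through the trace of \<open>u\<close> on the boundary.
\<close>

definition normal_trace ::
  "(real^'d) set \<Rightarrow> (real^'d, real^'m^'d) L2 \<Rightarrow> (real^'d, real) L2 \<Rightarrow> real^'m" where
  "normal_trace \<Omega> p u =
     (LINT x:\<Omega>|lebesgue. L2_fun (weak_grad \<Omega> u) x v* L2_fun p x + L2_fun u x *\<^sub>R L2_fun (weak_div \<Omega> p) x)"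

definition H0div :: "(real^'d) set \<Rightarrow> (real^'d, real^'m^'d) L2 set" where
  "H0div \<Omega> = {p \<in> Hdiv \<Omega>. \<forall>u\<in>H1 \<Omega>. normal_trace \<Omega> p u = 0}"

definition norm_div :: "(real^'d) set \<Rightarrow> (real^'d, real^'m^'d) L2 \<Rightarrow> real" where
  "norm_div \<Omega> p = sqrt ((norm p)\<^sup>2 + (norm (weak_div \<Omega> p))\<^sup>2)"


section \<open>Operators between subspaces\<close>

definition bounded_linear_between ::
  "'x::real_vector set \<Rightarrow> ('x \<Rightarrow> real) \<Rightarrow> 'y::real_vector set \<Rightarrow> ('y \<Rightarrow> real) \<Rightarrow> ('x \<Rightarrow> 'y) \<Rightarrow> bool" where
  "bounded_linear_between X nX Y nY A \<longleftrightarrow>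
     (\<forall>x\<in>X. A x \<in> Y) \<and>
     (\<forall>x\<in>X. \<forall>y\<in>X. A (x + y) = A x + A y) \<and>
     (\<forall>c. \<forall>x\<in>X. A (c *\<^sub>R x) = c *\<^sub>R A x) \<and>
     (\<exists>C. \<forall>x\<in>X. nY (A x) \<le> C * nX x)"

text \<open>The analogue of \<^const>\<open>onorm\<close>; the zero vector contributes \<open>0 / 0 = 0\<close>.\<close>

definition op_norm :: "'x set \<Rightarrow> ('x \<Rightarrow> real) \<Rightarrow> ('y \<Rightarrow> real) \<Rightarrow> ('x \<Rightarrow> 'y) \<Rightarrow> real" where
  "op_norm X nX nY A = (SUP x\<in>X. nY (A x) / nX x)"

definition is_adjoint ::
  "'x::real_inner set \<Rightarrow> 'y::real_inner set \<Rightarrow> ('x \<Rightarrow> 'y) \<Rightarrow> ('y \<Rightarrow> 'x) \<Rightarrow> bool" where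
  "is_adjoint X Y A As \<longleftrightarrow> (\<forall>y\<in>Y. As y \<in> X) \<and> (\<forall>x\<in>X. \<forall>y\<in>Y. A x \<bullet> y = x \<bullet> As y)"


section \<open>The dual problem\<close>

definition B_op :: "('w::real_vector \<Rightarrow> 'y) \<Rightarrow> ('y \<Rightarrow> 'w) \<Rightarrow> real \<Rightarrow> 'w \<Rightarrow> 'w" where
  "B_op T Ts \<beta> u = Ts (T u) + \<beta> *\<^sub>R u"

definition B_inv :: "(real^'d) set \<Rightarrow> ((real^'d, real^'m) L2 \<Rightarrow> (real^'d, real) L2) \<Rightarrow>
    ((real^'d, real) L2 \<Rightarrow> (real^'d, real^'m) L2) \<Rightarrow> real \<Rightarrow>
    (real^'d, real^'m) L2 \<Rightarrow> (real^'d, real^'m) L2" where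
  "B_inv \<Omega> T Ts \<beta> = inv_into (L2_on \<Omega>) (B_op T Ts \<beta>)"

definition dual_energy :: "(real^'d) set \<Rightarrow> ((real^'d, real^'m) L2 \<Rightarrow> (real^'d, real) L2) \<Rightarrow>
    ((real^'d, real) L2 \<Rightarrow> (real^'d, real^'m) L2) \<Rightarrow> real \<Rightarrow> (real^'d, real) L2 \<Rightarrow>
    (real^'d, real^'m^'d) L2 \<Rightarrow> real" where
  "dual_energy \<Omega> T Ts \<beta> g p =
     1/2 * ((weak_div \<Omega> p - Ts g) \<bullet> B_inv \<Omega> T Ts \<beta> (weak_div \<Omega> p - Ts g))"

definition dual_constraint :: "(real^'d) set \<Rightarrow> real \<Rightarrow> (real^'d, real^'m^'d) L2 set" where
  "dual_constraint \<Omega> lam = {p \<in> H0div \<Omega>. AE x in lebesgue. x \<in> \<Omega> \<longrightarrow> norm (L2_fun p x) \<le> lam}"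


section \<open>Decomposition algorithms\<close>

definition approx_argmin :: "real \<Rightarrow> 'x \<Rightarrow> 'x set \<Rightarrow> ('x \<Rightarrow> real) \<Rightarrow> 'x set" where
  "approx_argmin \<rho> q C F =
     {v \<in> C. \<exists>vh. is_arg_min F (\<lambda>x. x \<in> C) vh \<and> F q - F v \<ge> \<rho> * (F q - F vh)}"

definition parallel_iterates :: "('x::real_vector \<Rightarrow> real) \<Rightarrow> 'x set \<Rightarrow> nat \<Rightarrow> (nat \<Rightarrow> 'x \<Rightarrow> 'x) \<Rightarrow>
    real \<Rightarrow> real \<Rightarrow> (nat \<Rightarrow> 'x) \<Rightarrow> bool" where
  "parallel_iterates F K M \<theta> \<sigma> \<rho> p \<longleftrightarrow> p 0 \<in> K \<and>
     (\<forall>n. \<exists>v.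
        (\<forall>i\<in>{1..M}. v i \<in> approx_argmin \<rho> (\<theta> i (p n)) (\<theta> i ` K)
                           (\<lambda>w. F (p n + (w - \<theta> i (p n))))) \<and>
        p (Suc n) = p n + (\<Sum>i=1..M. \<sigma> *\<^sub>R (v i - \<theta> i (p n))))"

definition sequential_iterates :: "('x::real_vector \<Rightarrow> real) \<Rightarrow> 'x set \<Rightarrow> nat \<Rightarrow> (nat \<Rightarrow> 'x \<Rightarrow> 'x) \<Rightarrow>
    real \<Rightarrow> real \<Rightarrow> (nat \<Rightarrow> 'x) \<Rightarrow> bool" where
  "sequential_iterates F K M \<theta> \<sigma> \<rho> p \<longleftrightarrow> p 0 \<in> K \<and>
     (\<forall>n. \<exists>v q. q 0 = p n \<and>
        (\<forall>i\<in>{1..M}. v i \<in> approx_argmin \<rho> (\<theta> i (p n)) (\<theta> i ` K)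
                           (\<lambda>w. F (q (i - 1) + (w - \<theta> i (p n)))) \<and>
                    q i = q (i - 1) + \<sigma> *\<^sub>R (v i - \<theta> i (p n))) \<and>
        p (Suc n) = q M)"

end

theory Submission
  imports Defs
begin

text \<open>
  The energy \<open>\<D>\<close> is a quadratic functional with seminorm \<open>|p|\<^sup>2 = \<langle>\<Lambda>p, B\<^sup>-\<^sup>1 \<Lambda>p\<rangle>\<close>. Let \<open>\<delta>\<^sub>i\<close> be the optimal
  gain of the \<open>i\<close>-th subproblem, \<open>S\<close> the sum of the \<open>\<delta>\<^sub>i\<close> and \<open>e\<close> the current energy gap. Convexity
  shows that one sweep lowers the energy by at least \<open>\<sigma>\<rho>S\<close>. Testing the subproblems with
  \<open>\<theta>\<^sub>i(p\<^sup>n + t(phat - p\<^sup>n))\<close> gives \<open>t e \<le> S + t\<^sup>2\<Phi>\<^sup>2/2 + t \<kappa> \<Phi> sqrt(2S)\<close> for \<open>0 \<le> t \<le> 1\<close>. The last term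
  accounts for the drift of the point of linearization within a sequential sweep: strong convexity
  bounds the \<open>i\<close>-th step by \<open>(1 + sqrt(1-\<rho>)) sqrt(2\<delta>\<^sub>i)\<close>, so \<open>\<kappa> = M\<sigma>(1 + sqrt(1-\<rho>))\<close>, whereas \<open>\<kappa> = 0\<close>
  for a parallel sweep; in both cases \<open>\<alpha> = 1 + \<kappa>\<close>. Optimizing over \<open>t\<close> gives \<open>S \<ge> e/(2\<alpha>)\<close> if
  \<open>e \<ge> \<Phi>\<^sup>2\<alpha>\<close> and \<open>S \<ge> e\<^sup>2/(2\<Phi>\<^sup>2\<alpha>\<^sup>2)\<close> otherwise, hence first linear and then sublinear decay.
\<close>

section \<open>Decay of energy gaps\<close>

text \<open>The gain inequality is implicit, since S also stands under the root. The trial value t =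
  e/(\<Phi>^2 \<alpha>) has to be cut off at 1, and this cut-off is what separates the two regimes
  at n0. Most of the remaining work goes into making the energy a distance in an inner product space
  at all. B^{-1} and the weak divergence are given by \<open>inv_into\<close> and
  \<open>THE\<close>, so nothing can be computed with them before B is known to be bijective on
  \<open>L2_on \<Omega>\<close> and weak divergences are known to be unique. The former rests on
  completeness of L^2 and a contraction, the latter on smooth bumps and the fundamental lemma of the
  calculus of variations. After that, D is half the squared distance of a linear image E p from a
  fixed vector f, and the sweeps are analysed in this setting; the norm of V enters through \<Phi>
  alone. Finiteness of R takes two separate bounds: the pointwise constraint controls the L^2 part
  of the norm but says nothing about the divergence, which is controlled by the energy.\<close>

lemma energy_decrease_bound:
  fixes e S \<Phi> \<kappa> :: real
  assumes "0 \<le> e" "0 \<le> S" "0 \<le> \<Phi>" "0 \<le> \<kappa>"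
    and gain: "\<And>t. 0 \<le> t \<Longrightarrow> t \<le> 1 \<Longrightarrow> t * e \<le> S + t\<^sup>2 / 2 * \<Phi>\<^sup>2 + t * \<kappa> * \<Phi> * sqrt (2 * S)"
  shows "\<Phi>\<^sup>2 * (1 + \<kappa>) \<le> e \<Longrightarrow> e / (2 * (1 + \<kappa>)) \<le> S"
    and "e < \<Phi>\<^sup>2 * (1 + \<kappa>) \<Longrightarrow> e\<^sup>2 / (2 * \<Phi>\<^sup>2 * (1 + \<kappa>)\<^sup>2) \<le> S"
proof -
  define x where "x = sqrt (2 * S)"
  have x: "0 \<le> x" "x\<^sup>2 = 2 * S" using assms(2) by (auto simp: x_def)
  \<comment> \<open>Resolves the implicit inequality without solving a quadratic equation: if x < y,
    the right side would be strictly below y^2/2 + y^2/2 + \<kappa> y^2, which is the left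
    side.\<close>
  have key: "y \<le> x" if y: "0 \<le> y" and le: "(1 + \<kappa>) * y\<^sup>2 \<le> x\<^sup>2 / 2 + y\<^sup>2 / 2 + \<kappa> * y * x" for y
  proof (rule ccontr)
    assume "\<not> y \<le> x"
    then have "x < y" by simp
    then have "x\<^sup>2 < y\<^sup>2" using x(1) by (simp add: power_strict_mono)
    moreover have "\<kappa> * y * x \<le> \<kappa> * y * y" using \<open>x < y\<close> y assms(4) by (intro mult_left_mono) auto
    ultimately show False using le by (simp add: power2_eq_square algebra_simps)
  qed
  show "e / (2 * (1 + \<kappa>)) \<le> S" if big: "\<Phi>\<^sup>2 * (1 + \<kappa>) \<le> e"
  proof -
    \<comment> \<open>The trial value is t = 1. The case assumption says exactly that \<Phi> \<le>
      z, so \<Phi> may be enlarged to z, and \<open>key\<close> then applies with y = z.\<close>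
    define z where "z = sqrt (e / (1 + \<kappa>))"
    have z: "0 \<le> z" "(1 + \<kappa>) * z\<^sup>2 = e" "z\<^sup>2 = e / (1 + \<kappa>)" using assms by (auto simp: z_def)
    have "\<Phi>\<^sup>2 \<le> z\<^sup>2" using big assms(4) by (simp add: z(3) field_simps)
    then have \<Phi>z: "\<Phi> \<le> z" using z(1) by (rule power2_le_imp_le)
    have "(1 + \<kappa>) * z\<^sup>2 \<le> x\<^sup>2 / 2 + \<Phi>\<^sup>2 / 2 + \<kappa> * \<Phi> * x"
      using gain[of 1] unfolding z(2) x_def[symmetric] x(2) by simp
    also have "\<dots> \<le> x\<^sup>2 / 2 + z\<^sup>2 / 2 + \<kappa> * z * x"
      using \<open>\<Phi>\<^sup>2 \<le> z\<^sup>2\<close> \<Phi>z x(1) assms(4) by (intro add_mono mult_right_mono mult_left_mono) auto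
    finally have "z \<le> x" using key[OF z(1)] by simp
    then have "z\<^sup>2 \<le> x\<^sup>2" using z(1) by (simp add: power_mono)
    then show ?thesis using assms(4) by (simp add: x(2) z(3) field_simps)
  qed
  show "e\<^sup>2 / (2 * \<Phi>\<^sup>2 * (1 + \<kappa>)\<^sup>2) \<le> S" if small: "e < \<Phi>\<^sup>2 * (1 + \<kappa>)"
  proof -
    have "\<Phi> \<noteq> 0" using small assms(1) by auto
    then have \<Phi>: "\<Phi> > 0" using assms(3) by simp
    \<comment> \<open>This t is at most 1 precisely in the present case, and it is chosen so that y
      = t \<Phi> satisfies (1 + \<kappa>) y^2 = t e, the form that \<open>key\<close>
      expects.\<close>
    define t where "t = e / (\<Phi>\<^sup>2 * (1 + \<kappa>))"
    have t: "0 \<le> t" "t \<le> 1" using small assms \<Phi> by (auto simp: t_def field_simps)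
    define y where "y = t * \<Phi>"
    have y: "0 \<le> y" using t \<Phi> by (simp add: y_def)
    have e: "e = t * \<Phi>\<^sup>2 * (1 + \<kappa>)" using \<Phi> assms(4) by (simp add: t_def)
    have "(1 + \<kappa>) * y\<^sup>2 = t * e" unfolding y_def e by (simp add: power2_eq_square algebra_simps)
    also have "\<dots> \<le> x\<^sup>2 / 2 + y\<^sup>2 / 2 + \<kappa> * y * x"
      using gain[OF t] unfolding x(2) x_def[symmetric] y_def by (simp add: power_mult_distrib algebra_simps)
    finally have "y \<le> x" using key y by simp
    then have "y\<^sup>2 \<le> x\<^sup>2" using y by (simp add: power_mono)
    moreover have "y\<^sup>2 = e\<^sup>2 / (\<Phi>\<^sup>2 * (1 + \<kappa>)\<^sup>2)"
    proof -
      have "y = e / (\<Phi> * (1 + \<kappa>))" using \<Phi> by (simp add: y_def t_def power2_eq_square)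
      then show ?thesis by (simp add: power_divide power_mult_distrib)
    qed
    ultimately show ?thesis using x(2) by (simp add: field_simps)
  qed
qed

text \<open>A large gap loses at least the fraction \<tau>/(2\<alpha>) of itself in each step. A
  small gap e loses at least e^2/C with C = 2 \<Phi>^2 \<alpha>^2/\<tau>, which is the recursion
  behind a rate of C/k. The infimum of the empty set is \<infinity>, so \<open>the_enat\<close> is
  evaluated only at finite values.\<close>

lemma energy_decay_rate:
  fixes e S :: "nat \<Rightarrow> real" and \<Phi> \<kappa> \<alpha> \<tau> :: real and n\<^sub>0 :: enat
  assumes e: "\<And>n. 0 \<le> e n" and S: "\<And>n. 0 \<le> S n" and "0 \<le> \<Phi>" "0 \<le> \<kappa>" "0 < \<tau>" "\<tau> \<le> 1"
    and step: "\<And>n. \<tau> * S n \<le> e n - e (Suc n)"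
    and gain: "\<And>n t. 0 \<le> t \<Longrightarrow> t \<le> 1 \<Longrightarrow>
      t * e n \<le> S n + t\<^sup>2 / 2 * \<Phi>\<^sup>2 + t * \<kappa> * \<Phi> * sqrt (2 * S n)"
    and \<alpha>: "\<alpha> = 1 + \<kappa>"
    and n\<^sub>0: "n\<^sub>0 = Inf (enat ` {n. e n < \<Phi>\<^sup>2 * \<alpha>})"
  shows "enat n \<le> n\<^sub>0 \<Longrightarrow> e n \<le> (1 - \<tau> / (2 * \<alpha>)) ^ n * e 0"
    and "n\<^sub>0 \<le> enat n \<Longrightarrow>
      e n \<le> 2 * \<Phi>\<^sup>2 / \<tau> * \<alpha>\<^sup>2 * inverse (real n - real (the_enat n\<^sub>0) + 1)"
    and "e \<longlonglongrightarrow> 0"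
proof -
  have \<alpha>1: "1 \<le> \<alpha>" using assms by simp
  have mono: "e (Suc n) \<le> e n" for n using step[of n] S[of n] \<open>0 < \<tau>\<close>
    by (smt (verit) mult_nonneg_nonneg)
  have dec: "decseq e" using mono by (intro decseq_SucI)
  have q: "0 \<le> 1 - \<tau> / (2 * \<alpha>)" "1 - \<tau> / (2 * \<alpha>) < 1"
    using \<alpha>1 \<open>0 < \<tau>\<close> \<open>\<tau> \<le> 1\<close> by (auto simp: field_simps)
  show linear: "e n \<le> (1 - \<tau> / (2 * \<alpha>)) ^ n * e 0" if "enat n \<le> n\<^sub>0" for n
    using that
  proof (induction n)
    case (Suc n)
    \<comment> \<open>The step from n to n + 1 uses the size of the gap at n only, so the linear
      bound still holds at the index \<open>n\<^sub>0\<close> itself.\<close>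
    have "enat n < n\<^sub>0" using Suc.prems by (metis Suc_ile_eq)
    then have "\<not> e n < \<Phi>\<^sup>2 * \<alpha>" unfolding n\<^sub>0 using INF_lower[of n "{n. e n < \<Phi>\<^sup>2 * \<alpha>}" enat] by force
    then have "e n / (2 * \<alpha>) \<le> S n"
      using energy_decrease_bound(1)[OF e S \<open>0 \<le> \<Phi>\<close> \<open>0 \<le> \<kappa>\<close> gain, of n] \<alpha> by simp
    then have "\<tau> * (e n / (2 * \<alpha>)) \<le> e n - e (Suc n)"
      using step[of n] \<open>0 < \<tau>\<close> by (smt (verit) mult_left_mono)
    then have "e (Suc n) \<le> (1 - \<tau> / (2 * \<alpha>)) * e n" by (simp add: algebra_simps)
    also have "\<dots> \<le> (1 - \<tau> / (2 * \<alpha>)) * ((1 - \<tau> / (2 * \<alpha>)) ^ n * e 0)"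
      using Suc \<open>enat n < n\<^sub>0\<close> q by (intro mult_left_mono) auto
    finally show ?case by simp
  qed simp
  have sublinear: "e n * (real n - real N + 1) \<le> 2 * \<Phi>\<^sup>2 / \<tau> * \<alpha>\<^sup>2" if N: "n\<^sub>0 = enat N" and "N \<le> n" for n N
    using \<open>N \<le> n\<close>
  proof -
    have ne: "enat ` {n. e n < \<Phi>\<^sup>2 * \<alpha>} \<noteq> {}"
    proof
      assume "enat ` {n. e n < \<Phi>\<^sup>2 * \<alpha>} = {}"
      then show False using N unfolding n\<^sub>0 by (simp add: top_enat_def)
    qed
    then obtain m where "m \<in> enat ` {n. e n < \<Phi>\<^sup>2 * \<alpha>}" by blast
    then have "n\<^sub>0 \<in> enat ` {n. e n < \<Phi>\<^sup>2 * \<alpha>}"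
      unfolding n\<^sub>0 by (rule wellorder_InfI)
    then have eN: "e N < \<Phi>\<^sup>2 * \<alpha>" using N by auto
    then have \<Phi>: "0 < \<Phi>" using e[of N] \<open>0 \<le> \<Phi>\<close> by (cases "\<Phi> = 0") auto
    define C where "C = 2 * \<Phi>\<^sup>2 / \<tau> * \<alpha>\<^sup>2"
    have C: "0 < C" using \<Phi> \<open>0 < \<tau>\<close> \<alpha>1 by (simp add: C_def)
    have quad: "(e n)\<^sup>2 / C \<le> e n - e (Suc n)" if "N \<le> n" for n
    proof -
      have "e n < \<Phi>\<^sup>2 * \<alpha>" using eN decseqD[OF dec that] by simp
      then have "(e n)\<^sup>2 / (2 * \<Phi>\<^sup>2 * \<alpha>\<^sup>2) \<le> S n"
        using energy_decrease_bound(2)[OF e S \<open>0 \<le> \<Phi>\<close> \<open>0 \<le> \<kappa>\<close> gain, of n] \<alpha> by simp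
      then have "\<tau> * ((e n)\<^sup>2 / (2 * \<Phi>\<^sup>2 * \<alpha>\<^sup>2)) \<le> \<tau> * S n"
        using \<open>0 < \<tau>\<close> by (intro mult_left_mono) auto
      then show ?thesis using step[of n] by (simp add: C_def mult.commute)
    qed
    have "e (N + k) * (real k + 1) \<le> C" for k
    proof (induction k)
      \<comment> \<open>At the switching index the gap is below \<Phi>^2 \<alpha>, and C is this
        number times 2\<alpha>/\<tau> \<ge> 1. Hence the sublinear bound can start with the
        denominator 1.\<close>
      case 0
      have "\<Phi>\<^sup>2 * \<alpha> * 1 \<le> \<Phi>\<^sup>2 * \<alpha> * (2 * \<alpha> / \<tau>)"
        using \<alpha>1 \<open>0 < \<tau>\<close> \<open>\<tau> \<le> 1\<close> by (intro mult_left_mono) (auto simp: field_simps)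
      then show ?case using eN by (simp add: C_def power2_eq_square mult_ac)
    next
      case (Suc k)
      define a where "a = e (N + k)"
      have a: "0 \<le> a" "a * (real k + 1) \<le> C" using Suc e by (auto simp: a_def)
      have "e (N + Suc k) \<le> a - a\<^sup>2 / C" using quad[of "N + k"] by (simp add: a_def)
      then have "e (N + Suc k) * (real (Suc k) + 1) \<le> (a - a\<^sup>2 / C) * (real (Suc k) + 1)"
        by (intro mult_right_mono) auto
      also have "\<dots> \<le> C"
      proof -
        \<comment> \<open>Scaling by C leaves the claim (s - s^2)(k + 2) \<le> 1 for s(k + 1) \<le>
          1. Splitting off one copy of s - s^2 bounds the left side by (1 - s) + s - s^2 = 1 -
          s^2.\<close>
        define s where "s = a / C"
        have s: "0 \<le> s" "s * (real k + 1) \<le> 1" using a C by (auto simp: s_def field_simps)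
        have "(s - s\<^sup>2) * (real k + 2) \<le> 1"
        proof -
          have "(s - s\<^sup>2) * (real k + 2) = s * (real k + 1) * (1 - s) + s - s\<^sup>2"
            by (simp add: power2_eq_square algebra_simps)
          also have "\<dots> \<le> 1 * (1 - s) + s - s\<^sup>2"
          proof -
            have "s * 1 \<le> s * (real k + 1)" using s(1) by (intro mult_left_mono) auto
            then have "0 \<le> 1 - s" using s(2) by simp
            then have "s * (real k + 1) * (1 - s) \<le> 1 * (1 - s)" using s(2) by (intro mult_right_mono)
            then show ?thesis by simp
          qed
          also have "\<dots> \<le> 1" by simp
          finally show ?thesis .
        qed
        then have "C * ((s - s\<^sup>2) * (real k + 2)) \<le> C * 1" using C by (intro mult_left_mono) auto
        moreover have "C * ((s - s\<^sup>2) * (real k + 2)) = (a - a\<^sup>2 / C) * (real (Suc k) + 1)"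
          using C by (simp add: s_def power2_eq_square field_simps)
        ultimately show ?thesis by simp
      qed
      finally show ?case .
    qed
    from this[of "n - N"] show ?thesis using \<open>N \<le> n\<close> by (simp add: C_def of_nat_diff)
  qed
  show sub': "e n \<le> 2 * \<Phi>\<^sup>2 / \<tau> * \<alpha>\<^sup>2 * inverse (real n - real (the_enat n\<^sub>0) + 1)" if le: "n\<^sub>0 \<le> enat n" for n
  proof -
    obtain N where N: "n\<^sub>0 = enat N" "N \<le> n" using le by (cases n\<^sub>0) auto
    have "0 < real n - real N + 1" using N by linarith
    then have "e n \<le> 2 * \<Phi>\<^sup>2 / \<tau> * \<alpha>\<^sup>2 / (real n - real N + 1)"
      using sublinear[OF N] by (subst pos_le_divide_eq)
    then show ?thesis by (simp only: divide_inverse N(1) the_enat.simps)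
  qed
  show "e \<longlonglongrightarrow> 0"
  proof (cases n\<^sub>0)
    case infinity
    have "(\<lambda>n. (1 - \<tau> / (2 * \<alpha>)) ^ n * e 0) \<longlonglongrightarrow> 0 * e 0"
      by (intro tendsto_mult LIMSEQ_realpow_zero tendsto_const q)
    then have lim: "(\<lambda>n. (1 - \<tau> / (2 * \<alpha>)) ^ n * e 0) \<longlonglongrightarrow> 0" by simp
    show ?thesis
      by (rule tendsto_sandwich[OF _ _ tendsto_const lim]) (use linear infinity e in simp_all)
  next
    case (enat N)
    have "filterlim (\<lambda>n. real n - real N + 1) at_top sequentially"
      by (intro filterlim_at_top_mono[OF filterlim_tendsto_add_at_top[OF tendsto_const[of "1 - real N"] filterlim_real_sequentially]])
        auto
    then have "(\<lambda>n. inverse (real n - real N + 1)) \<longlonglongrightarrow> 0"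
      by (rule tendsto_inverse_0_at_top)
    then have "(\<lambda>n. 2 * \<Phi>\<^sup>2 / \<tau> * \<alpha>\<^sup>2 * inverse (real n - real N + 1)) \<longlonglongrightarrow> 2 * \<Phi>\<^sup>2 / \<tau> * \<alpha>\<^sup>2 * 0"
      by (intro tendsto_mult tendsto_const)
    then have lim: "(\<lambda>n. 2 * \<Phi>\<^sup>2 / \<tau> * \<alpha>\<^sup>2 * inverse (real n - real N + 1)) \<longlonglongrightarrow> 0" by simp
    show ?thesis
    proof (rule tendsto_sandwich[OF _ _ tendsto_const lim])
      show "\<forall>\<^sub>F n in sequentially. e n \<le> 2 * \<Phi>\<^sup>2 / \<tau> * \<alpha>\<^sup>2 * inverse (real n - real N + 1)"
        using eventually_ge_at_top[of N] by eventually_elim (use sub' enat in auto)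
    qed (auto simp: e)
  qed
qed

section \<open>Decomposition methods for least squares functionals\<close>

text \<open>Linearity is required on V only, because the operators of the application are total
  functions whose values off V are unspecified. The energy seminorm is the norm of the image under
  E, so E may have a kernel and D need not be strictly convex.\<close>

locale decomposed_least_squares =
  fixes V K :: "'x::real_vector set" and E :: "'x \<Rightarrow> 'e::real_inner" and f :: 'e
    and D :: "'x \<Rightarrow> real" and M :: nat and \<theta> :: "nat \<Rightarrow> 'x \<Rightarrow> 'x"
  assumes subspace_V: "subspace V"
    and E_add: "x \<in> V \<Longrightarrow> y \<in> V \<Longrightarrow> E (x + y) = E x + E y"
    and E_scale: "x \<in> V \<Longrightarrow> E (c *\<^sub>R x) = c *\<^sub>R E x"
    and D_eq: "x \<in> V \<Longrightarrow> D x = 1 / 2 * (norm (E x - f))\<^sup>2"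
    and K_subset: "K \<subseteq> V" and K_convex: "convex K"
    and \<theta>_in: "i \<in> {1..M} \<Longrightarrow> x \<in> V \<Longrightarrow> \<theta> i x \<in> V"
    and \<theta>_add: "i \<in> {1..M} \<Longrightarrow> x \<in> V \<Longrightarrow> y \<in> V \<Longrightarrow> \<theta> i (x + y) = \<theta> i x + \<theta> i y"
    and \<theta>_scale: "i \<in> {1..M} \<Longrightarrow> x \<in> V \<Longrightarrow> \<theta> i (c *\<^sub>R x) = c *\<^sub>R \<theta> i x"
    and \<theta>_sum: "x \<in> V \<Longrightarrow> (\<Sum>i=1..M. \<theta> i x) = x"
    and \<theta>_K: "(\<And>i. i \<in> {1..M} \<Longrightarrow> v i \<in> \<theta> i ` K) \<Longrightarrow> (\<Sum>i=1..M. v i) \<in> K"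
begin

lemma E_diff: "x \<in> V \<Longrightarrow> y \<in> V \<Longrightarrow> E (x - y) = E x - E y"
  using E_add[of x "(-1) *\<^sub>R y"] E_scale[of y "-1"] subspace_scale[OF subspace_V, of y "-1"] by simp

lemma \<theta>_diff: "i \<in> {1..M} \<Longrightarrow> x \<in> V \<Longrightarrow> y \<in> V \<Longrightarrow> \<theta> i (x - y) = \<theta> i x - \<theta> i y"
  using \<theta>_add[of i x "(-1) *\<^sub>R y"] \<theta>_scale[of i y "-1"] subspace_scale[OF subspace_V, of y "-1"] by simp

lemma E_sum: "(\<And>i. i \<in> A \<Longrightarrow> x i \<in> V) \<Longrightarrow> E (\<Sum>i\<in>A. x i) = (\<Sum>i\<in>A. E (x i))"
proof (induction A rule: infinite_finite_induct)
  case (insert a A)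
  then show ?case using E_add[of "x a" "\<Sum>i\<in>A. x i"] subspace_sum[OF subspace_V, of A x] by simp
qed (use E_scale[of 0 0] subspace_0[OF subspace_V] in auto)

lemma \<theta>_image_subset: "i \<in> {1..M} \<Longrightarrow> \<theta> i ` K \<subseteq> V"
  using \<theta>_in K_subset by blast

lemma \<theta>_image_convex:
  assumes i: "i \<in> {1..M}" and "a \<in> \<theta> i ` K" "b \<in> \<theta> i ` K" "0 \<le> t" "t \<le> 1"
  shows "a + t *\<^sub>R (b - a) \<in> \<theta> i ` K"
proof -
  from assms obtain x y where xy: "x \<in> K" "y \<in> K" "a = \<theta> i x" "b = \<theta> i y" by blast
  have "(1 - t) *\<^sub>R x + t *\<^sub>R y \<in> K" using K_convex xy assms by (simp add: convex_alt)
  moreover have "\<theta> i ((1 - t) *\<^sub>R x + t *\<^sub>R y) = a + t *\<^sub>R (b - a)"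
  proof -
    have V: "x \<in> V" "y \<in> V" using xy K_subset by auto
    then have "\<theta> i ((1 - t) *\<^sub>R x + t *\<^sub>R y) = (1 - t) *\<^sub>R a + t *\<^sub>R b"
      using xy i subspace_scale[OF subspace_V] by (simp add: \<theta>_add \<theta>_scale)
    then show ?thesis by (simp add: algebra_simps)
  qed
  ultimately show ?thesis by (metis imageI)
qed

lemma D_add:
  assumes "x \<in> V" "h \<in> V"
  shows "D (x + h) = D x + (E x - f) \<bullet> E h + 1 / 2 * (norm (E h))\<^sup>2"
  using assms subspace_add[OF subspace_V assms]
  by (simp add: D_eq E_add power2_norm_eq_inner inner_add_left inner_add_right inner_diff_left
      inner_diff_right inner_commute algebra_simps)

lemma D_line:
  assumes "x \<in> V" "h \<in> V"
  shows "D (x + t *\<^sub>R h) = D x + t * ((E x - f) \<bullet> E h) + t\<^sup>2 / 2 * (norm (E h))\<^sup>2"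
  using D_add[OF assms(1) subspace_scale[OF subspace_V assms(2)], of t] assms(2)
  by (simp add: E_scale power_mult_distrib)

lemma D_gradient_le:
  assumes "x \<in> V" "y \<in> V"
  shows "D x - D y \<le> - ((E x - f) \<bullet> E (y - x))"
  using D_add[OF assms(1) subspace_diff[OF subspace_V assms(2,1)]] by simp

text \<open>Convexity along the segment: a step shortened by \<sigma> keeps at least the fraction
  \<sigma> of the full decrease. For the quadratic D this is \<sigma>^2 \<le> \<sigma>.\<close>

lemma relaxed_step_decrease:
  assumes "x \<in> V" "h \<in> V" "0 \<le> \<sigma>" "\<sigma> \<le> 1"
  shows "\<sigma> * (D x - D (x + h)) \<le> D x - D (x + \<sigma> *\<^sub>R h)"
proof -
  have "\<sigma>\<^sup>2 \<le> \<sigma>" using assms by (simp add: power2_eq_square mult_left_le)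
  then have "\<sigma>\<^sup>2 * (norm (E h))\<^sup>2 \<le> \<sigma> * (norm (E h))\<^sup>2" by (intro mult_right_mono) auto
  then show ?thesis unfolding D_line[OF assms(1,2), of \<sigma>] D_add[OF assms(1,2)]
    by (simp add: algebra_simps)
qed

lemma convex_on_D: "convex_on V D"
proof (rule convex_onI)
  fix t :: real and x y assume "0 < t" "t < 1" and xy: "x \<in> V" "y \<in> V"
  then have "t * (D x - D (x + (y - x))) \<le> D x - D (x + t *\<^sub>R (y - x))"
    by (intro relaxed_step_decrease subspace_diff[OF subspace_V]) auto
  then show "D ((1 - t) *\<^sub>R x + t *\<^sub>R y) \<le> (1 - t) * D x + t * D y"
    by (simp add: algebra_simps)
next
  show "convex V" using subspace_V by (rule subspace_imp_convex)
qed

text \<open>Here r is the point at which the subproblem is posed and x the start of the sweep; they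
  coincide in a parallel sweep. The number \<delta> stands for the gain of an exact minimizer. The
  last clause compares it with the trial point that moves from \<theta>_i x towards \<theta>_i y by
  the fraction t.\<close>

definition subproblem_gain :: "real \<Rightarrow> 'x \<Rightarrow> 'x \<Rightarrow> nat \<Rightarrow> 'x \<Rightarrow> real \<Rightarrow> bool" where
  "subproblem_gain \<rho> r x i v \<delta> \<longleftrightarrow> 0 \<le> \<delta> \<and> \<rho> * \<delta> \<le> D r - D (r + (v - \<theta> i x)) \<and>
    norm (E (v - \<theta> i x)) \<le> (1 + sqrt (1 - \<rho>)) * sqrt (2 * \<delta>) \<and>
    (\<forall>y\<in>K. \<forall>t\<in>{0..1}.
      - t * ((E r - f) \<bullet> E (\<theta> i (y - x))) - t\<^sup>2 / 2 * (norm (E (\<theta> i (y - x))))\<^sup>2 \<le> \<delta>)"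

lemma subproblem_gainD:
  assumes "subproblem_gain \<rho> r x i v \<delta>"
  shows "0 \<le> \<delta>" "\<rho> * \<delta> \<le> D r - D (r + (v - \<theta> i x))"
    "norm (E (v - \<theta> i x)) \<le> (1 + sqrt (1 - \<rho>)) * sqrt (2 * \<delta>)"
    "y \<in> K \<Longrightarrow> 0 \<le> t \<Longrightarrow> t \<le> 1 \<Longrightarrow>
      - t * ((E r - f) \<bullet> E (\<theta> i (y - x))) \<le> \<delta> + t\<^sup>2 / 2 * (norm (E (\<theta> i (y - x))))\<^sup>2"
proof -
  show "0 \<le> \<delta>" "\<rho> * \<delta> \<le> D r - D (r + (v - \<theta> i x))"
    "norm (E (v - \<theta> i x)) \<le> (1 + sqrt (1 - \<rho>)) * sqrt (2 * \<delta>)"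
    using assms by (auto simp: subproblem_gain_def)
  assume "y \<in> K" "0 \<le> t" "t \<le> 1"
  then have "- t * ((E r - f) \<bullet> E (\<theta> i (y - x))) - t\<^sup>2 / 2 * (norm (E (\<theta> i (y - x))))\<^sup>2 \<le> \<delta>"
    using assms unfolding subproblem_gain_def atLeastAtMost_iff Ball_def by blast
  then show "- t * ((E r - f) \<bullet> E (\<theta> i (y - x))) \<le> \<delta> + t\<^sup>2 / 2 * (norm (E (\<theta> i (y - x))))\<^sup>2"
    by linarith
qed

text \<open>Witnessed by the gain of an exact minimizer. Strong convexity in the seminorm \<open>norm (E _)\<close>
  turns near-optimality of \<open>v\<close> into the bound on the length of the step.\<close>

lemma subproblem_gain_exists:
  assumes i: "i \<in> {1..M}" and r: "r \<in> V" and x: "x \<in> K" and \<rho>: "0 < \<rho>" "\<rho> \<le> 1"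
    and v: "v \<in> approx_argmin \<rho> (\<theta> i x) (\<theta> i ` K) (\<lambda>w. D (r + (w - \<theta> i x)))"
  shows "\<exists>\<delta>. subproblem_gain \<rho> r x i v \<delta>"
proof -
  define a where "a = \<theta> i x"
  have a: "a \<in> \<theta> i ` K" "a \<in> V" using x i \<theta>_image_subset by (auto simp: a_def)
  from v obtain vh where v_in: "v \<in> \<theta> i ` K" and vh: "is_arg_min (\<lambda>w. D (r + (w - a))) (\<lambda>w. w \<in> \<theta> i ` K) vh"
    and v_le: "\<rho> * (D r - D (r + (vh - a))) \<le> D r - D (r + (v - a))"
    by (auto simp: approx_argmin_def a_def)
  have vh_in: "vh \<in> \<theta> i ` K" using vh by (simp add: is_arg_min_def)
  have min: "D (r + (vh - a)) \<le> D (r + (w - a))" if "w \<in> \<theta> i ` K" for w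
    using vh that by (auto simp: is_arg_min_linorder)
  have in_V: "w \<in> V" if "w \<in> \<theta> i ` K" for w using that \<theta>_image_subset[OF i] by blast
  have V: "w - a \<in> V" "w - vh \<in> V" "r + (w - a) \<in> V" if "w \<in> \<theta> i ` K" for w
    using in_V[OF that] in_V[OF vh_in] a(2) r
    by (simp_all add: subspace_diff[OF subspace_V] subspace_add[OF subspace_V])
  define \<delta> where "\<delta> = D r - D (r + (vh - a))"
  have \<delta>0: "0 \<le> \<delta>" using min[OF a(1)] by (simp add: \<delta>_def)
  \<comment> \<open>Quadratic growth at the minimizer. Minimality along the segment to w, divided by
    t, gives G + t/2 |w - vh|^2 \<ge> 0; letting t tend to 0 yields the variational inequality G
    \<ge> 0, and the expansion of D around the minimizer is exact.\<close>
  have strong: "1 / 2 * (norm (E (w - vh)))\<^sup>2 \<le> D (r + (w - a)) - D (r + (vh - a))" if w: "w \<in> \<theta> i ` K" for w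
  proof -
    define G where "G = (E (r + (vh - a)) - f) \<bullet> E (w - vh)"
    have nonneg: "0 \<le> G + t / 2 * (norm (E (w - vh)))\<^sup>2" if t: "0 < t" "t \<le> 1" for t
    proof -
      have "vh + t *\<^sub>R (w - vh) \<in> \<theta> i ` K" using \<theta>_image_convex[OF i vh_in w] t by simp
      from min[OF this] have "D (r + (vh - a)) \<le> D (r + (vh - a) + t *\<^sub>R (w - vh))"
        by (simp add: algebra_simps)
      also have "\<dots> = D (r + (vh - a)) + t * G + t\<^sup>2 / 2 * (norm (E (w - vh)))\<^sup>2"
        unfolding G_def by (rule D_line[OF V(3)[OF vh_in] V(2)[OF w]])
      finally have "0 \<le> t * (G + t / 2 * (norm (E (w - vh)))\<^sup>2)"
        by (simp add: power2_eq_square algebra_simps)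
      then show ?thesis using t by (simp add: zero_le_mult_iff)
    qed
    have "0 \<le> G"
    proof (rule tendsto_lowerbound)
      show "((\<lambda>t. G + t / 2 * (norm (E (w - vh)))\<^sup>2) \<longlongrightarrow> G) (at_right 0)"
        by (auto intro!: tendsto_eq_intros)
      show "\<forall>\<^sub>F t in at_right 0. 0 \<le> G + t / 2 * (norm (E (w - vh)))\<^sup>2"
        unfolding eventually_at_right_field by (rule exI[of _ 1]) (use nonneg in simp)
    qed simp
    moreover have "D (r + (w - a)) = D (r + (vh - a)) + G + 1 / 2 * (norm (E (w - vh)))\<^sup>2"
      using D_add[OF V(3)[OF vh_in] V(2)[OF w]] by (simp add: G_def algebra_simps)
    ultimately show ?thesis by simp
  qed
  have n1: "norm (E (a - vh)) \<le> sqrt (2 * \<delta>)"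
    using strong[OF a(1)] by (intro real_le_rsqrt) (simp add: \<delta>_def)
  \<comment> \<open>The candidate v attains at least the fraction \<rho> of the optimal gain, so it
    misses the optimum by at most (1 - \<rho>) \<delta>. This is the origin of sqrt(1 - \<rho>); the
    summand 1 comes from the distance between \<theta>_i x and the exact minimizer.\<close>
  have "1 / 2 * (norm (E (v - vh)))\<^sup>2 \<le> (1 - \<rho>) * \<delta>"
    using strong[OF v_in] v_le by (simp add: \<delta>_def algebra_simps)
  then have "norm (E (v - vh)) \<le> sqrt ((1 - \<rho>) * (2 * \<delta>))"
    by (intro real_le_rsqrt) simp
  then have n2: "norm (E (v - vh)) \<le> sqrt (1 - \<rho>) * sqrt (2 * \<delta>)" by (simp only: real_sqrt_mult)
  have "E (v - a) = E (v - vh) - E (a - vh)"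
    using E_diff[OF V(2)[OF v_in] V(2)[OF a(1)]] by simp
  then have "norm (E (v - a)) \<le> norm (E (v - vh)) + norm (E (a - vh))"
    by (simp add: norm_triangle_ineq4)
  then have n: "norm (E (v - a)) \<le> (1 + sqrt (1 - \<rho>)) * sqrt (2 * \<delta>)"
    using n1 n2 by (simp add: algebra_simps)
  have gain: "- t * ((E r - f) \<bullet> E (\<theta> i (y - x))) - t\<^sup>2 / 2 * (norm (E (\<theta> i (y - x))))\<^sup>2 \<le> \<delta>"
    if y: "y \<in> K" and t: "0 \<le> t" "t \<le> 1" for y t
  proof -
    have d: "\<theta> i (y - x) = \<theta> i y - a" unfolding a_def using y x K_subset i by (intro \<theta>_diff) auto
    have y': "\<theta> i y \<in> \<theta> i ` K" using y by simp
    have "D (r + (vh - a)) \<le> D (r + t *\<^sub>R (\<theta> i y - a))"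
      using min[OF \<theta>_image_convex[OF i a(1) y' t]] by (simp add: algebra_simps)
    also have "\<dots> = D r + t * ((E r - f) \<bullet> E (\<theta> i y - a)) + t\<^sup>2 / 2 * (norm (E (\<theta> i y - a)))\<^sup>2"
      by (rule D_line[OF r V(1)[OF y']])
    finally show ?thesis unfolding \<delta>_def d by simp
  qed
  have "\<rho> * \<delta> \<le> D r - D (r + (v - a))" using v_le by (simp add: \<delta>_def)
  then have "subproblem_gain \<rho> r x i v \<delta>"
    unfolding subproblem_gain_def a_def[symmetric] using \<delta>0 n gain by simp
  then show ?thesis by blast
qed

text \<open>Each component moves inside its own convex set \<theta>_i K, and K contains every sum of
  points chosen independently from these sets. Feasibility thus survives different step sizes and
  components that come from unrelated elements of K.\<close>

lemma \<theta>_blend_in_K: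
  assumes "x \<in> K" "\<And>i. i \<in> {1..M} \<Longrightarrow> v i \<in> \<theta> i ` K"
    and "\<And>i. i \<in> {1..M} \<Longrightarrow> 0 \<le> s i \<and> s i \<le> 1"
  shows "x + (\<Sum>i=1..M. s i *\<^sub>R (v i - \<theta> i x)) \<in> K"
proof -
  have "(\<Sum>i=1..M. \<theta> i x + s i *\<^sub>R (v i - \<theta> i x)) \<in> K"
    using assms by (intro \<theta>_K \<theta>_image_convex) auto
  then show ?thesis using \<theta>_sum[of x] assms(1) K_subset by (auto simp: sum.distrib)
qed

text \<open>The condition \<sigma> \<le> 1/M makes the update a step from x by the fraction M
  \<sigma> \<le> 1 towards the average of the M separately updated points. Jensen's inequality
  handles the average, and relaxation handles the fraction.\<close>

lemma parallel_step:
  assumes M: "M \<ge> 1" and x: "x \<in> K" and \<rho>: "0 < \<rho>" "\<rho> \<le> 1" and \<sigma>: "0 < \<sigma>" "\<sigma> \<le> 1 / real M"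
    and v: "\<And>i. i \<in> {1..M} \<Longrightarrow>
      v i \<in> approx_argmin \<rho> (\<theta> i x) (\<theta> i ` K) (\<lambda>w. D (x + (w - \<theta> i x)))"
    and x': "x' = x + (\<Sum>i=1..M. \<sigma> *\<^sub>R (v i - \<theta> i x))"
  obtains S where "x' \<in> K" "0 \<le> S" "\<sigma> * \<rho> * S \<le> D x - D x'"
    and "\<And>y t. y \<in> K \<Longrightarrow> 0 \<le> t \<Longrightarrow> t \<le> 1 \<Longrightarrow>
      t * (D x - D y) \<le> S + t\<^sup>2 / 2 * (\<Sum>i=1..M. (norm (E (\<theta> i (y - x))))\<^sup>2)"
proof -
  have xV: "x \<in> V" using x K_subset by blast
  have vin: "v i \<in> \<theta> i ` K" if "i \<in> {1..M}" for i using v[OF that] by (auto simp: approx_argmin_def)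
  have "\<forall>i\<in>{1..M}. \<exists>\<delta>. subproblem_gain \<rho> x x i (v i) \<delta>"
    using subproblem_gain_exists[OF _ xV x \<rho> v] by blast
  then obtain \<delta> where \<delta>: "\<And>i. i \<in> {1..M} \<Longrightarrow> subproblem_gain \<rho> x x i (v i) (\<delta> i)"
    by metis
  define S where "S = (\<Sum>i=1..M. \<delta> i)"
  have M\<sigma>: "real M * \<sigma> \<le> 1" using \<sigma> M by (simp add: field_simps)
  have \<sigma>1: "\<sigma> \<le> 1" using \<sigma> M by (smt (verit) divide_le_eq_1 of_nat_1 of_nat_mono)
  have V: "v i - \<theta> i x \<in> V" if "i \<in> {1..M}" for i
    using vin[OF that] \<theta>_image_subset[OF that] \<theta>_in[OF that xV] subspace_diff[OF subspace_V] by blast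
  have conv: "D x' \<le> D x - \<sigma> * (\<Sum>i=1..M. D x - D (x + (v i - \<theta> i x)))"
  proof -
    define H where "H = (\<Sum>i=1..M. v i - \<theta> i x)"
    define mean where "mean = (1 / real M) *\<^sub>R H"
    have HV: "H \<in> V" unfolding H_def using V by (intro subspace_sum[OF subspace_V])
    have meanV: "mean \<in> V" unfolding mean_def using HV by (intro subspace_scale[OF subspace_V])
    have "D (\<Sum>i\<in>{1..M}. (1 / real M) *\<^sub>R (x + (v i - \<theta> i x)))
        \<le> (\<Sum>i\<in>{1..M}. (1 / real M) * D (x + (v i - \<theta> i x)))"
      using M V xV subspace_add[OF subspace_V] by (intro convex_on_sum[OF _ _ convex_on_D]) auto
    moreover have "(\<Sum>i\<in>{1..M}. (1 / real M) *\<^sub>R (x + (v i - \<theta> i x))) = x + mean"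
      using M unfolding mean_def H_def scaleR_sum_right[symmetric]
      by (simp add: sum.distrib scaleR_add_right sum_constant_scaleR del: sum_constant)
    ultimately have "D (x + mean) \<le> 1 / real M * (\<Sum>i\<in>{1..M}. D (x + (v i - \<theta> i x)))"
      by (simp add: sum_distrib_left)
    then have "real M * D (x + mean) \<le> (\<Sum>i\<in>{1..M}. D (x + (v i - \<theta> i x)))"
      using M by (simp add: field_simps)
    then have "\<sigma> * (\<Sum>i=1..M. D x - D (x + (v i - \<theta> i x))) \<le> \<sigma> * (real M * (D x - D (x + mean)))"
      using \<sigma> by (intro mult_left_mono) (auto simp: sum_subtractf algebra_simps)
    also have "\<dots> \<le> D x - D (x + (real M * \<sigma>) *\<^sub>R mean)"
      using relaxed_step_decrease[OF xV meanV, of "real M * \<sigma>"] M\<sigma> \<sigma> by (simp add: mult_ac)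
    also have "x + (real M * \<sigma>) *\<^sub>R mean = x'"
      using M unfolding x' mean_def H_def by (simp add: scaleR_sum_right)
    finally show ?thesis by simp
  qed
  have "\<sigma> * \<rho> * S \<le> D x - D x'"
  proof -
    have "\<sigma> * \<rho> * S = \<sigma> * (\<Sum>i=1..M. \<rho> * \<delta> i)" by (simp add: S_def sum_distrib_left mult_ac)
    also have "\<dots> \<le> \<sigma> * (\<Sum>i=1..M. D x - D (x + (v i - \<theta> i x)))"
      using \<sigma> subproblem_gainD(2)[OF \<delta>] by (intro mult_left_mono sum_mono) auto
    finally show ?thesis using conv by simp
  qed
  moreover have "t * (D x - D y) \<le> S + t\<^sup>2 / 2 * (\<Sum>i=1..M. (norm (E (\<theta> i (y - x))))\<^sup>2)"
    if y: "y \<in> K" and t: "0 \<le> t" "t \<le> 1" for y t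
  proof -
    have yV: "y - x \<in> V" using y xV K_subset subspace_diff[OF subspace_V] by blast
    \<comment> \<open>Convexity bounds the gap by the derivative of D at x in the direction of y.
      That derivative splits along the decomposition of y - x, and each piece is bounded by the gain
      of its own subproblem.\<close>
    have "t * (D x - D y) \<le> t * - ((E x - f) \<bullet> E (y - x))"
      using D_gradient_le[OF xV, of y] y K_subset t by (intro mult_left_mono) auto
    also have "E (y - x) = (\<Sum>i=1..M. E (\<theta> i (y - x)))"
      using E_sum[of "{1..M}" "\<lambda>i. \<theta> i (y - x)"] \<theta>_sum[OF yV] \<theta>_in yV by simp
    also have "t * - ((E x - f) \<bullet> (\<Sum>i=1..M. E (\<theta> i (y - x))))
        = (\<Sum>i=1..M. - t * ((E x - f) \<bullet> E (\<theta> i (y - x))))"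
      by (simp add: inner_sum_right sum_distrib_left sum_negf)
    also have "\<dots> \<le> (\<Sum>i=1..M. \<delta> i + t\<^sup>2 / 2 * (norm (E (\<theta> i (y - x))))\<^sup>2)"
      using subproblem_gainD(4)[OF \<delta> y t] by (intro sum_mono)
    also have "\<dots> = S + t\<^sup>2 / 2 * (\<Sum>i=1..M. (norm (E (\<theta> i (y - x))))\<^sup>2)"
      by (simp add: S_def sum.distrib sum_distrib_left)
    finally show ?thesis .
  qed
  moreover have "x' \<in> K" unfolding x' using x vin \<sigma> \<sigma>1 by (intro \<theta>_blend_in_K) auto
  moreover have "0 \<le> S" unfolding S_def using subproblem_gainD(1)[OF \<delta>] by (intro sum_nonneg)
  ultimately show thesis using that by blast
qed

text \<open>The i-th gain controls the derivative at q (i - 1), whereas the gap is governed by the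
  derivative at x. The mismatch is E (q (i - 1) - x), a sum of earlier steps, whose lengths are
  bounded through their own gains.\<close>

lemma sequential_step:
  assumes x: "x \<in> K" and \<rho>: "0 < \<rho>" "\<rho> \<le> 1" and \<sigma>: "0 < \<sigma>" "\<sigma> \<le> 1"
    and q0: "q 0 = x"
    and v: "\<And>i. i \<in> {1..M} \<Longrightarrow>
      v i \<in> approx_argmin \<rho> (\<theta> i x) (\<theta> i ` K) (\<lambda>w. D (q (i - 1) + (w - \<theta> i x)))"
    and q: "\<And>i. i \<in> {1..M} \<Longrightarrow> q i = q (i - 1) + \<sigma> *\<^sub>R (v i - \<theta> i x)"
    and \<kappa>: "\<kappa> = real M * \<sigma> * (1 + sqrt (1 - \<rho>))"
  obtains S where "q M \<in> K" "0 \<le> S" "\<sigma> * \<rho> * S \<le> D x - D (q M)"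
    and "\<And>y t. y \<in> K \<Longrightarrow> 0 \<le> t \<Longrightarrow> t \<le> 1 \<Longrightarrow>
      t * (D x - D y) \<le> S + t\<^sup>2 / 2 * (\<Sum>i=1..M. (norm (E (\<theta> i (y - x))))\<^sup>2)
        + t * \<kappa> * sqrt (\<Sum>i=1..M. (norm (E (\<theta> i (y - x))))\<^sup>2) * sqrt (2 * S)"
proof -
  have xV: "x \<in> V" using x K_subset by blast
  have vin: "v i \<in> \<theta> i ` K" if "i \<in> {1..M}" for i using v[OF that] by (auto simp: approx_argmin_def)
  have V: "v i - \<theta> i x \<in> V" if "i \<in> {1..M}" for i
    using vin[OF that] \<theta>_image_subset[OF that] \<theta>_in[OF that xV] subspace_diff[OF subspace_V] by blast
  have q_eq: "q j = x + (\<Sum>i=1..j. \<sigma> *\<^sub>R (v i - \<theta> i x))" if "j \<le> M" for j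
    using that
  proof (induction j)
    case (Suc j)
    then show ?case using q[of "Suc j"] by (simp add: add.assoc)
  qed (simp add: q0)
  have qV: "q j \<in> V" if "j \<le> M" for j
    unfolding q_eq[OF that] using that V
    by (intro subspace_add[OF subspace_V xV] subspace_sum[OF subspace_V] subspace_scale[OF subspace_V]) auto
  define c where "c = 1 + sqrt (1 - \<rho>)"
  have c: "0 \<le> c" using \<rho> by (simp add: c_def)
  have "\<forall>i\<in>{1..M}. \<exists>\<delta>. subproblem_gain \<rho> (q (i - 1)) x i (v i) \<delta>"
  proof
    fix i assume i: "i \<in> {1..M}"
    then have "q (i - 1) \<in> V" by (intro qV) auto
    then show "\<exists>\<delta>. subproblem_gain \<rho> (q (i - 1)) x i (v i) \<delta>"
      using subproblem_gain_exists[OF i _ x \<rho> v[OF i]] by blast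
  qed
  then obtain \<delta> where \<delta>: "\<And>i. i \<in> {1..M} \<Longrightarrow> subproblem_gain \<rho> (q (i - 1)) x i (v i) (\<delta> i)"
    by metis
  note \<delta>_nonneg = subproblem_gainD(1)[OF \<delta>]
  define S where "S = (\<Sum>i=1..M. \<delta> i)"
  have S0: "0 \<le> S" unfolding S_def using \<delta>_nonneg by (intro sum_nonneg)
  have sub: "\<sigma> * \<rho> * \<delta> i \<le> D (q (i - 1)) - D (q i)" if i: "i \<in> {1..M}" for i
  proof -
    have "\<sigma> * (\<rho> * \<delta> i) \<le> \<sigma> * (D (q (i - 1)) - D (q (i - 1) + (v i - \<theta> i x)))"
      using \<sigma> subproblem_gainD(2)[OF \<delta>[OF i]] by (intro mult_left_mono) auto
    also have "\<dots> \<le> D (q (i - 1)) - D (q i)"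
      unfolding q[OF i] using i \<sigma> by (intro relaxed_step_decrease qV V) auto
    finally show ?thesis by (simp add: mult.assoc)
  qed
  have "\<sigma> * \<rho> * (\<Sum>i=1..j. \<delta> i) \<le> D x - D (q j)" if "j \<le> M" for j
    using that
  proof (induction j)
    case (Suc j)
    then show ?case using sub[of "Suc j"] by (simp add: algebra_simps)
  qed (simp add: q0)
  then have decr: "\<sigma> * \<rho> * S \<le> D x - D (q M)" by (simp add: S_def)
  \<comment> \<open>Cauchy--Schwarz against the constant 1. It contributes one factor sqrt M;
    summing the pieces w i contributes the other, and together they give the M in \<kappa>.\<close>
  have root_sum: "(\<Sum>i=1..M. sqrt (2 * \<delta> i)) \<le> sqrt (real M) * sqrt (2 * S)"
  proof -
    have "(\<Sum>i=1..M. 1 * sqrt (2 * \<delta> i)) \<le> L2_set (\<lambda>_. 1) {1..M} * L2_set (\<lambda>i. sqrt (2 * \<delta> i)) {1..M}"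
      using L2_set_mult_ineq[of "\<lambda>_. 1" "\<lambda>i. sqrt (2 * \<delta> i)" "{1..M}"] \<delta>_nonneg by simp
    also have "L2_set (\<lambda>i. sqrt (2 * \<delta> i)) {1..M} = sqrt (2 * S)"
      using \<delta>_nonneg by (simp add: L2_set_def S_def sum_distrib_left)
    finally show ?thesis by (simp add: L2_set_def)
  qed
  have drift: "norm (E (q j - x)) \<le> \<sigma> * c * (sqrt (real M) * sqrt (2 * S))" if j: "j \<le> M" for j
  proof -
    have "E (q j - x) = (\<Sum>i=1..j. E (\<sigma> *\<^sub>R (v i - \<theta> i x)))"
      unfolding q_eq[OF j] add_diff_cancel_left'
      using V j by (intro E_sum subspace_scale[OF subspace_V]) auto
    also have "norm \<dots> \<le> (\<Sum>i=1..j. \<sigma> * (c * sqrt (2 * \<delta> i)))"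
      using j \<sigma> subproblem_gainD(3)[OF \<delta>, folded c_def] V by (intro sum_norm_le) (auto simp: E_scale intro!: mult_left_mono)
    \<comment> \<open>Extending the sum to all M steps makes the drift bound uniform in j, at the
      price of also counting steps that have not yet been made.\<close>
    also have "\<dots> \<le> (\<Sum>i=1..M. \<sigma> * (c * sqrt (2 * \<delta> i)))"
      using j \<sigma> c \<delta>_nonneg by (intro sum_mono2) auto
    also have "\<dots> = \<sigma> * c * (\<Sum>i=1..M. sqrt (2 * \<delta> i))" by (simp add: sum_distrib_left mult.assoc)
    also have "\<dots> \<le> \<sigma> * c * (sqrt (real M) * sqrt (2 * S))"
      using \<sigma> c root_sum by (intro mult_left_mono) auto
    finally show ?thesis .
  qed
  have "t * (D x - D y) \<le> S + t\<^sup>2 / 2 * (\<Sum>i=1..M. (norm (E (\<theta> i (y - x))))\<^sup>2)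
        + t * \<kappa> * sqrt (\<Sum>i=1..M. (norm (E (\<theta> i (y - x))))\<^sup>2) * sqrt (2 * S)"
    if y: "y \<in> K" and t: "0 \<le> t" "t \<le> 1" for y t
  proof -
    define w where "w i = E (\<theta> i (y - x))" for i
    define \<Psi> where "\<Psi> = (\<Sum>i=1..M. (norm (w i))\<^sup>2)"
    have yV: "y - x \<in> V" using y xV K_subset subspace_diff[OF subspace_V] by blast
    have w_sum: "(\<Sum>i=1..M. norm (w i)) \<le> sqrt (real M) * sqrt \<Psi>"
      using L2_set_mult_ineq[of "\<lambda>_. 1" "\<lambda>i. norm (w i)" "{1..M}"] by (simp add: L2_set_def \<Psi>_def)
    have "E (y - x) = (\<Sum>i=1..M. w i)"
      using E_sum[of "{1..M}" "\<lambda>i. \<theta> i (y - x)"] \<theta>_sum[OF yV] \<theta>_in yV by (simp add: w_def)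
    then have "- ((E x - f) \<bullet> E (y - x)) = (\<Sum>i=1..M. - ((E x - f) \<bullet> w i))"
      by (simp add: inner_sum_right sum_negf)
    \<comment> \<open>Moves the linearization in the i-th term from x to q (i - 1), where the i-th
      subproblem was solved; the second sum collects the resulting errors.\<close>
    also have "\<dots> = (\<Sum>i=1..M. - ((E (q (i - 1)) - f) \<bullet> w i)) + (\<Sum>i=1..M. E (q (i - 1) - x) \<bullet> w i)"
      unfolding sum.distrib[symmetric]
    proof (intro sum.cong refl)
      fix i assume "i \<in> {1..M}"
      then have "E (q (i - 1) - x) = E (q (i - 1)) - E x" using qV xV by (intro E_diff) auto
      then show "- ((E x - f) \<bullet> w i) = - ((E (q (i - 1)) - f) \<bullet> w i) + E (q (i - 1) - x) \<bullet> w i"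
        by (simp add: inner_diff_left)
    qed
    finally have split: "- ((E x - f) \<bullet> E (y - x)) = (\<Sum>i=1..M. - ((E (q (i - 1)) - f) \<bullet> w i))
        + (\<Sum>i=1..M. E (q (i - 1) - x) \<bullet> w i)" .
    have "t * (\<Sum>i=1..M. - ((E (q (i - 1)) - f) \<bullet> w i)) = (\<Sum>i=1..M. - t * ((E (q (i - 1)) - f) \<bullet> w i))"
      by (simp add: sum_distrib_left)
    also have "\<dots> \<le> (\<Sum>i=1..M. \<delta> i + t\<^sup>2 / 2 * (norm (w i))\<^sup>2)"
      unfolding w_def using subproblem_gainD(4)[OF \<delta> y t] by (intro sum_mono)
    also have "\<dots> = S + t\<^sup>2 / 2 * \<Psi>"
      by (simp add: S_def \<Psi>_def sum.distrib sum_distrib_left)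
    finally have first: "t * (\<Sum>i=1..M. - ((E (q (i - 1)) - f) \<bullet> w i)) \<le> S + t\<^sup>2 / 2 * \<Psi>" .
    have "(\<Sum>i=1..M. E (q (i - 1) - x) \<bullet> w i)
        \<le> (\<Sum>i=1..M. \<sigma> * c * (sqrt (real M) * sqrt (2 * S)) * norm (w i))"
    proof (intro sum_mono)
      fix i assume i: "i \<in> {1..M}"
      have "E (q (i - 1) - x) \<bullet> w i \<le> norm (E (q (i - 1) - x)) * norm (w i)"
        by (rule norm_cauchy_schwarz)
      also have "\<dots> \<le> \<sigma> * c * (sqrt (real M) * sqrt (2 * S)) * norm (w i)"
        using i by (intro mult_right_mono drift) auto
      finally show "E (q (i - 1) - x) \<bullet> w i \<le> \<sigma> * c * (sqrt (real M) * sqrt (2 * S)) * norm (w i)" .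
    qed
    also have "\<dots> = \<sigma> * c * (sqrt (real M) * sqrt (2 * S)) * (\<Sum>i=1..M. norm (w i))"
      by (simp add: sum_distrib_left)
    also have "\<dots> \<le> \<sigma> * c * (sqrt (real M) * sqrt (2 * S)) * (sqrt (real M) * sqrt \<Psi>)"
      using \<sigma> c S0 w_sum by (intro mult_left_mono) auto
    also have "\<dots> = \<sigma> * c * (sqrt (real M) * sqrt (real M)) * sqrt \<Psi> * sqrt (2 * S)"
      by (simp only: mult_ac)
    also have "\<dots> = \<kappa> * sqrt \<Psi> * sqrt (2 * S)"
      unfolding \<kappa> c_def by (simp add: mult_ac del: real_sqrt_mult_self) (simp add: mult_ac)
    finally have second: "(\<Sum>i=1..M. E (q (i - 1) - x) \<bullet> w i) \<le> \<kappa> * sqrt \<Psi> * sqrt (2 * S)" .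
    have "t * (D x - D y) \<le> t * - ((E x - f) \<bullet> E (y - x))"
      using D_gradient_le[OF xV, of y] y K_subset t by (intro mult_left_mono) auto
    also have "\<dots> \<le> S + t\<^sup>2 / 2 * \<Psi> + t * (\<kappa> * sqrt \<Psi> * sqrt (2 * S))"
      unfolding split distrib_left using first mult_left_mono[OF second t(1)] by (rule add_mono)
    finally show ?thesis by (simp add: \<Psi>_def w_def mult.assoc)
  qed
  moreover have "q M \<in> K" unfolding q_eq[OF order_refl] using x vin \<sigma> by (intro \<theta>_blend_in_K) auto
  ultimately show thesis using that S0 decr by blast
qed

text \<open>The interface between the algorithms and the rate. The comparison point y ranges over
  all of K, so that a minimizer can be inserted afterwards, and the sums over i stay explicit until
  they are bounded by \<Phi>^2.\<close>

definition iterates_gain :: "real \<Rightarrow> real \<Rightarrow> (nat \<Rightarrow> 'x) \<Rightarrow> (nat \<Rightarrow> real) \<Rightarrow> bool" where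
  "iterates_gain \<tau> \<kappa> p S \<longleftrightarrow> (\<forall>n. p n \<in> K \<and> 0 \<le> S n \<and> \<tau> * S n \<le> D (p n) - D (p (Suc n)) \<and>
    (\<forall>y\<in>K. \<forall>t\<in>{0..1}. t * (D (p n) - D y)
      \<le> S n + t\<^sup>2 / 2 * (\<Sum>i=1..M. (norm (E (\<theta> i (y - p n))))\<^sup>2)
        + t * \<kappa> * sqrt (\<Sum>i=1..M. (norm (E (\<theta> i (y - p n))))\<^sup>2) * sqrt (2 * S n)))"

lemma iterates_gainI:
  assumes "p 0 \<in> K"
    and step: "\<And>n. p n \<in> K \<Longrightarrow> \<exists>S. p (Suc n) \<in> K \<and> 0 \<le> S \<and> \<tau> * S \<le> D (p n) - D (p (Suc n)) \<and>
    (\<forall>y\<in>K. \<forall>t\<in>{0..1}. t * (D (p n) - D y)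
      \<le> S + t\<^sup>2 / 2 * (\<Sum>i=1..M. (norm (E (\<theta> i (y - p n))))\<^sup>2)
        + t * \<kappa> * sqrt (\<Sum>i=1..M. (norm (E (\<theta> i (y - p n))))\<^sup>2) * sqrt (2 * S))"
  shows "\<exists>S. iterates_gain \<tau> \<kappa> p S"
proof -
  have K: "p n \<in> K" for n
    by (induction n) (use assms(1) step in blast)+
  show ?thesis unfolding iterates_gain_def
    by (rule choice) (use K step in blast)
qed

lemma parallel_iterates_gain:
  assumes iter: "parallel_iterates D K M \<theta> \<sigma> \<rho> p"
    and "M \<ge> 1" "0 < \<rho>" "\<rho> \<le> 1" "0 < \<sigma>" "\<sigma> \<le> 1 / real M"
  shows "\<exists>S. iterates_gain (\<sigma> * \<rho>) 0 p S"
proof (rule iterates_gainI)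
  show "p 0 \<in> K" using iter by (simp add: parallel_iterates_def)
  fix n assume n: "p n \<in> K"
  obtain v where v: "\<And>i. i \<in> {1..M} \<Longrightarrow> v i \<in> approx_argmin \<rho> (\<theta> i (p n)) (\<theta> i ` K) (\<lambda>w. D (p n + (w - \<theta> i (p n))))"
    and p: "p (Suc n) = p n + (\<Sum>i=1..M. \<sigma> *\<^sub>R (v i - \<theta> i (p n)))"
    using iter unfolding parallel_iterates_def by blast
  obtain S where "p (Suc n) \<in> K" "0 \<le> S" "\<sigma> * \<rho> * S \<le> D (p n) - D (p (Suc n))"
    and "\<And>y t. y \<in> K \<Longrightarrow> 0 \<le> t \<Longrightarrow> t \<le> 1 \<Longrightarrow>
      t * (D (p n) - D y) \<le> S + t\<^sup>2 / 2 * (\<Sum>i=1..M. (norm (E (\<theta> i (y - p n))))\<^sup>2)"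
    by (rule parallel_step[OF assms(2) n assms(3-6) v p]) (assumption, rule that)
  then show "\<exists>S. p (Suc n) \<in> K \<and> 0 \<le> S \<and> \<sigma> * \<rho> * S \<le> D (p n) - D (p (Suc n)) \<and>
    (\<forall>y\<in>K. \<forall>t\<in>{0..1}. t * (D (p n) - D y)
      \<le> S + t\<^sup>2 / 2 * (\<Sum>i=1..M. (norm (E (\<theta> i (y - p n))))\<^sup>2)
        + t * 0 * sqrt (\<Sum>i=1..M. (norm (E (\<theta> i (y - p n))))\<^sup>2) * sqrt (2 * S))"
    by (intro exI[of _ S]) simp
qed

lemma sequential_iterates_gain:
  assumes iter: "sequential_iterates D K M \<theta> \<sigma> \<rho> p"
    and "0 < \<rho>" "\<rho> \<le> 1" "0 < \<sigma>" "\<sigma> \<le> 1" and \<kappa>: "\<kappa> = real M * \<sigma> * (1 + sqrt (1 - \<rho>))"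
  shows "\<exists>S. iterates_gain (\<sigma> * \<rho>) \<kappa> p S"
proof (rule iterates_gainI)
  show "p 0 \<in> K" using iter by (simp add: sequential_iterates_def)
  fix n assume n: "p n \<in> K"
  obtain v q where q0: "q 0 = p n"
    and vq: "\<forall>i\<in>{1..M}. v i \<in> approx_argmin \<rho> (\<theta> i (p n)) (\<theta> i ` K)
      (\<lambda>w. D (q (i - 1) + (w - \<theta> i (p n)))) \<and> q i = q (i - 1) + \<sigma> *\<^sub>R (v i - \<theta> i (p n))"
    and p: "p (Suc n) = q M"
    using iter unfolding sequential_iterates_def by blast
  obtain S where "q M \<in> K" "0 \<le> S" "\<sigma> * \<rho> * S \<le> D (p n) - D (q M)"
    and "\<And>y t. y \<in> K \<Longrightarrow> 0 \<le> t \<Longrightarrow> t \<le> 1 \<Longrightarrow>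
      t * (D (p n) - D y) \<le> S + t\<^sup>2 / 2 * (\<Sum>i=1..M. (norm (E (\<theta> i (y - p n))))\<^sup>2)
        + t * \<kappa> * sqrt (\<Sum>i=1..M. (norm (E (\<theta> i (y - p n))))\<^sup>2) * sqrt (2 * S)"
    by (rule sequential_step[OF n assms(2-5) q0 vq[rule_format, THEN conjunct1] vq[rule_format, THEN conjunct2] \<kappa>]) (assumption, assumption, rule that)
  then show "\<exists>S. p (Suc n) \<in> K \<and> 0 \<le> S \<and> \<sigma> * \<rho> * S \<le> D (p n) - D (p (Suc n)) \<and>
    (\<forall>y\<in>K. \<forall>t\<in>{0..1}. t * (D (p n) - D y)
      \<le> S + t\<^sup>2 / 2 * (\<Sum>i=1..M. (norm (E (\<theta> i (y - p n))))\<^sup>2)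
        + t * \<kappa> * sqrt (\<Sum>i=1..M. (norm (E (\<theta> i (y - p n))))\<^sup>2) * sqrt (2 * S))"
    by (intro exI[of _ S]) (simp add: p)
qed

text \<open>The energies decrease, so every iterate stays in the sublevel set of p 0. Therefore a
  bound \<Phi> that is valid on this sublevel set alone can be used in every sweep.\<close>

lemma iterates_decay:
  fixes n\<^sub>0 :: enat
  assumes gain: "iterates_gain \<tau> \<kappa> p S" and \<tau>: "0 < \<tau>" "\<tau> \<le> 1" and "0 \<le> \<kappa>" "\<alpha> = 1 + \<kappa>"
    and y: "y \<in> K" "\<And>x. x \<in> K \<Longrightarrow> D y \<le> D x"
    and \<Phi>: "0 \<le> \<Phi>" "\<And>x. x \<in> K \<Longrightarrow> D x \<le> D (p 0) \<Longrightarrow> (\<Sum>i=1..M. (norm (E (\<theta> i (y - x))))\<^sup>2) \<le> \<Phi>\<^sup>2"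
    and n\<^sub>0: "n\<^sub>0 = Inf (enat ` {n. D (p n) - D y < \<Phi>\<^sup>2 * \<alpha>})"
  shows "(\<lambda>n. D (p n)) \<longlonglongrightarrow> D y"
    and "enat n \<le> n\<^sub>0 \<Longrightarrow> D (p n) - D y \<le> (1 - \<tau> / (2 * \<alpha>)) ^ n * (D (p 0) - D y)"
    and "n\<^sub>0 \<le> enat n \<Longrightarrow>
      D (p n) - D y \<le> 2 * \<Phi>\<^sup>2 / \<tau> * \<alpha>\<^sup>2 * inverse (real n - real (the_enat n\<^sub>0) + 1)"
proof -
  have K: "p n \<in> K" and S: "0 \<le> S n" and step: "\<tau> * S n \<le> D (p n) - D (p (Suc n))" for n
    using gain by (auto simp: iterates_gain_def)
  have "decseq (\<lambda>n. D (p n))"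
  proof (rule decseq_SucI)
    fix n
    have "0 \<le> \<tau> * S n" using \<tau> S by simp
    then show "D (p (Suc n)) \<le> D (p n)" using step[of n] by linarith
  qed
  then have \<Psi>: "(\<Sum>i=1..M. (norm (E (\<theta> i (y - p n))))\<^sup>2) \<le> \<Phi>\<^sup>2" for n
    using \<Phi>(2) K by (auto dest: decseqD[of _ 0 n])
  have e_gain: "t * (D (p n) - D y) \<le> S n + t\<^sup>2 / 2 * \<Phi>\<^sup>2 + t * \<kappa> * \<Phi> * sqrt (2 * S n)"
    if t: "0 \<le> t" "t \<le> 1" for n t
  proof -
    define \<Psi>' where "\<Psi>' = (\<Sum>i=1..M. (norm (E (\<theta> i (y - p n))))\<^sup>2)"
    have "sqrt \<Psi>' \<le> \<Phi>" using \<Psi>[of n] \<Phi>(1) unfolding \<Psi>'_def by (rule real_le_lsqrt[rotated])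
    moreover have "t * (D (p n) - D y) \<le> S n + t\<^sup>2 / 2 * \<Psi>' + t * \<kappa> * sqrt \<Psi>' * sqrt (2 * S n)"
      using gain y(1) t unfolding iterates_gain_def \<Psi>'_def by (meson atLeastAtMost_iff)
    moreover have "t\<^sup>2 / 2 * \<Psi>' \<le> t\<^sup>2 / 2 * \<Phi>\<^sup>2"
      using \<Psi>[of n] unfolding \<Psi>'_def by (intro mult_left_mono) auto
    moreover have "t * \<kappa> * sqrt \<Psi>' * sqrt (2 * S n) \<le> t * \<kappa> * \<Phi> * sqrt (2 * S n)"
      using calculation(1) t \<open>0 \<le> \<kappa>\<close> S[of n] by (intro mult_right_mono mult_left_mono) auto
    ultimately show ?thesis by linarith
  qed
  have e_step: "\<tau> * S n \<le> (D (p n) - D y) - (D (p (Suc n)) - D y)" for n using step[of n] by simp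
  have e: "0 \<le> D (p n) - D y" for n using y(2)[OF K] by simp
  note rate = energy_decay_rate[where e = "\<lambda>n. D (p n) - D y", OF e S \<Phi>(1) \<open>0 \<le> \<kappa>\<close> \<tau> e_step e_gain \<open>\<alpha> = 1 + \<kappa>\<close> n\<^sub>0]
  show "enat n \<le> n\<^sub>0 \<Longrightarrow> D (p n) - D y \<le> (1 - \<tau> / (2 * \<alpha>)) ^ n * (D (p 0) - D y)"
    by (rule rate(1))
  show "n\<^sub>0 \<le> enat n \<Longrightarrow>
      D (p n) - D y \<le> 2 * \<Phi>\<^sup>2 / \<tau> * \<alpha>\<^sup>2 * inverse (real n - real (the_enat n\<^sub>0) + 1)"
    by (rule rate(2))
  show "(\<lambda>n. D (p n)) \<longlonglongrightarrow> D y" using rate(3) by (rule LIM_zero_cancel)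
qed

end

section \<open>Completeness of \<open>L\<^sup>2\<close>\<close>

lemma L2_rel_rep: "L2_rel (L2_fun u) (L2_fun u)"
  unfolding L2_fun_def by (rule Quotient_rep_reflp[OF Quotient_L2])

lemma square_integrable_L2_fun: "square_integrable (L2_fun u)"
  using L2_rel_rep by (simp add: L2_rel_def)

lemma L2_fun_measurable [measurable]: "L2_fun u \<in> borel_measurable lebesgue"
  using square_integrable_L2_fun[of u] by (simp add: square_integrable_def)

lemma L2_eq_iff: "u = v \<longleftrightarrow> (AE x in lebesgue. L2_fun u x = L2_fun v x)"
proof -
  have "L2_rel (L2_fun u) (L2_fun v) \<longleftrightarrow> u = v"
    unfolding L2_fun_def by (rule Quotient_rel_rep[OF Quotient_L2])
  then show ?thesis by (auto simp: L2_rel_def square_integrable_L2_fun)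
qed

lemma L2_fun_abs: "square_integrable h \<Longrightarrow> AE x in lebesgue. L2_fun (abs_L2 h) x = h x"
  using Quotient_rep_abs[OF Quotient_L2, of h] by (simp add: L2_fun_def L2_rel_def)

lemma L2_fun_zero: "AE x in lebesgue. L2_fun 0 x = 0"
  unfolding zero_L2_def using square_integrable_zero by (rule L2_fun_abs)

lemma L2_fun_add: "AE x in lebesgue. L2_fun (u + v) x = L2_fun u x + L2_fun v x"
  unfolding plus_L2_def map_fun_apply L2_fun_def[symmetric]
  by (intro L2_fun_abs square_integrable_add square_integrable_L2_fun)

lemma L2_fun_diff: "AE x in lebesgue. L2_fun (u - v) x = L2_fun u x - L2_fun v x"
  unfolding minus_L2_def map_fun_apply L2_fun_def[symmetric]
  by (intro L2_fun_abs square_integrable_diff square_integrable_L2_fun)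

lemma L2_fun_scaleR: "AE x in lebesgue. L2_fun (c *\<^sub>R u) x = c *\<^sub>R L2_fun u x"
  unfolding scaleR_L2_def map_fun_apply id_def L2_fun_def[symmetric]
  by (intro L2_fun_abs square_integrable_scaleR square_integrable_L2_fun)

lemma L2_inner_eq: "u \<bullet> v = (LINT x|lebesgue. L2_fun u x \<bullet> L2_fun v x)"
  unfolding inner_L2_def map_fun_apply id_def L2_fun_def[symmetric] ..

lemma L2_norm_eq: "(norm u)\<^sup>2 = (LINT x|lebesgue. (norm (L2_fun u x))\<^sup>2)"
  by (simp add: power2_norm_eq_inner L2_inner_eq)

lemma L2_nn_integral: "(\<integral>\<^sup>+x. ennreal ((norm (L2_fun u x))\<^sup>2) \<partial>lebesgue) = ennreal ((norm u)\<^sup>2)"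
  unfolding L2_norm_eq using square_integrable_L2_fun[of u]
  by (intro nn_integral_eq_integral) (auto simp: square_integrable_def)

text \<open>Nonnegative integrals are used so that an almost everywhere limit can be compared with a
  sequence before that limit is known to be square integrable.\<close>

lemma L2_nn_integral_diff:
  "(\<integral>\<^sup>+x. ennreal ((norm (L2_fun u x - L2_fun v x))\<^sup>2) \<partial>lebesgue) = ennreal ((dist u v)\<^sup>2)"
proof -
  have "(\<integral>\<^sup>+x. ennreal ((norm (L2_fun u x - L2_fun v x))\<^sup>2) \<partial>lebesgue)
      = (\<integral>\<^sup>+x. ennreal ((norm (L2_fun (u - v) x))\<^sup>2) \<partial>lebesgue)"
    using L2_fun_diff[of u v] by (intro nn_integral_cong_AE) (auto elim: eventually_mono)
  then show ?thesis by (simp only: L2_nn_integral dist_norm)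
qed

text \<open>The weight 4^k turns mere boundedness of the terms into increments of order 2^{-k}, so
  the telescoping series converges absolutely.\<close>

lemma convergent_if_summable_weighted_squares:
  fixes y :: "nat \<Rightarrow> 'b::euclidean_space"
  assumes "(\<Sum>k. ennreal (4 ^ k * (norm (y (Suc k) - y k))\<^sup>2)) \<noteq> \<infinity>"
  shows "convergent y"
proof -
  have "summable (\<lambda>k. 4 ^ k * (norm (y (Suc k) - y k))\<^sup>2)"
    using assms by (intro summable_suminf_not_top) auto
  then have "bounded (range (\<lambda>k. 4 ^ k * (norm (y (Suc k) - y k))\<^sup>2))"
    by (intro convergent_imp_bounded[OF summable_LIMSEQ_zero])
  then obtain C where C: "\<And>k. 4 ^ k * (norm (y (Suc k) - y k))\<^sup>2 \<le> C"
    by (fastforce simp: bounded_iff)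
  have decay: "norm (y (Suc k) - y k) \<le> sqrt C * (1 / 2) ^ k" for k
  proof -
    have "(2 ^ k)\<^sup>2 = (4 :: real) ^ k" by (simp add: power2_eq_square flip: power_mult_distrib)
    then have "(2 ^ k * norm (y (Suc k) - y k))\<^sup>2 \<le> C" using C[of k] by (simp add: power_mult_distrib)
    then have "2 ^ k * norm (y (Suc k) - y k) \<le> sqrt C" by (rule real_le_rsqrt)
    then have "norm (y (Suc k) - y k) \<le> sqrt C / 2 ^ k"
      by (subst pos_le_divide_eq) (auto simp: mult.commute)
    then show ?thesis by (simp add: power_divide)
  qed
  have "summable (\<lambda>k. sqrt C * (1 / 2) ^ k)"
    by (rule summable_mult) (rule summable_geometric, simp)
  then have "summable (\<lambda>k. y (Suc k) - y k)"
    by (rule summable_comparison_test[rotated]) (use decay in blast)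
  then have "convergent (\<lambda>n. \<Sum>k<n. y (Suc k) - y k)"
    by (simp add: summable_iff_convergent)
  then have "convergent (\<lambda>n. y 0 + (\<Sum>k<n. y (Suc k) - y k))"
    by (rule convergent_add[OF convergent_const])
  moreover have "y 0 + (\<Sum>k<n. y (Suc k) - y k) = y n" for n
    using sum_lessThan_telescope[of y n] by simp
  ultimately show ?thesis by simp
qed

text \<open>Riesz--Fischer: a subsequence with geometric decay converges almost everywhere, and Fatou's
  lemma upgrades this to norm convergence of the whole sequence.\<close>

instance L2 :: (euclidean_space, euclidean_space) complete_space
proof
  fix X :: "nat \<Rightarrow> ('a, 'b) L2"
  assume X: "Cauchy X"
  have "\<exists>N. \<forall>m\<ge>N. \<forall>n\<ge>N. dist (X m) (X n) < (1 / 4) ^ k" for k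
    using X unfolding Cauchy_def by simp
  then obtain N where N: "\<And>k m n. N k \<le> m \<Longrightarrow> N k \<le> n \<Longrightarrow> dist (X m) (X n) < (1 / 4) ^ k"
    by metis
  \<comment> \<open>Partial sums give a nondecreasing majorant of N. Both r k and r (k + 1)
    therefore lie beyond the threshold N k.\<close>
  define r where "r k = (\<Sum>j\<le>k. N j)" for k
  have r_ge: "N k \<le> r j" if "k \<le> j" for k j
    unfolding r_def using member_le_sum[of k "{..j}" N] that by simp
  define y where "y k = L2_fun (X (r k))" for k
  have [measurable]: "y k \<in> borel_measurable lebesgue" for k by (simp add: y_def)
  \<comment> \<open>The squared distance is at most 16^{-k}. Against the weight 4^k this leaves
    4^{-k}, which is still summable.\<close>
  have term_le: "(\<integral>\<^sup>+x. ennreal (4 ^ k * (norm (y (Suc k) x - y k x))\<^sup>2) \<partial>lebesgue) \<le> ennreal ((1 / 4) ^ k)" for k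
  proof -
    have "(\<integral>\<^sup>+x. ennreal (4 ^ k * (norm (y (Suc k) x - y k x))\<^sup>2) \<partial>lebesgue)
      = ennreal (4 ^ k) * (\<integral>\<^sup>+x. ennreal ((norm (y (Suc k) x - y k x))\<^sup>2) \<partial>lebesgue)"
      by (subst ennreal_mult) (auto intro!: nn_integral_cmult)
    also have "\<dots> = ennreal (4 ^ k * (dist (X (r (Suc k))) (X (r k)))\<^sup>2)"
      unfolding y_def L2_nn_integral_diff by (rule ennreal_mult[symmetric]) auto
    also have "\<dots> \<le> ennreal (4 ^ k * ((1 / 4) ^ k)\<^sup>2)"
      using N[of k "r (Suc k)" "r k"] r_ge[of k "Suc k"] r_ge[of k k]
      by (intro ennreal_leI mult_left_mono power_mono) auto
    also have "4 ^ k * ((1 / 4) ^ k)\<^sup>2 = (1 / 4 :: real) ^ k"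
      by (simp add: power2_eq_square power_divide)
    finally show ?thesis .
  qed
  have "(\<integral>\<^sup>+x. (\<Sum>k. ennreal (4 ^ k * (norm (y (Suc k) x - y k x))\<^sup>2)) \<partial>lebesgue)
      = (\<Sum>k. \<integral>\<^sup>+x. ennreal (4 ^ k * (norm (y (Suc k) x - y k x))\<^sup>2) \<partial>lebesgue)"
    by (intro nn_integral_suminf) measurable
  also have "\<dots> \<le> (\<Sum>k. ennreal ((1 / 4) ^ k))" by (intro suminf_le term_le) auto
  also have "\<dots> < \<infinity>" by (subst suminf_ennreal2) (auto intro: summable_geometric)
  finally have "AE x in lebesgue. (\<Sum>k. ennreal (4 ^ k * (norm (y (Suc k) x - y k x))\<^sup>2)) \<noteq> \<infinity>"
    by (intro nn_integral_PInf_AE) auto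
  then have lim: "AE x in lebesgue. (\<lambda>k. y k x) \<longlonglongrightarrow> lim (\<lambda>k. y k x)"
    by eventually_elim (intro convergent_LIMSEQ_iff[THEN iffD1] convergent_if_summable_weighted_squares)
  define h where "h x = lim (\<lambda>k. y k x)" for x
  have [measurable]: "h \<in> borel_measurable lebesgue" unfolding h_def by measurable
  have fatou: "(\<integral>\<^sup>+x. ennreal ((norm (L2_fun (X m) x - h x))\<^sup>2) \<partial>lebesgue) \<le> ennreal (((1 / 4) ^ k)\<^sup>2)"
    if m: "N k \<le> m" for m k
  proof -
    have "(\<integral>\<^sup>+x. ennreal ((norm (L2_fun (X m) x - h x))\<^sup>2) \<partial>lebesgue)
        = (\<integral>\<^sup>+x. liminf (\<lambda>j. ennreal ((norm (L2_fun (X m) x - y j x))\<^sup>2)) \<partial>lebesgue)"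
    proof (rule nn_integral_cong_AE, use lim in eventually_elim)
      fix x assume "(\<lambda>k. y k x) \<longlonglongrightarrow> lim (\<lambda>k. y k x)"
      then have "(\<lambda>j. ennreal ((norm (L2_fun (X m) x - y j x))\<^sup>2)) \<longlonglongrightarrow> ennreal ((norm (L2_fun (X m) x - h x))\<^sup>2)"
        unfolding h_def by (intro tendsto_ennrealI tendsto_intros)
      then show "ennreal ((norm (L2_fun (X m) x - h x))\<^sup>2) = liminf (\<lambda>j. ennreal ((norm (L2_fun (X m) x - y j x))\<^sup>2))"
        by (intro lim_imp_Liminf[symmetric]) auto
    qed
    also have "\<dots> \<le> liminf (\<lambda>j. \<integral>\<^sup>+x. ennreal ((norm (L2_fun (X m) x - y j x))\<^sup>2) \<partial>lebesgue)"
      by (intro nn_integral_liminf) measurable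
    also have "\<dots> \<le> liminf (\<lambda>j. ennreal (((1 / 4) ^ k)\<^sup>2))"
    proof (rule Liminf_mono, use eventually_ge_at_top[of k] in eventually_elim)
      fix j assume "k \<le> j"
      then have "dist (X m) (X (r j)) \<le> (1 / 4) ^ k" using N[OF m r_ge] by (simp add: less_imp_le)
      then show "(\<integral>\<^sup>+x. ennreal ((norm (L2_fun (X m) x - y j x))\<^sup>2) \<partial>lebesgue) \<le> ennreal (((1 / 4) ^ k)\<^sup>2)"
        unfolding y_def L2_nn_integral_diff by (intro ennreal_leI power_mono) auto
    qed
    finally show ?thesis by (simp add: Liminf_const)
  qed
  \<comment> \<open>The Fatou bound is finite already for k = 0. Hence X (N 0) - h is square
    integrable, and so is h, which thereby represents an element of L^2.\<close>
  have "integrable lebesgue (\<lambda>x. (norm (L2_fun (X (N 0)) x - h x))\<^sup>2)"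
    using fatou[of 0 "N 0"] by (intro integrableI_nonneg) (auto simp: less_top[symmetric] top_unique)
  then have "square_integrable (\<lambda>x. L2_fun (X (N 0)) x - h x)"
    by (simp add: square_integrable_def)
  from square_integrable_diff[OF square_integrable_L2_fun[of "X (N 0)"] this]
  have h: "square_integrable h" by simp
  have close: "dist (X m) (abs_L2 h) \<le> (1 / 4) ^ k" if m: "N k \<le> m" for m k
  proof -
    have "ennreal ((dist (X m) (abs_L2 h))\<^sup>2) = (\<integral>\<^sup>+x. ennreal ((norm (L2_fun (X m) x - h x))\<^sup>2) \<partial>lebesgue)"
      unfolding L2_nn_integral_diff[symmetric]
      using L2_fun_abs[OF h] by (intro nn_integral_cong_AE) (auto elim: eventually_mono)
    then have "ennreal ((dist (X m) (abs_L2 h))\<^sup>2) \<le> ennreal (((1 / 4) ^ k)\<^sup>2)" using fatou[OF m] by simp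
    then have "(dist (X m) (abs_L2 h))\<^sup>2 \<le> ((1 / 4) ^ k)\<^sup>2" by (subst (asm) ennreal_le_iff) auto
    then show ?thesis by (rule power2_le_imp_le) simp
  qed
  have "X \<longlonglongrightarrow> abs_L2 h"
  proof (rule metric_LIMSEQ_I)
    fix e :: real assume "0 < e"
    then obtain k where "(1 / 4) ^ k < e" using real_arch_pow_inv[of e "1 / 4"] by fastforce
    then show "\<exists>n0. \<forall>n\<ge>n0. dist (X n) (abs_L2 h) < e" using close[of k] by (meson le_less_trans)
  qed
  then show "convergent X" by (auto simp: convergent_def)
qed

lemma L2_on_subspace: "subspace (L2_on \<Omega>)"
proof (rule subspaceI)
  show "0 \<in> L2_on \<Omega>" unfolding L2_on_def using L2_fun_zero by (auto elim: eventually_mono)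
  show "u + v \<in> L2_on \<Omega>" if "u \<in> L2_on \<Omega>" "v \<in> L2_on \<Omega>" for u v
    using that L2_fun_add[of u v] unfolding L2_on_def mem_Collect_eq by eventually_elim auto
  show "c *\<^sub>R u \<in> L2_on \<Omega>" if "u \<in> L2_on \<Omega>" for c u
    using that L2_fun_scaleR[of c u] unfolding L2_on_def mem_Collect_eq by eventually_elim auto
qed

text \<open>It suffices that the subspace is closed. Outside \<Omega> the functions X n vanish
  almost everywhere, so the mass of the limit u there is at most the squared distance of u to X
  n.\<close>

lemma L2_on_complete:
  assumes [measurable]: "\<Omega> \<in> sets lebesgue"
  shows "complete (L2_on \<Omega> :: ('a::euclidean_space, 'b::euclidean_space) L2 set)"
  unfolding complete_eq_closed closed_sequential_limits
proof (intro allI impI, elim conjE)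
  fix X and u :: "('a, 'b) L2"
  assume X: "\<forall>n. X n \<in> L2_on \<Omega>" "X \<longlonglongrightarrow> u"
  let ?I = "\<integral>\<^sup>+x. ennreal ((norm (L2_fun u x))\<^sup>2) * indicator (-\<Omega>) x \<partial>lebesgue"
  have "?I \<le> ennreal ((dist (X n) u)\<^sup>2)" for n
  proof -
    have "?I \<le> (\<integral>\<^sup>+x. ennreal ((norm (L2_fun (X n) x - L2_fun u x))\<^sup>2) \<partial>lebesgue)"
      using X(1)[rule_format, of n] unfolding L2_on_def mem_Collect_eq
      by (intro nn_integral_mono_AE) (auto elim!: eventually_mono simp: indicator_def)
    then show ?thesis by (simp only: L2_nn_integral_diff)
  qed
  moreover have "(\<lambda>n. ennreal ((dist (X n) u)\<^sup>2)) \<longlonglongrightarrow> ennreal (0\<^sup>2)"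
    by (intro tendsto_ennrealI tendsto_power tendsto_dist_iff[THEN iffD1] X(2))
  ultimately have "?I \<le> 0" by (intro tendsto_lowerbound[of _ 0]) auto
  then have "?I = 0" by simp
  then have "AE x in lebesgue. ennreal ((norm (L2_fun u x))\<^sup>2) * indicator (-\<Omega>) x = 0"
    by (subst (asm) nn_integral_0_iff_AE) measurable
  then show "u \<in> L2_on \<Omega>"
    unfolding L2_on_def mem_Collect_eq by eventually_elim (auto simp: indicator_def)
qed

section \<open>Coercive operators\<close>

text \<open>The Lax--Milgram argument: injectivity is immediate from coercivity, and B u = w is
  solved by Banach's fixed point theorem for the damped residual iteration. Working on a complete
  subspace W avoids assumptions on B elsewhere.\<close>

lemma coercive_operator_bij:
  fixes B :: "'w::real_inner \<Rightarrow> 'w"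
  assumes W: "subspace W" "complete W"
    and B_in: "\<And>u. u \<in> W \<Longrightarrow> B u \<in> W"
    and B_diff: "\<And>u v. u \<in> W \<Longrightarrow> v \<in> W \<Longrightarrow> B (u - v) = B u - B v"
    and bounded: "\<And>u. u \<in> W \<Longrightarrow> norm (B u) \<le> C * norm u"
    and coercive: "\<And>u. u \<in> W \<Longrightarrow> c * (norm u)\<^sup>2 \<le> B u \<bullet> u" and "0 < c"
  shows "bij_betw B W W"
proof -
  \<comment> \<open>The bound C may be small or negative; the maximum with c makes L positive and
    guarantees c \<le> L, hence k \<ge> 0 below.\<close>
  define L where "L = max C c"
  have L: "0 < L" "c \<le> L" "norm (B u) \<le> L * norm u" if "u \<in> W" for u
    using \<open>0 < c\<close> bounded[OF that] mult_right_mono[of C L "norm u"] by (auto simp: L_def)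
  show ?thesis
  proof (rule bij_betw_imageI)
    show "inj_on B W"
    proof (rule inj_onI)
      fix u v assume uv: "u \<in> W" "v \<in> W" "B u = B v"
      then have "c * (norm (u - v))\<^sup>2 \<le> 0"
        using coercive[OF subspace_diff[OF W(1) uv(1,2)]] B_diff[OF uv(1,2)] by simp
      then show "u = v" using \<open>0 < c\<close> by (simp add: mult_le_0_iff)
    qed
    show "B ` W = W"
    proof
      show "W \<subseteq> B ` W"
      proof
        fix w assume w: "w \<in> W"
        have L0: "0 < L" "c \<le> L" using L w by auto
        \<comment> \<open>The squared contraction factor is 1 - 2 \<tau> c + \<tau>^2 L^2. It is
          smallest at \<tau> = c/L^2, with value k = 1 - c^2/L^2.\<close>
        define \<tau> where "\<tau> = c / L\<^sup>2"
        define F where "F u = u - \<tau> *\<^sub>R (B u - w)" for u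
        define k where "k = 1 - c\<^sup>2 / L\<^sup>2"
        have "c\<^sup>2 \<le> L\<^sup>2" using L0 \<open>0 < c\<close> by (intro power_mono) auto
        then have k: "0 \<le> k" "k < 1" using L0 \<open>0 < c\<close> by (auto simp: k_def field_simps)
        have "\<exists>!u\<in>W. F u = u"
        proof (rule Banach_fix[OF W(2), of "sqrt k"])
          show "W \<noteq> {}" using w by blast
          show "0 \<le> sqrt k" "sqrt k < 1" using k by auto
          show "F ` W \<subseteq> W" unfolding F_def using w
            by (auto intro!: subspace_diff[OF W(1)] subspace_scale[OF W(1)] B_in)
          fix u v assume uv: "u \<in> W" "v \<in> W"
          define d where "d = u - v"
          have d: "d \<in> W" unfolding d_def using uv by (rule subspace_diff[OF W(1)])
          have "F u - F v = d - \<tau> *\<^sub>R B d"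
            unfolding d_def B_diff[OF uv] by (simp add: F_def algebra_simps)
          then have dist_eq: "dist (F u) (F v) = norm (d - \<tau> *\<^sub>R B d)" by (simp add: dist_norm)
          have "(dist (F u) (F v))\<^sup>2 = (norm d)\<^sup>2 - 2 * \<tau> * (B d \<bullet> d) + \<tau>\<^sup>2 * (norm (B d))\<^sup>2"
            unfolding dist_eq power2_norm_eq_inner
            by (simp add: inner_diff_left inner_diff_right inner_commute
                power2_eq_square algebra_simps)
          also have "\<dots> \<le> (norm d)\<^sup>2 - 2 * \<tau> * (c * (norm d)\<^sup>2) + \<tau>\<^sup>2 * (L * norm d)\<^sup>2"
            using coercive[OF d] L(3)[OF d] \<open>0 < c\<close>
            by (intro add_mono diff_mono mult_left_mono power_mono) (auto simp: \<tau>_def)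
          also have "\<dots> = k * (norm d)\<^sup>2"
            using L0 by (simp add: \<tau>_def k_def power2_eq_square field_simps)
          finally have "dist (F u) (F v) \<le> sqrt (k * (norm d)\<^sup>2)" by (rule real_le_rsqrt)
          then show "dist (F u) (F v) \<le> sqrt k * dist u v"
            by (simp add: real_sqrt_mult dist_norm d_def)
        qed
        then obtain u where u: "u \<in> W" "F u = u" by blast
        then have "\<tau> *\<^sub>R (B u - w) = 0" by (simp add: F_def)
        then have "B u = w" using L0 \<open>0 < c\<close> by (simp add: \<tau>_def)
        then show "w \<in> B ` W" using u by blast
      qed
    qed (use B_in in blast)
  qed
qed

section \<open>Operator norms relative to a subspace\<close>

lemma bounded_linear_between_bound:
  assumes "bounded_linear_between X nX Y nY A"
  obtains C where "\<forall>x\<in>X. nY (A x) \<le> C * nX x"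
  using assms unfolding bounded_linear_between_def by (elim conjE exE) (rule that)

lemma op_norm_upper:
  assumes A: "bounded_linear_between X nX Y nY A" and nX: "\<And>x. x \<in> X \<Longrightarrow> 0 \<le> nX x" and x: "x \<in> X"
  shows "nY (A x) / nX x \<le> op_norm X nX nY A"
proof -
  obtain C where C: "\<forall>x\<in>X. nY (A x) \<le> C * nX x"
    using A by (rule bounded_linear_between_bound)
  have "nY (A x) / nX x \<le> \<bar>C\<bar>" if "x \<in> X" for x
  proof (cases "nX x = 0")
    case False
    then have "0 < nX x" using nX[OF that] by simp
    moreover have "C * nX x \<le> \<bar>C\<bar> * nX x" using nX[OF that] by (intro mult_right_mono) auto
    ultimately show ?thesis using C that by (auto simp: pos_divide_le_eq intro: order_trans)
  qed simp
  then have "bdd_above ((\<lambda>x. nY (A x) / nX x) ` X)" by (intro bdd_aboveI2)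
  then show ?thesis unfolding op_norm_def by (intro cSUP_upper x)
qed

text \<open>If \<open>nX x = 0\<close>, the quotient in the supremum is 0 by convention and carries
  no information about A x; there the estimate comes from boundedness itself.\<close>

lemma op_norm_bound:
  assumes A: "bounded_linear_between X nX Y nY A" and nX: "\<And>x. x \<in> X \<Longrightarrow> 0 \<le> nX x" and x: "x \<in> X"
  shows "nY (A x) \<le> op_norm X nX nY A * nX x"
proof (cases "nX x = 0")
  case True
  obtain C where "\<forall>x\<in>X. nY (A x) \<le> C * nX x" using A by (rule bounded_linear_between_bound)
  then show ?thesis using True x by auto
next
  case False
  then have "0 < nX x" using nX[OF x] by simp
  then show ?thesis using op_norm_upper[OF A nX x] by (simp add: pos_divide_le_eq)
qed

lemma op_norm_nonneg:
  assumes A: "bounded_linear_between X nX Y nY A" and nX: "\<And>x. x \<in> X \<Longrightarrow> 0 \<le> nX x"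
    and nY: "\<And>y. y \<in> Y \<Longrightarrow> 0 \<le> nY y" and x: "x \<in> X"
  shows "0 \<le> op_norm X nX nY A"
proof -
  have "0 \<le> nY (A x) / nX x"
    using A x by (intro divide_nonneg_nonneg nX nY) (auto simp: bounded_linear_between_def)
  then show ?thesis using op_norm_upper[OF A nX x] by linarith
qed

section \<open>The operator T*T + \<beta> I and its inverse\<close>

locale regularized_normal_operator =
  fixes W :: "'w::real_inner set" and Y :: "'y::real_inner set"
    and T :: "'w \<Rightarrow> 'y" and Ts :: "'y \<Rightarrow> 'w" and \<beta> c :: real
  assumes W: "subspace W" "complete W" and Y: "subspace Y"
    and T: "bounded_linear_between W norm Y norm T" and Ts: "is_adjoint W Y T Ts"
    and \<beta>: "0 \<le> \<beta>" and c: "0 < c"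
    and coercive: "u \<in> W \<Longrightarrow> c * (norm u)\<^sup>2 \<le> (norm (T u))\<^sup>2 + \<beta> * (norm u)\<^sup>2"
begin

abbreviation B :: "'w \<Rightarrow> 'w" where "B \<equiv> B_op T Ts \<beta>"
abbreviation Binv :: "'w \<Rightarrow> 'w" where "Binv \<equiv> inv_into W B"

lemma T_in: "u \<in> W \<Longrightarrow> T u \<in> Y"
  and T_add: "u \<in> W \<Longrightarrow> v \<in> W \<Longrightarrow> T (u + v) = T u + T v"
  and T_scaleR: "u \<in> W \<Longrightarrow> T (a *\<^sub>R u) = a *\<^sub>R T u"
  using T by (auto simp: bounded_linear_between_def)

lemma Ts_in: "y \<in> Y \<Longrightarrow> Ts y \<in> W"
  and adjoint: "u \<in> W \<Longrightarrow> y \<in> Y \<Longrightarrow> u \<bullet> Ts y = T u \<bullet> y"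
  using Ts by (auto simp: is_adjoint_def)

text \<open>The adjoint is specified through inner products and not as a linear map. Linearity of B
  is therefore verified by testing against all elements of W.\<close>

lemma W_eqI:
  assumes "a \<in> W" "b \<in> W" "\<And>u. u \<in> W \<Longrightarrow> u \<bullet> a = u \<bullet> b"
  shows "a = b"
proof -
  have "(a - b) \<bullet> (a - b) = 0"
    using assms(3)[OF subspace_diff[OF W(1) assms(1,2)]] by (simp add: inner_diff_right)
  then show ?thesis by simp
qed

lemma B_in: "u \<in> W \<Longrightarrow> B u \<in> W"
  unfolding B_op_def by (intro subspace_add[OF W(1)] subspace_scale[OF W(1)] Ts_in T_in)

lemma B_inner: "u \<in> W \<Longrightarrow> v \<in> W \<Longrightarrow> v \<bullet> B u = T v \<bullet> T u + \<beta> * (v \<bullet> u)"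
  by (simp add: B_op_def inner_add_right adjoint T_in)

lemma B_add: "u \<in> W \<Longrightarrow> v \<in> W \<Longrightarrow> B (u + v) = B u + B v"
  by (rule W_eqI) (auto simp: B_in B_inner T_add subspace_add[OF W(1)] inner_add_right algebra_simps)

lemma B_scaleR: "u \<in> W \<Longrightarrow> B (a *\<^sub>R u) = a *\<^sub>R B u"
  by (rule W_eqI) (auto simp: B_in B_inner T_scaleR subspace_scale[OF W(1)] algebra_simps)

lemma B_coercive: "u \<in> W \<Longrightarrow> c * (norm u)\<^sup>2 \<le> B u \<bullet> u"
  using coercive[of u] B_inner[of u u] by (simp add: inner_commute power2_norm_eq_inner)

text \<open>A bound for T suffices: testing B u with itself moves the adjoint back onto T, and one
  factor norm (B u) cancels.\<close>

lemma B_bounded: "\<exists>L. \<forall>u\<in>W. norm (B u) \<le> L * norm u"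
proof -
  obtain C where C: "\<forall>u\<in>W. norm (T u) \<le> C * norm u"
    using T by (rule bounded_linear_between_bound)
  have "norm (B u) \<le> (\<bar>C\<bar> * \<bar>C\<bar> + \<beta>) * norm u" if u: "u \<in> W" for u
  proof -
    have TC: "norm (T v) \<le> \<bar>C\<bar> * norm v" if "v \<in> W" for v
      using C that mult_right_mono[of C "\<bar>C\<bar>" "norm v"] by (auto intro: order_trans)
    have "norm (B u) * norm (B u) = T (B u) \<bullet> T u + \<beta> * (B u \<bullet> u)"
      using B_inner[OF u B_in[OF u]] by (simp add: power2_norm_eq_inner[symmetric] power2_eq_square)
    also have "\<dots> \<le> norm (T (B u)) * norm (T u) + \<beta> * (norm (B u) * norm u)"
      using \<beta> by (intro add_mono mult_left_mono norm_cauchy_schwarz)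
    also have "\<dots> \<le> (\<bar>C\<bar> * norm (B u)) * (\<bar>C\<bar> * norm u) + \<beta> * (norm (B u) * norm u)"
      using TC[OF u] TC[OF B_in[OF u]] by (intro add_mono mult_mono order_refl) auto
    also have "\<dots> = norm (B u) * ((\<bar>C\<bar> * \<bar>C\<bar> + \<beta>) * norm u)" by (simp add: algebra_simps)
    finally have le: "norm (B u) * norm (B u) \<le> norm (B u) * ((\<bar>C\<bar> * \<bar>C\<bar> + \<beta>) * norm u)" .
    show ?thesis
    proof (cases "norm (B u) = 0")
      case True
      then show ?thesis using \<beta> by (simp only: True) (simp add: mult_nonneg_nonneg)
    next
      case False
      then show ?thesis using le by (simp only: mult_le_cancel_left) auto
    qed
  qed
  then show ?thesis by blast
qed

lemma B_bij: "bij_betw B W W"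
proof -
  obtain L where L: "\<And>u. u \<in> W \<Longrightarrow> norm (B u) \<le> L * norm u" using B_bounded by blast
  have "B (u - v) = B u - B v" if "u \<in> W" "v \<in> W" for u v
    using B_add[OF that(1) subspace_scale[OF W(1) that(2)], of "-1"] B_scaleR[OF that(2), of "-1"] by simp
  then show ?thesis by (intro coercive_operator_bij[OF W B_in _ L B_coercive c])
qed

lemma Binv_in: "w \<in> W \<Longrightarrow> Binv w \<in> W"
  using B_bij by (metis bij_betw_def inv_into_into)

lemma B_Binv: "w \<in> W \<Longrightarrow> B (Binv w) = w"
  using B_bij by (metis bij_betw_def f_inv_into_f)

lemma Binv_eqI: "u \<in> W \<Longrightarrow> B u = w \<Longrightarrow> Binv w = u"
  using B_bij by (metis bij_betw_def inv_into_f_f)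

lemma Binv_add: "v \<in> W \<Longrightarrow> w \<in> W \<Longrightarrow> Binv (v + w) = Binv v + Binv w"
  by (rule Binv_eqI) (auto simp: B_add B_Binv Binv_in subspace_add[OF W(1)])

lemma Binv_scaleR: "w \<in> W \<Longrightarrow> Binv (a *\<^sub>R w) = a *\<^sub>R Binv w"
  by (rule Binv_eqI) (auto simp: B_scaleR B_Binv Binv_in subspace_scale[OF W(1)])

lemma Binv_bounded: "bounded_linear_between W norm W norm Binv"
  unfolding bounded_linear_between_def
proof (intro conjI ballI allI exI[of _ "1 / c"])
  fix w assume w: "w \<in> W"
  have "c * (norm (Binv w))\<^sup>2 \<le> w \<bullet> Binv w"
    using B_coercive[OF Binv_in[OF w]] by (simp add: B_Binv w)
  also have "\<dots> \<le> norm w * norm (Binv w)" by (rule norm_cauchy_schwarz)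
  finally have "norm (Binv w) * (c * norm (Binv w)) \<le> norm (Binv w) * norm w"
    by (simp add: power2_eq_square mult_ac)
  then have "c * norm (Binv w) \<le> norm w"
    by (cases "norm (Binv w) = 0") (auto simp: mult_le_cancel_left)
  then show "norm (Binv w) \<le> 1 / c * norm w" using c by (simp add: field_simps)
qed (simp_all add: Binv_in Binv_add Binv_scaleR)

text \<open>Realizes \<open>\<langle>w, B\<^sup>-\<^sup>1w\<rangle>\<close> as a squared norm, so that Cauchy--Schwarz and the triangle inequality come for free.\<close>

definition energy_embedding :: "'w \<Rightarrow> 'y \<times> 'w" where
  "energy_embedding w = (T (Binv w), sqrt \<beta> *\<^sub>R Binv w)"

lemma energy_embedding_add:
  "v \<in> W \<Longrightarrow> w \<in> W \<Longrightarrow> energy_embedding (v + w) = energy_embedding v + energy_embedding w"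
  by (simp add: energy_embedding_def Binv_add T_add Binv_in scaleR_add_right)

lemma energy_embedding_scaleR: "w \<in> W \<Longrightarrow> energy_embedding (a *\<^sub>R w) = a *\<^sub>R energy_embedding w"
  by (simp add: energy_embedding_def Binv_scaleR T_scaleR Binv_in)

lemma energy_embedding_diff:
  "v \<in> W \<Longrightarrow> w \<in> W \<Longrightarrow> energy_embedding (v - w) = energy_embedding v - energy_embedding w"
  using energy_embedding_add[of v "(-1) *\<^sub>R w"] energy_embedding_scaleR[of w "-1"] subspace_scale[OF W(1), of w "-1"]
  by simp

lemma norm_energy_embedding: "w \<in> W \<Longrightarrow> (norm (energy_embedding w))\<^sup>2 = w \<bullet> Binv w"
  using B_inner[OF Binv_in Binv_in, of w w] \<beta>
  by (simp add: B_Binv energy_embedding_def power2_norm_eq_inner inner_commute)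

lemma norm_energy_embedding_le:
  assumes "w \<in> W"
  shows "(norm (energy_embedding w))\<^sup>2 \<le> op_norm W norm norm Binv * (norm w)\<^sup>2"
proof -
  have "w \<bullet> Binv w \<le> norm w * norm (Binv w)" by (rule norm_cauchy_schwarz)
  also have "\<dots> \<le> norm w * (op_norm W norm norm Binv * norm w)"
    using op_norm_bound[OF Binv_bounded _ assms] by (intro mult_left_mono) auto
  finally show ?thesis unfolding norm_energy_embedding[OF assms] by (simp add: power2_eq_square mult_ac)
qed

text \<open>The embedding is bounded below, so an energy bound controls the L^2 norm of the
  divergence. This supplies the divergence part of the finiteness of R.\<close>

lemma norm_le_energy_embedding: "\<exists>L\<ge>0. \<forall>w\<in>W. norm w \<le> L * norm (energy_embedding w)"
proof -
  obtain L where L: "\<And>u. u \<in> W \<Longrightarrow> norm (B u) \<le> L * norm u" using B_bounded by blast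
  have "norm w \<le> \<bar>L\<bar> / sqrt c * norm (energy_embedding w)" if w: "w \<in> W" for w
  proof -
    have "c * (norm (Binv w))\<^sup>2 \<le> (norm (energy_embedding w))\<^sup>2"
      using B_coercive[OF Binv_in[OF w]] by (simp add: B_Binv w norm_energy_embedding)
    then have "(sqrt c * norm (Binv w))\<^sup>2 \<le> (norm (energy_embedding w))\<^sup>2"
      using c by (simp add: power_mult_distrib)
    then have le: "sqrt c * norm (Binv w) \<le> norm (energy_embedding w)" by (rule power2_le_imp_le) simp
    have "norm w \<le> L * norm (Binv w)" using L[OF Binv_in[OF w]] by (simp add: B_Binv w)
    also have "\<dots> \<le> \<bar>L\<bar> * norm (Binv w)" by (intro mult_right_mono) auto
    also have "\<dots> = \<bar>L\<bar> / sqrt c * (sqrt c * norm (Binv w))" using c by simp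
    also have "\<dots> \<le> \<bar>L\<bar> / sqrt c * norm (energy_embedding w)" using le c by (intro mult_left_mono) auto
    finally show ?thesis .
  qed
  then show ?thesis using c by (intro exI[of _ "\<bar>L\<bar> / sqrt c"]) auto
qed

end

section \<open>Test functions\<close>

lemma C_k_lower: "C_k (Suc k) f \<Longrightarrow> C_k k f"
proof (induction k arbitrary: f)
  case 0
  then show ?case
    by (auto simp: differentiable_imp_continuous_within intro!: continuous_at_imp_continuous_on)
next
  case (Suc k)
  then show ?case by (metis C_k.simps(2))
qed

lemma frechet_derivative_eq: "(f has_derivative f') (at x) \<Longrightarrow> frechet_derivative f (at x) v = f' v"
  by (metis frechet_derivative_at)

lemma C_k_zero: "C_k k (\<lambda>_. 0)"
  by (induction k) simp_all

lemma C_k_const: "C_k k (\<lambda>_. c)"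
  by (cases k) (simp_all add: C_k_zero)

lemma C_k_add: "C_k k f \<Longrightarrow> C_k k g \<Longrightarrow> C_k k (\<lambda>x. f x + g x)"
proof (induction k arbitrary: f g)
  case (Suc k)
  have "frechet_derivative (\<lambda>x. f x + g x) (at x) v
      = frechet_derivative f (at x) v + frechet_derivative g (at x) v" for x v
  proof -
    have "f differentiable (at x)" "g differentiable (at x)" using Suc.prems by auto
    then show ?thesis
      by (intro frechet_derivative_eq has_derivative_add) (simp_all flip: frechet_derivative_works)
  qed
  then show ?case using Suc by (auto intro: differentiable_add)
qed (simp add: continuous_on_add)

lemma C_k_mult: "C_k k f \<Longrightarrow> C_k k g \<Longrightarrow> C_k k (\<lambda>x. f x * g x)"
proof (induction k arbitrary: f g)
  case (Suc k)
  have diff: "f differentiable (at x)" "g differentiable (at x)" for x using Suc.prems by auto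
  have "frechet_derivative (\<lambda>x. f x * g x) (at x) v
      = f x * frechet_derivative g (at x) v + frechet_derivative f (at x) v * g x" for x v
    using diff by (intro frechet_derivative_eq has_derivative_mult) (simp_all flip: frechet_derivative_works)
  then show ?case using Suc.prems C_k_lower[OF Suc.prems(1)] C_k_lower[OF Suc.prems(2)]
    by (auto intro!: differentiable_mult C_k_add Suc.IH)
qed (simp add: continuous_on_mult)

lemma C_k_prod: "(\<And>i. i \<in> A \<Longrightarrow> C_k k (f i)) \<Longrightarrow> C_k k (\<lambda>x. \<Prod>i\<in>A. f i x)"
  by (induction A rule: infinite_finite_induct) (auto intro: C_k_const C_k_mult)

text \<open>For n = 0 this is the classical smooth function that is flat at 0. The powers of 1/t are
  included because the family is then closed under differentiation up to linear combinations, so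
  smoothness follows by one induction over all n at once.\<close>

definition flat :: "nat \<Rightarrow> real \<Rightarrow> real" where
  "flat n t = (if 0 < t then (1 / t) ^ n * exp (- (1 / t)) else 0)"

lemma flat_has_derivative:
  "(flat n has_real_derivative - real n * flat (Suc n) t + flat (n + 2) t) (at t)"
proof -
  consider "t < 0" | "t = 0" | "0 < t" by linarith
  then show ?thesis
  proof cases
    case 1
    have "((\<lambda>_. 0) has_real_derivative 0) (at t)" by simp
    then have "(flat n has_real_derivative 0) (at t)"
      by (rule DERIV_cong_ev[THEN iffD1, OF refl _ refl, rotated])
        (use 1 eventually_nhds_in_open[of "{..<0}" t] in \<open>auto simp: flat_def elim!: eventually_mono\<close>)
    then show ?thesis using 1 by (simp add: flat_def)
  next
    case 2
    \<comment> \<open>The difference quotient at 0 from the right; after substituting 1/h it is a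
      power divided by an exponential at infinity.\<close>
    have "((\<lambda>h. (1 / h) ^ Suc n / exp (1 / h)) \<longlongrightarrow> 0) (at_right (0::real))"
      by (rule filterlim_compose[OF tendsto_power_div_exp_0])
        (use filterlim_inverse_at_top_right in \<open>simp add: inverse_eq_divide\<close>)
    then have right: "((\<lambda>h. flat n h / h) \<longlongrightarrow> 0) (at_right 0)"
      by (rule Lim_transform_eventually)
        (use eventually_at_right_less[of "0::real"] in eventually_elim, auto simp: flat_def exp_minus field_simps)
    have left: "((\<lambda>h. flat n h / h) \<longlongrightarrow> 0) (at_left 0)"
      by (rule Lim_transform_eventually[OF tendsto_const])
        (auto simp: flat_def eventually_at_filter)
    have "((\<lambda>h. (flat n (0 + h) - flat n 0) / h) \<longlongrightarrow> 0) (at 0)"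
      using filterlim_split_at[OF left right] by (simp add: flat_def)
    then show ?thesis using 2 by (simp add: DERIV_def flat_def)
  next
    case 3
    have u: "((\<lambda>t. 1 / t) has_real_derivative - ((1 / t)\<^sup>2)) (at t)"
      using 3 by (auto intro!: derivative_eq_intros simp: power2_eq_square)
    have "((\<lambda>t. (1 / t) ^ n * exp (- (1 / t))) has_real_derivative
        - real n * ((1 / t) ^ Suc n * exp (- (1 / t))) + (1 / t) ^ (n + 2) * exp (- (1 / t))) (at t)"
      by (rule DERIV_cong[OF DERIV_mult[OF DERIV_power[OF u] DERIV_fun_exp[OF DERIV_minus[OF u]]]])
        (cases n; simp add: power2_eq_square algebra_simps flip: add_divide_distrib)
    then have "(flat n has_real_derivative
        - real n * ((1 / t) ^ Suc n * exp (- (1 / t))) + (1 / t) ^ (n + 2) * exp (- (1 / t))) (at t)"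
      by (rule DERIV_cong_ev[THEN iffD1, OF refl _ refl, rotated])
        (use 3 eventually_nhds_in_open[of "{0<..}" t] in \<open>auto simp: flat_def elim!: eventually_mono\<close>)
    then show ?thesis using 3 by (simp add: flat_def)
  qed
qed

lemma C_k_flat: "C_k k (\<lambda>x. flat n (c \<bullet> x + d))"
proof (induction k arbitrary: n)
  case 0
  have "continuous_on UNIV (flat n)"
    by (intro continuous_at_imp_continuous_on ballI DERIV_isCont[OF flat_has_derivative])
  then show ?case by (auto intro!: continuous_intros continuous_on_compose2[of UNIV "flat n"])
next
  case (Suc k)
  define F where "F x = - real n * flat (Suc n) (c \<bullet> x + d) + flat (n + 2) (c \<bullet> x + d)" for x
  have deriv: "((\<lambda>x. flat n (c \<bullet> x + d)) has_derivative (\<lambda>v. F x * (c \<bullet> v))) (at x)" for x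
  proof -
    have "((\<lambda>x. c \<bullet> x + d) has_derivative (\<lambda>v. c \<bullet> v)) (at x)"
      by (auto intro!: derivative_eq_intros)
    from has_derivative_compose[OF this flat_has_derivative[of n "c \<bullet> x + d", unfolded has_field_derivative_def]]
    show ?thesis by (simp add: F_def o_def)
  qed
  have "C_k k (\<lambda>x. F x * (c \<bullet> v))" for v
    unfolding F_def by (intro C_k_mult C_k_add C_k_const Suc.IH)
  then show ?case
    using deriv by (auto simp: frechet_derivative_at[OF deriv, symmetric] differentiable_def)
qed

lemma flat_0_le: "0 \<le> flat 0 t" "flat 0 t \<le> 1"
  by (auto simp: flat_def)

lemma flat_0_tendsto: "(\<lambda>n. flat 0 (real n * t)) \<longlonglongrightarrow> (if 0 < t then 1 else 0)"
proof (cases "0 < t")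
  case True
  have "(\<lambda>n. exp (- (inverse (real n) * (1 / t)))) \<longlonglongrightarrow> exp (- (0 * (1 / t)))"
    by (intro tendsto_intros lim_inverse_n)
  then have "(\<lambda>n. flat 0 (real n * t)) \<longlonglongrightarrow> exp (- (0 * (1 / t)))"
    by (rule Lim_transform_eventually)
      (use eventually_gt_at_top[of "0::nat"] in eventually_elim, use True in \<open>auto simp: flat_def divide_inverse\<close>)
  then show ?thesis using True by simp
next
  case False
  then have "flat 0 (real n * t) = 0" for n
    by (auto simp: flat_def zero_less_mult_iff)
  then show ?thesis using False by simp
qed

text \<open>Scaling the argument by n sharpens the smooth steps to jumps, so the bumps tend
  pointwise to the indicator of the open box. Their supports stay inside the closed box for every
  n.\<close>

definition box_bump :: "'a::euclidean_space \<Rightarrow> 'a \<Rightarrow> nat \<Rightarrow> 'a \<Rightarrow> real" where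
  "box_bump a b n x =
    (\<Prod>i\<in>Basis. flat 0 (real n * (x \<bullet> i - a \<bullet> i)) * flat 0 (real n * (b \<bullet> i - x \<bullet> i)))"

lemma C_k_box_bump: "C_k k (box_bump a b n)"
proof -
  have "C_k k (\<lambda>x. flat 0 ((real n *\<^sub>R i) \<bullet> x + - (real n * (a \<bullet> i)))
      * flat 0 ((- real n *\<^sub>R i) \<bullet> x + real n * (b \<bullet> i)))" for i
    by (intro C_k_mult C_k_flat)
  then have "C_k k (\<lambda>x. \<Prod>i\<in>Basis. flat 0 ((real n *\<^sub>R i) \<bullet> x + - (real n * (a \<bullet> i)))
      * flat 0 ((- real n *\<^sub>R i) \<bullet> x + real n * (b \<bullet> i)))"
    by (intro C_k_prod)
  then show ?thesis unfolding box_bump_def by (simp add: inner_commute algebra_simps)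
qed

lemma box_bump_bounds: "0 \<le> box_bump a b n x" "box_bump a b n x \<le> indicator (box a b) x"
proof -
  show "0 \<le> box_bump a b n x"
    unfolding box_bump_def by (intro prod_nonneg) (simp add: flat_0_le)
  have "box_bump a b n x \<le> 1"
    unfolding box_bump_def by (intro prod_le_1) (auto simp: flat_0_le intro!: mult_le_one)
  moreover have "box_bump a b n x = 0" if outside: "x \<notin> box a b"
  proof -
    obtain i where i: "i \<in> Basis" "x \<bullet> i \<le> a \<bullet> i \<or> b \<bullet> i \<le> x \<bullet> i"
      using outside unfolding mem_box by (meson not_less)
    then have "flat 0 (real n * (x \<bullet> i - a \<bullet> i)) * flat 0 (real n * (b \<bullet> i - x \<bullet> i)) = 0"
      by (auto simp: flat_def zero_less_mult_iff)
    then show ?thesis unfolding box_bump_def using i(1) by (intro prod_zero) auto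
  qed
  ultimately show "box_bump a b n x \<le> indicator (box a b) x" by (auto simp: indicator_def)
qed

lemma box_bump_tendsto: "(\<lambda>n. box_bump a b n x) \<longlonglongrightarrow> indicator (box a b) x"
proof -
  have "(\<lambda>n. box_bump a b n x) \<longlonglongrightarrow>
    (\<Prod>i\<in>Basis. (if 0 < x \<bullet> i - a \<bullet> i then 1 else 0) * (if 0 < b \<bullet> i - x \<bullet> i then 1 else 0))"
    unfolding box_bump_def by (intro tendsto_prod tendsto_mult flat_0_tendsto)
  also have "(\<Prod>i\<in>Basis. (if 0 < x \<bullet> i - a \<bullet> i then 1 else 0) * (if 0 < b \<bullet> i - x \<bullet> i then 1 else 0 :: real))
    = (\<Prod>i\<in>Basis. if a \<bullet> i < x \<bullet> i \<and> x \<bullet> i < b \<bullet> i then 1 else 0)"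
    by (intro prod.cong) auto
  also have "\<dots> = indicator (box a b) x"
    by (auto simp: indicator_def mem_box prod_zero_iff)
  finally show ?thesis .
qed

lemma box_bump_test_function:
  assumes "cbox a b \<subseteq> \<Omega>"
  shows "box_bump a b n \<in> test_functions \<Omega>"
proof -
  have "{x. box_bump a b n x \<noteq> 0} \<subseteq> box a b"
  proof
    fix x assume "x \<in> {x. box_bump a b n x \<noteq> 0}"
    then show "x \<in> box a b"
      using box_bump_bounds[of a b n x] by (cases "x \<in> box a b") auto
  qed
  then have sub: "closure {x. box_bump a b n x \<noteq> 0} \<subseteq> cbox a b"
    by (intro closure_minimal) (auto intro: subsetD[OF box_subset_cbox])
  then have "compact (closure {x. box_bump a b n x \<noteq> 0})"
    by (meson bounded_cbox bounded_subset closed_closure compact_eq_bounded_closed)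
  then show ?thesis using sub assms by (auto simp: test_functions_def C_k_box_bump)
qed

section \<open>Functions determined by their integrals over boxes\<close>

lemma sigma_finite_lebesgue: "sigma_finite_measure (lebesgue :: 'a::euclidean_space measure)"
proof
  obtain A :: "'a set set" where A: "countable A" "A \<subseteq> sets lborel" "\<Union>A = space lborel"
      "\<forall>a\<in>A. emeasure lborel a \<noteq> \<infinity>"
    using lborel.sigma_finite_countable by (elim exE conjE) (rule that)
  show "\<exists>A. countable A \<and> A \<subseteq> sets (lebesgue :: 'a measure) \<and> \<Union>A = space lebesgue \<and>
      (\<forall>a\<in>A. emeasure lebesgue a \<noteq> \<infinity>)"
  proof (intro exI conjI)
    show "countable A" by fact
    show "A \<subseteq> sets lebesgue" using A(2) by auto
    show "\<Union>A = space lebesgue" using A(3) by simp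
    show "\<forall>a\<in>A. emeasure lebesgue a \<noteq> \<infinity>"
    proof
      fix a assume "a \<in> A"
      then show "emeasure lebesgue a \<noteq> \<infinity>" using A(2,4) by (subst emeasure_completion) (auto simp: subset_eq)
    qed
  qed
qed

text \<open>Dynkin's argument: open boxes are stable under intersection and generate the Borel sets,
  and sets with vanishing integral are closed under complements and disjoint countable unions. Null
  sets carry this over to all Lebesgue sets, and a density is determined by its integrals.\<close>

lemma AE_zero_if_box_integrals_zero:
  fixes f :: "'a::euclidean_space \<Rightarrow> 'b::euclidean_space"
  assumes f: "integrable lebesgue f" and zero: "\<And>a b. (LINT x:box a b|lebesgue. f x) = 0"
  shows "AE x in lebesgue. f x = 0"
proof -
  have set_int: "set_integrable lebesgue A f" if "A \<in> sets lebesgue" for A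
    using f that unfolding set_integrable_def by (intro integrable_mult_indicator)
  have borel: "(LINT x:A|lebesgue. f x) = 0" if "A \<in> sets borel" for A
  proof -
    let ?G = "range (\<lambda>(a, b). box a b :: 'a set)"
    have sets: "sigma_sets UNIV ?G \<subseteq> sets lebesgue"
      using borel_eq_box[where 'a='a] by (metis sets_measure_of subset_UNIV Pow_UNIV sets_completionI_sets sets_lborel subsetI)
    have A: "A \<in> sigma_sets UNIV ?G"
      using that borel_eq_box[where 'a='a] by (metis sets_measure_of subset_UNIV Pow_UNIV)
    have "Int_stable ?G" by (auto simp: Int_stable_def box_Int_box)
    moreover have "?G \<subseteq> Pow UNIV" by simp
    ultimately show ?thesis using A
    proof (induction rule: sigma_sets_induct_disjoint)
      case (basic A)
      then show ?case using zero by auto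
    next
      case empty
      show ?case by (simp add: set_lebesgue_integral_def)
    next
      case (compl A)
      \<comment> \<open>Complements need the integral over the whole space, which is not a box; it
        is the limit of the integrals over an exhausting sequence of boxes.\<close>
      have "(LINT x:UNIV|lebesgue. f x) = 0"
      proof -
        define Q where "Q n = box (- (real n *\<^sub>R One)) (real n *\<^sub>R One :: 'a)" for n
        have "x \<in> Q n" if "m \<le> n" "x \<in> Q m" for m n x
        proof -
          have "real m \<le> real n" using that by simp
          moreover have "\<forall>i\<in>Basis. - real m < x \<bullet> i \<and> x \<bullet> i < real m"
            using that(2) by (simp add: Q_def mem_box)
          ultimately have "\<forall>i\<in>Basis. - real n < x \<bullet> i \<and> x \<bullet> i < real n" by force
          then show ?thesis by (simp add: Q_def mem_box)
        qed
        then have "incseq Q" by (auto simp: incseq_def)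
        moreover have "Q n \<in> sets lebesgue" for n by (simp add: Q_def)
        ultimately have "(\<lambda>n. LINT x:Q n|lebesgue. f x) \<longlonglongrightarrow> (LINT x:(\<Union>n. Q n)|lebesgue. f x)"
          by (intro set_integral_cont_up set_int) auto
        moreover have "(\<Union>n. Q n) = UNIV" using UN_box_eq_UNIV by (simp add: Q_def)
        ultimately show ?thesis using zero by (simp add: Q_def LIMSEQ_const_iff)
      qed
      moreover have "A \<in> sets lebesgue" using compl sets by blast
      moreover from this have "UNIV - A \<in> sets lebesgue" using sets.compl_sets[of A lebesgue] by simp
      ultimately show ?case
        using compl set_integral_Un[of A "UNIV - A" lebesgue f] set_int by auto
    next
      case (union X)
      have X: "X i \<in> sets lebesgue" for i using union(2) sets by blast
      have "(LINT x:(\<Union>i. X i)|lebesgue. f x) = (\<Sum>i. LINT x:X i|lebesgue. f x)"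
        using X union(1) set_int by (intro lebesgue_integral_countable_add) (auto simp: disjoint_family_on_def)
      then show ?case using union(3) by simp
    qed
  qed
  have "(LINT x:A|lebesgue. f x) = 0" if A: "A \<in> sets lebesgue" for A
  proof -
    obtain S N N' where S: "A = S \<union> N" "N \<subseteq> N'" "N' \<in> null_sets lborel" "S \<in> sets lborel"
      using A by (rule sets_completionE)
    then have "AE x in lebesgue. x \<notin> N'"
      by (intro AE_not_in) (auto intro: null_sets_completionI)
    then have "AE x in lebesgue. x \<in> S \<longleftrightarrow> x \<in> A" by eventually_elim (use S in auto)
    moreover have "S \<in> sets lebesgue" using S(4) by simp
    ultimately have "(LINT x:A|lebesgue. f x) = (LINT x:S|lebesgue. f x)"
      using set_int[OF A] set_int by (intro set_integral_cong_set[symmetric])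
        (auto simp: set_integrable_def set_borel_measurable_def)
    then show ?thesis using borel[of S] S(4) by simp
  qed
  then show ?thesis
    by (intro sigma_finite_measure.density_zero[OF sigma_finite_lebesgue f])
qed

section \<open>The weak divergence\<close>

text \<open>The weak divergence pairs functions in two ways, scalar times vector and vector times
  matrix. An arbitrary bounded bilinear product covers both.\<close>

lemma bounded_bilinear_square_integrable:
  fixes op :: "'b::euclidean_space \<Rightarrow> 'c::euclidean_space \<Rightarrow> 'e::euclidean_space"
  assumes op: "bounded_bilinear op" and f: "square_integrable f" and g: "square_integrable g"
  shows "integrable lebesgue (\<lambda>x. op (f x) (g x))"
proof -
  obtain C where C: "0 < C" "\<And>a b. norm (op a b) \<le> norm a * norm b * C"
    using bounded_bilinear.pos_bounded[OF op] by blast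
  have [measurable]: "f \<in> borel_measurable lebesgue" "g \<in> borel_measurable lebesgue"
    using f g by (auto simp: square_integrable_def)
  have int: "integrable lebesgue (\<lambda>x. C * ((norm (f x))\<^sup>2 + (norm (g x))\<^sup>2))"
    using f g by (auto simp: square_integrable_def)
  show ?thesis
  proof (rule Bochner_Integration.integrable_bound[OF int])
    have "continuous_on UNIV (\<lambda>z. op (fst z) (snd z))"
      by (rule bounded_bilinear.continuous_on[OF op]) (auto intro: continuous_intros)
    then show "(\<lambda>x. op (f x) (g x)) \<in> borel_measurable lebesgue"
      by (rule borel_measurable_continuous_Pair[rotated 2]) measurable
    show "AE x in lebesgue. norm (op (f x) (g x)) \<le> norm (C * ((norm (f x))\<^sup>2 + (norm (g x))\<^sup>2))"
    proof (rule AE_I2)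
      fix x
      have "norm (f x) * norm (g x) \<le> 2 * norm (f x) * norm (g x)" by simp
      also have "\<dots> \<le> (norm (f x))\<^sup>2 + (norm (g x))\<^sup>2" by (rule sum_squares_bound)
      finally have "norm (f x) * norm (g x) * C \<le> ((norm (f x))\<^sup>2 + (norm (g x))\<^sup>2) * C"
        using C(1) by (intro mult_right_mono) auto
      then show "norm (op (f x) (g x)) \<le> norm (C * ((norm (f x))\<^sup>2 + (norm (g x))\<^sup>2))"
        using C(1) order_trans[OF C(2)[of "f x" "g x"]] by (simp add: mult.commute)
    qed
  qed
qed

lemma bounded_bilinear_vector_matrix_mult:
  "bounded_bilinear ((v*) :: real^'d \<Rightarrow> real^'m^'d \<Rightarrow> real^'m)"
proof (subst bilinear_conv_bounded_bilinear[symmetric])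
  show "bilinear ((v*) :: real^'d \<Rightarrow> real^'m^'d \<Rightarrow> real^'m)"
    unfolding bilinear_def
    by (intro conjI allI linearI)
      (simp_all add: vec_eq_iff vector_matrix_mult_def algebra_simps sum.distrib sum_distrib_left)
qed

lemma square_integrable_continuous_compact:
  fixes h :: "'a::euclidean_space \<Rightarrow> 'b::euclidean_space"
  assumes h: "continuous_on UNIV h" and C: "compact C" and zero: "\<And>x. x \<notin> C \<Longrightarrow> h x = 0"
  shows "square_integrable h"
proof -
  have meas: "h \<in> borel_measurable lebesgue"
    using borel_measurable_continuous_onI[OF h] by (intro measurable_completion) simp
  have "integrable lborel (\<lambda>x. indicator C x *\<^sub>R (norm (h x))\<^sup>2)"
    using continuous_on_subset[OF h] by (intro borel_integrable_compact[OF C] continuous_on_power continuous_on_norm) auto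
  also have "(\<lambda>x. indicator C x *\<^sub>R (norm (h x))\<^sup>2) = (\<lambda>x. (norm (h x))\<^sup>2)"
    using zero by (intro ext) (auto simp: indicator_def)
  finally have "integrable lborel (\<lambda>x. (norm (h x))\<^sup>2)" .
  then have "integrable lebesgue (\<lambda>x. (norm (h x))\<^sup>2)"
    by (subst integrable_completion) (auto dest: borel_measurable_integrable)
  then show ?thesis using meas by (simp add: square_integrable_def)
qed

lemma test_function_square_integrable:
  assumes "\<phi> \<in> test_functions \<Omega>"
  shows "square_integrable \<phi>"
proof (rule square_integrable_continuous_compact)
  show "continuous_on UNIV \<phi>" using assms C_k.simps(1)[of \<phi>] unfolding test_functions_def by blast
  show "compact (closure {x. \<phi> x \<noteq> 0})" using assms by (auto simp: test_functions_def)
  show "\<phi> x = 0" if "x \<notin> closure {x. \<phi> x \<noteq> 0}" for x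
    using that closure_subset[of "{x. \<phi> x \<noteq> 0}"] by auto
qed

lemma grad_square_integrable:
  assumes "\<phi> \<in> test_functions \<Omega>"
  shows "square_integrable (grad \<phi>)"
proof (rule square_integrable_continuous_compact)
  have "C_k (Suc 0) \<phi>" using assms unfolding test_functions_def by blast
  then have "continuous_on UNIV (\<lambda>x. frechet_derivative \<phi> (at x) v)" for v by simp
  then show "continuous_on UNIV (grad \<phi>)" unfolding grad_def by (intro continuous_on_vec_lambda)
  show "compact (closure {x. \<phi> x \<noteq> 0})" using assms by (auto simp: test_functions_def)
  show "grad \<phi> x = 0" if x: "x \<notin> closure {x. \<phi> x \<noteq> 0}" for x
  proof -
    have "(\<phi> has_derivative (\<lambda>_. 0)) (at x)"
    proof (rule has_derivative_transform_within_open[OF has_derivative_const])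
      show "open (- closure {x. \<phi> x \<noteq> 0})" by auto
      show "x \<in> - closure {x. \<phi> x \<noteq> 0}" using x by auto
      show "0 = \<phi> y" if "y \<in> - closure {x. \<phi> x \<noteq> 0}" for y
        using that closure_subset[of "{x. \<phi> x \<noteq> 0}"] by auto
    qed
    then show ?thesis by (simp add: grad_def frechet_derivative_eq vec_eq_iff)
  qed
qed

text \<open>The bumps converge to indicators of boxes, and boxes generate the Borel sets.\<close>

lemma L2_zero_if_test_integrals_zero:
  fixes w :: "('a::euclidean_space, 'b::euclidean_space) L2"
  assumes \<Omega>: "open \<Omega>" and w: "w \<in> L2_on \<Omega>"
    and zero: "\<And>\<phi>. \<phi> \<in> test_functions \<Omega> \<Longrightarrow> (LINT x:\<Omega>|lebesgue. \<phi> x *\<^sub>R L2_fun w x) = 0"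
  shows "w = 0"
proof -
  have box_zero: "AE x in lebesgue. x \<in> cbox a b \<longrightarrow> L2_fun w x = 0" if ab: "cbox a b \<subseteq> \<Omega>" for a b
  proof -
    \<comment> \<open>Cutting off at a box makes the function integrable over the whole space, since
      the indicator is itself square integrable.\<close>
    define f where "f x = indicator (box a b) x *\<^sub>R L2_fun w x" for x
    have "square_integrable (indicator (box a b) :: 'a \<Rightarrow> real)"
      using lmeasurable_box[of a b] by (simp add: square_integrable_def power2_eq_square lmeasurable_iff_integrable
          indicator_inter_arith[symmetric] borel_measurable_integrable)
    then have f: "integrable lebesgue f" unfolding f_def
      by (rule bounded_bilinear_square_integrable[OF bounded_bilinear_scaleR _ square_integrable_L2_fun])
    have "AE x in lebesgue. f x = 0"
    proof (rule AE_zero_if_box_integrals_zero[OF f])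
      fix c d :: 'a
      \<comment> \<open>The intersection of two boxes is again a box, and its closure lies in
        \<Omega>. Its bumps are thus admissible test functions, and their limit produces the
        integral over the intersection.\<close>
      obtain c' d' where cd: "box c d \<inter> box a b = box c' d'" by (rule that[OF box_Int_box])
      show "(LINT x:box c d|lebesgue. f x) = 0"
      proof (cases "box c' d' = {}")
        case True
        then have "indicator (box c d) x *\<^sub>R f x = 0" for x
          using cd by (auto simp: f_def indicator_def)
        then show ?thesis unfolding set_lebesgue_integral_def by (simp only: integral_zero)
      next
        case False
        have "cbox c' d' \<subseteq> cbox a b"
        proof -
          have "closure (box c' d') \<subseteq> cbox a b"
            using cd box_subset_cbox[of a b] by (intro closure_minimal) auto
          then show ?thesis using closure_box[OF False] by simp
        qed
        then have test: "box_bump c' d' n \<in> test_functions \<Omega>" for n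
          using ab by (intro box_bump_test_function) auto
        have "(\<lambda>n. LINT x|lebesgue. indicator \<Omega> x *\<^sub>R (box_bump c' d' n x *\<^sub>R L2_fun w x)) \<longlonglongrightarrow>
          (LINT x|lebesgue. indicator (box c d) x *\<^sub>R f x)"
        proof (rule integral_dominated_convergence[where w = "\<lambda>x. norm (f x)"])
          have eq: "indicator \<Omega> x *\<^sub>R indicator (box c' d') x *\<^sub>R L2_fun w x = indicator (box c d) x *\<^sub>R f x" for x
            using ab box_subset_cbox[of a b] unfolding cd[symmetric] f_def by (auto simp: indicator_def)
          show "AE x in lebesgue. (\<lambda>n. indicator \<Omega> x *\<^sub>R (box_bump c' d' n x *\<^sub>R L2_fun w x)) \<longlonglongrightarrow>
            indicator (box c d) x *\<^sub>R f x"
            unfolding eq[symmetric] by (intro AE_I2 tendsto_scaleR tendsto_const box_bump_tendsto)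
          show "integrable lebesgue (\<lambda>x. norm (f x))" using f by simp
          show "AE x in lebesgue. norm (indicator \<Omega> x *\<^sub>R (box_bump c' d' n x *\<^sub>R L2_fun w x)) \<le> norm (f x)" for n
          proof (rule AE_I2)
            fix x
            have "indicator \<Omega> x * box_bump c' d' n x \<le> 1 * indicator (box c' d') x"
              using box_bump_bounds[of c' d' n x] by (intro mult_mono) (auto simp: indicator_def)
            also have "\<dots> \<le> indicator (box a b) x" using cd by (auto simp: indicator_def)
            finally have "\<bar>indicator \<Omega> x * box_bump c' d' n x\<bar> \<le> indicator (box a b) x"
              using box_bump_bounds(1)[of c' d' n x] by (simp add: abs_mult)
            from mult_right_mono[OF this, of "norm (L2_fun w x)"]
            show "norm (indicator \<Omega> x *\<^sub>R (box_bump c' d' n x *\<^sub>R L2_fun w x)) \<le> norm (f x)"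
              by (simp add: f_def abs_mult mult.assoc)
          qed
          have "box_bump c' d' n \<in> borel_measurable lebesgue" for n
            using test_function_square_integrable[OF test] by (simp add: square_integrable_def)
          moreover have "\<Omega> \<in> sets lebesgue" using \<Omega> by simp
          ultimately show "(\<lambda>x. indicator \<Omega> x *\<^sub>R (box_bump c' d' n x *\<^sub>R L2_fun w x)) \<in> borel_measurable lebesgue" for n
            by measurable
          show "(\<lambda>x. indicator (box c d) x *\<^sub>R f x) \<in> borel_measurable lebesgue"
            using f by (intro borel_measurable_scaleR borel_measurable_indicator) auto
        qed
        then show ?thesis
          using zero[OF test] by (simp add: set_lebesgue_integral_def LIMSEQ_const_iff)
      qed
    qed
    \<comment> \<open>The bumps see the open box only; its boundary is a null set. Closed boxes are
      wanted because countably many of them cover \<Omega>.\<close>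
    moreover have "AE x in lebesgue. x \<notin> cbox a b - box a b"
      by (intro AE_not_in negligible_frontier_interval[unfolded negligible_iff_null_sets])
    ultimately show ?thesis by eventually_elim (auto simp: f_def)
  qed
  obtain \<D> where \<D>: "countable \<D>" "\<D> \<subseteq> Pow \<Omega>" "\<And>X. X \<in> \<D> \<Longrightarrow> \<exists>a b. X = cbox a b" "\<Union>\<D> = \<Omega>"
    using open_countable_Union_open_cbox[OF \<Omega>] by metis
  have "AE x in lebesgue. \<forall>X\<in>\<D>. x \<in> X \<longrightarrow> L2_fun w x = 0"
  proof (rule AE_ball_countable'[OF _ \<D>(1)])
    fix X assume X: "X \<in> \<D>"
    then obtain a b where "X = cbox a b" using \<D>(3) by blast
    then show "AE x in lebesgue. x \<in> X \<longrightarrow> L2_fun w x = 0" using box_zero X \<D>(2) by blast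
  qed
  moreover have "AE x in lebesgue. x \<notin> \<Omega> \<longrightarrow> L2_fun w x = 0" using w by (simp add: L2_on_def)
  ultimately have "AE x in lebesgue. L2_fun w x = L2_fun 0 x"
    using L2_fun_zero by eventually_elim (use \<D>(4) in auto)
  then show ?thesis by (simp add: L2_eq_iff)
qed

section \<open>Uniqueness and linearity of the weak divergence\<close>

context
  fixes \<Omega> :: "(real^'d) set"
  assumes \<Omega>: "open \<Omega>"
begin

lemma \<Omega>_lebesgue: "\<Omega> \<in> sets lebesgue"
  using \<Omega> by simp

lemma set_integrable_bilinear_L2:
  fixes op :: "'b::euclidean_space \<Rightarrow> 'c::euclidean_space \<Rightarrow> 'e::euclidean_space"
  assumes "bounded_bilinear op" "square_integrable f"
  shows "set_integrable lebesgue \<Omega> (\<lambda>x. op (f x) (L2_fun w x))"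
  unfolding set_integrable_def
  by (intro integrable_mult_indicator \<Omega>_lebesgue bounded_bilinear_square_integrable[OF assms] square_integrable_L2_fun)

lemma set_integral_bilinear_L2_add:
  fixes op :: "'b::euclidean_space \<Rightarrow> 'c::euclidean_space \<Rightarrow> 'e::euclidean_space"
  assumes op: "bounded_bilinear op" and f: "square_integrable f"
  shows "(LINT x:\<Omega>|lebesgue. op (f x) (L2_fun (u + v) x))
    = (LINT x:\<Omega>|lebesgue. op (f x) (L2_fun u x)) + (LINT x:\<Omega>|lebesgue. op (f x) (L2_fun v x))"
proof -
  note int = set_integrable_bilinear_L2[OF op f]
  have "(LINT x:\<Omega>|lebesgue. op (f x) (L2_fun (u + v) x))
    = (LINT x:\<Omega>|lebesgue. op (f x) (L2_fun u x) + op (f x) (L2_fun v x))"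
    unfolding set_lebesgue_integral_def
  proof (rule integral_cong_AE)
    show "(\<lambda>x. indicator \<Omega> x *\<^sub>R op (f x) (L2_fun (u + v) x)) \<in> borel_measurable lebesgue"
      using int[of "u + v"] by (simp add: set_integrable_def)
    show "(\<lambda>x. indicator \<Omega> x *\<^sub>R (op (f x) (L2_fun u x) + op (f x) (L2_fun v x))) \<in> borel_measurable lebesgue"
      using set_integral_add(1)[OF int[of u] int[of v]] by (simp add: set_integrable_def)
    show "AE x in lebesgue. indicator \<Omega> x *\<^sub>R op (f x) (L2_fun (u + v) x)
        = indicator \<Omega> x *\<^sub>R (op (f x) (L2_fun u x) + op (f x) (L2_fun v x))"
      using L2_fun_add[of u v] by eventually_elim (simp add: bounded_bilinear.add_right[OF op])
  qed
  then show ?thesis using set_integral_add(2)[OF int[of u] int[of v]] by simp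
qed

lemma set_integral_bilinear_L2_scaleR:
  fixes op :: "'b::euclidean_space \<Rightarrow> 'c::euclidean_space \<Rightarrow> 'e::euclidean_space"
  assumes op: "bounded_bilinear op" and f: "square_integrable f"
  shows "(LINT x:\<Omega>|lebesgue. op (f x) (L2_fun (c *\<^sub>R u) x)) = c *\<^sub>R (LINT x:\<Omega>|lebesgue. op (f x) (L2_fun u x))"
proof -
  note int = set_integrable_bilinear_L2[OF op f]
  have "(LINT x:\<Omega>|lebesgue. op (f x) (L2_fun (c *\<^sub>R u) x))
    = (LINT x:\<Omega>|lebesgue. c *\<^sub>R op (f x) (L2_fun u x))"
    unfolding set_lebesgue_integral_def
  proof (rule integral_cong_AE)
    show "(\<lambda>x. indicator \<Omega> x *\<^sub>R op (f x) (L2_fun (c *\<^sub>R u) x)) \<in> borel_measurable lebesgue"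
      using int[of "c *\<^sub>R u"] by (simp add: set_integrable_def)
    show "(\<lambda>x. indicator \<Omega> x *\<^sub>R c *\<^sub>R op (f x) (L2_fun u x)) \<in> borel_measurable lebesgue"
      using set_integrable_scaleR_right[OF int[of u], of c] unfolding set_integrable_def
      by (rule borel_measurable_integrable)
    show "AE x in lebesgue. indicator \<Omega> x *\<^sub>R op (f x) (L2_fun (c *\<^sub>R u) x)
        = indicator \<Omega> x *\<^sub>R c *\<^sub>R op (f x) (L2_fun u x)"
      using L2_fun_scaleR[of c u] by eventually_elim (simp add: bounded_bilinear.scaleR_right[OF op])
  qed
  then show ?thesis by simp
qed

lemma has_weak_div_add:
  assumes "has_weak_div \<Omega> p u" "has_weak_div \<Omega> q v"
  shows "has_weak_div \<Omega> (p + q) (u + v)"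
  using assms unfolding has_weak_div_def
  by (auto simp: set_integral_bilinear_L2_add[OF bounded_bilinear_scaleR test_function_square_integrable]
      set_integral_bilinear_L2_add[OF bounded_bilinear_vector_matrix_mult grad_square_integrable])

lemma has_weak_div_scaleR:
  assumes "has_weak_div \<Omega> p u"
  shows "has_weak_div \<Omega> (c *\<^sub>R p) (c *\<^sub>R u)"
  using assms unfolding has_weak_div_def
  by (auto simp: set_integral_bilinear_L2_scaleR[OF bounded_bilinear_scaleR test_function_square_integrable]
      set_integral_bilinear_L2_scaleR[OF bounded_bilinear_vector_matrix_mult grad_square_integrable])

text \<open>The fundamental lemma of the calculus of variations, applied to u - v. It is what gives
  the description by \<open>THE\<close> in \<open>weak_div\<close> a definite value.\<close>

lemma has_weak_div_unique:
  assumes "has_weak_div \<Omega> p u" "has_weak_div \<Omega> p v" "u \<in> L2_on \<Omega>" "v \<in> L2_on \<Omega>"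
  shows "u = v"
proof -
  have "has_weak_div \<Omega> (p + (-1) *\<^sub>R p) (u + (-1) *\<^sub>R v)"
    using assms by (intro has_weak_div_add has_weak_div_scaleR)
  then have "has_weak_div \<Omega> (0 *\<^sub>R p) (u - v)" by simp
  then have "(LINT x:\<Omega>|lebesgue. \<phi> x *\<^sub>R L2_fun (u - v) x) = 0" if "\<phi> \<in> test_functions \<Omega>" for \<phi>
    using that set_integral_bilinear_L2_scaleR[OF bounded_bilinear_vector_matrix_mult grad_square_integrable[OF that], of 0 p]
    by (simp add: has_weak_div_def)
  then have "u - v = 0"
    using assms by (intro L2_zero_if_test_integrals_zero[OF \<Omega>] subspace_diff[OF L2_on_subspace])
  then show ?thesis by simp
qed

lemma weak_div_eqI: "u \<in> L2_on \<Omega> \<Longrightarrow> has_weak_div \<Omega> p u \<Longrightarrow> weak_div \<Omega> p = u"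
  unfolding weak_div_def using has_weak_div_unique by blast

lemma weak_div:
  assumes "p \<in> Hdiv \<Omega>"
  shows "weak_div \<Omega> p \<in> L2_on \<Omega>" "has_weak_div \<Omega> p (weak_div \<Omega> p)"
  using assms weak_div_eqI unfolding Hdiv_def by auto

lemma HdivI: "p \<in> L2_on \<Omega> \<Longrightarrow> w \<in> L2_on \<Omega> \<Longrightarrow> has_weak_div \<Omega> p w \<Longrightarrow> p \<in> Hdiv \<Omega>"
  by (auto simp: Hdiv_def)

lemma Hdiv_L2_on: "p \<in> Hdiv \<Omega> \<Longrightarrow> p \<in> L2_on \<Omega>"
  by (simp add: Hdiv_def)

lemma Hdiv_add: "p \<in> Hdiv \<Omega> \<Longrightarrow> q \<in> Hdiv \<Omega> \<Longrightarrow> p + q \<in> Hdiv \<Omega>"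
  by (rule HdivI[OF _ _ has_weak_div_add[OF weak_div(2) weak_div(2)]])
    (auto intro: subspace_add[OF L2_on_subspace] weak_div(1) Hdiv_L2_on)

lemma Hdiv_scaleR: "p \<in> Hdiv \<Omega> \<Longrightarrow> c *\<^sub>R p \<in> Hdiv \<Omega>"
  by (rule HdivI[OF _ _ has_weak_div_scaleR[OF weak_div(2)]])
    (auto intro: subspace_scale[OF L2_on_subspace] weak_div(1) Hdiv_L2_on)

lemma weak_div_add:
  "p \<in> Hdiv \<Omega> \<Longrightarrow> q \<in> Hdiv \<Omega> \<Longrightarrow> weak_div \<Omega> (p + q) = weak_div \<Omega> p + weak_div \<Omega> q"
  by (intro weak_div_eqI subspace_add[OF L2_on_subspace] has_weak_div_add weak_div)

lemma weak_div_scaleR: "p \<in> Hdiv \<Omega> \<Longrightarrow> weak_div \<Omega> (c *\<^sub>R p) = c *\<^sub>R weak_div \<Omega> p"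
  by (intro weak_div_eqI subspace_scale[OF L2_on_subspace] has_weak_div_scaleR weak_div)

section \<open>Vanishing normal trace as a linear condition\<close>

lemma normal_trace_eq:
  "normal_trace \<Omega> p u = (LINT x:\<Omega>|lebesgue. L2_fun (weak_grad \<Omega> u) x v* L2_fun p x)
    + (LINT x:\<Omega>|lebesgue. L2_fun u x *\<^sub>R L2_fun (weak_div \<Omega> p) x)"
  unfolding normal_trace_def
  by (intro set_integral_add(2) set_integrable_bilinear_L2[OF bounded_bilinear_vector_matrix_mult]
      set_integrable_bilinear_L2[OF bounded_bilinear_scaleR] square_integrable_L2_fun)

lemma normal_trace_add:
  "p \<in> Hdiv \<Omega> \<Longrightarrow> q \<in> Hdiv \<Omega> \<Longrightarrow> normal_trace \<Omega> (p + q) u = normal_trace \<Omega> p u + normal_trace \<Omega> q u"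
  by (simp add: normal_trace_eq weak_div_add square_integrable_L2_fun
      set_integral_bilinear_L2_add[OF bounded_bilinear_scaleR]
      set_integral_bilinear_L2_add[OF bounded_bilinear_vector_matrix_mult])

lemma normal_trace_scaleR:
  "p \<in> Hdiv \<Omega> \<Longrightarrow> normal_trace \<Omega> (c *\<^sub>R p) u = c *\<^sub>R normal_trace \<Omega> p u"
  by (simp add: normal_trace_eq weak_div_scaleR square_integrable_L2_fun scaleR_add_right
      set_integral_bilinear_L2_scaleR[OF bounded_bilinear_scaleR]
      set_integral_bilinear_L2_scaleR[OF bounded_bilinear_vector_matrix_mult])

lemma zero_in_Hdiv: "(0 :: (real^'d, real^'m^'d) L2) \<in> Hdiv \<Omega>"
proof -
  have "has_weak_div \<Omega> (0 :: (real^'d, real^'m^'d) L2) 0"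
    unfolding has_weak_div_def
  proof
    fix \<phi> assume \<phi>: "\<phi> \<in> test_functions \<Omega>"
    show "(LINT x:\<Omega>|lebesgue. \<phi> x *\<^sub>R L2_fun 0 x)
        = - (LINT x:\<Omega>|lebesgue. grad \<phi> x v* L2_fun (0 :: (real^'d, real^'m^'d) L2) x)"
      using set_integral_bilinear_L2_scaleR[OF bounded_bilinear_scaleR test_function_square_integrable[OF \<phi>], of 0 "0 :: (real^'d, real^'m) L2"]
        set_integral_bilinear_L2_scaleR[OF bounded_bilinear_vector_matrix_mult grad_square_integrable[OF \<phi>], of 0 "0 :: (real^'d, real^'m^'d) L2"]
      by simp
  qed
  then show ?thesis by (rule HdivI[OF subspace_0[OF L2_on_subspace] subspace_0[OF L2_on_subspace]])
qed

lemma H0div_subspace: "subspace (H0div \<Omega>)"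
proof (rule subspaceI)
  show "0 \<in> H0div \<Omega>"
    by (simp add: H0div_def zero_in_Hdiv normal_trace_scaleR[OF zero_in_Hdiv, of 0, simplified])
qed (auto simp: H0div_def Hdiv_add Hdiv_scaleR normal_trace_add normal_trace_scaleR)

section \<open>The constraint set\<close>

lemma dual_constraint_convex: "convex (dual_constraint \<Omega> lam)"
  unfolding convex_alt
proof (intro ballI allI impI, elim conjE)
  fix p q :: "(real^'d, real^'m^'d) L2" and t :: real
  assume pq: "p \<in> dual_constraint \<Omega> lam" "q \<in> dual_constraint \<Omega> lam" and t: "0 \<le> t" "t \<le> 1"
  have "AE x in lebesgue. x \<in> \<Omega> \<longrightarrow> norm (L2_fun p x) \<le> lam"
    "AE x in lebesgue. x \<in> \<Omega> \<longrightarrow> norm (L2_fun q x) \<le> lam"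
    using pq by (auto simp: dual_constraint_def)
  moreover note L2_fun_add[of "(1 - t) *\<^sub>R p" "t *\<^sub>R q"] L2_fun_scaleR[of "1 - t" p] L2_fun_scaleR[of t q]
  ultimately have "AE x in lebesgue. x \<in> \<Omega> \<longrightarrow> norm (L2_fun ((1 - t) *\<^sub>R p + t *\<^sub>R q) x) \<le> lam"
  proof eventually_elim
    case (elim x)
    show ?case
    proof
      assume "x \<in> \<Omega>"
      then have "(1 - t) * norm (L2_fun p x) + t * norm (L2_fun q x) \<le> lam"
        using elim(1,2) t by (intro convex_bound_le) auto
      moreover have "norm (L2_fun ((1 - t) *\<^sub>R p + t *\<^sub>R q) x) \<le> norm ((1 - t) *\<^sub>R L2_fun p x) + norm (t *\<^sub>R L2_fun q x)"
        unfolding elim(3-5) by (rule norm_triangle_ineq)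
      ultimately show "norm (L2_fun ((1 - t) *\<^sub>R p + t *\<^sub>R q) x) \<le> lam" using t by simp
    qed
  qed
  then show "(1 - t) *\<^sub>R p + t *\<^sub>R q \<in> dual_constraint \<Omega> lam"
    using pq subspace_add[OF H0div_subspace] subspace_scale[OF H0div_subspace] by (auto simp: dual_constraint_def)
qed

text \<open>Integrates the pointwise bound over a set of finite measure. This is the L^2 part of the
  finiteness of R.\<close>

lemma dual_constraint_bounded:
  assumes "bounded \<Omega>" "p \<in> dual_constraint \<Omega> lam"
  shows "(norm p)\<^sup>2 \<le> lam\<^sup>2 * measure lebesgue \<Omega>"
proof -
  have "\<Omega> \<in> lmeasurable" using \<Omega> assms(1) by (simp add: lmeasurable_open)
  then have int: "integrable lebesgue (\<lambda>x. lam\<^sup>2 * indicator \<Omega> x)"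
    by (auto simp: fmeasurable_def)
  have "AE x in lebesgue. x \<in> \<Omega> \<longrightarrow> norm (L2_fun p x) \<le> lam" "AE x in lebesgue. x \<notin> \<Omega> \<longrightarrow> L2_fun p x = 0"
    using assms(2) by (auto simp: dual_constraint_def H0div_def Hdiv_def L2_on_def)
  then have "AE x in lebesgue. (norm (L2_fun p x))\<^sup>2 \<le> lam\<^sup>2 * indicator \<Omega> x"
    by eventually_elim (auto simp: indicator_def intro!: power_mono)
  then have "(norm p)\<^sup>2 \<le> (LINT x|lebesgue. lam\<^sup>2 * indicator \<Omega> x)"
    unfolding L2_norm_eq using square_integrable_L2_fun[of p]
    by (intro integral_mono_AE int) (auto simp: square_integrable_def)
  then show ?thesis using \<Omega>_lebesgue by simp
qed

end

section \<open>Convergence of the decomposition algorithms\<close>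

text \<open>With s = sqrt (1 - \<rho>) the radicand is 1 + s^2 + 2s, a perfect square. This
  identifies the constant in \<alpha> with the step length constant of an approximate
  minimizer.\<close>

lemma sequential_alpha_eq:
  assumes "0 < \<rho>" "\<rho> \<le> 1"
  shows "sqrt (2 - \<rho> + 2 * sqrt (1 - \<rho>)) = 1 + sqrt (1 - \<rho>)"
  using assms by (intro real_sqrt_unique) (auto simp: power2_sum)

lemma norm_div_le: "norm_div \<Omega> q \<le> norm q + norm (weak_div \<Omega> q)"
  unfolding norm_div_def by (rule sqrt_sum_squares_le_sum) auto

lemma norm_weak_div_le_norm_div: "norm (weak_div \<Omega> q) \<le> norm_div \<Omega> q"
  unfolding norm_div_def by (rule real_le_rsqrt) simp

lemma norm_div_nonneg: "0 \<le> norm_div \<Omega> q"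
  by (simp add: norm_div_def)

theorem theorem4p2:
  fixes \<Omega> :: "(real^'d) set"
    and T :: "(real^'d, real^'m) L2 \<Rightarrow> (real^'d, real) L2"
    and Ts :: "(real^'d, real) L2 \<Rightarrow> (real^'d, real^'m) L2"
    and g :: "(real^'d, real) L2"
    and lam \<beta> \<sigma> \<rho> \<alpha> C\<^sub>\<theta> R \<Phi> :: real
    and M :: nat
    and \<theta> :: "nat \<Rightarrow> (real^'d, real^'m^'d) L2 \<Rightarrow> (real^'d, real^'m^'d) L2"
    and p :: "nat \<Rightarrow> (real^'d, real^'m^'d) L2"
    and phat :: "(real^'d, real^'m^'d) L2"
    and V K :: "(real^'d, real^'m^'d) L2 set"
    and W :: "(real^'d, real^'m) L2 set"
    and D :: "(real^'d, real^'m^'d) L2 \<Rightarrow> real"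
    and n\<^sub>0 :: enat
  assumes \<Omega>: "open \<Omega>" "bounded \<Omega>" "simply_connected \<Omega>" "lipschitz_boundary \<Omega>"
    and params: "lam > 0" "\<beta> \<ge> 0" "g \<in> L2_on \<Omega>"
    and V: "V = H0div \<Omega>" and W: "W = L2_on \<Omega>"
    and T: "bounded_linear_between W norm (L2_on \<Omega>) norm T"
    and Ts: "is_adjoint W (L2_on \<Omega>) T Ts"
    and coercive: "\<exists>c>0. \<forall>u\<in>W. (norm (T u))\<^sup>2 + \<beta> * (norm u)\<^sup>2 \<ge> c * (norm u)\<^sup>2"
    and K: "K = dual_constraint \<Omega> lam"
    and D: "D = dual_energy \<Omega> T Ts \<beta> g"
    and M: "M \<ge> 1"
    and \<theta>: "\<forall>i\<in>{1..M}. bounded_linear_between V (norm_div \<Omega>) V (norm_div \<Omega>) (\<theta> i)"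
    and \<theta>_sum: "\<forall>q\<in>V. q = (\<Sum>i=1..M. \<theta> i q)"
    and \<theta>_K: "K = {\<Sum>i=1..M. v i | v. \<forall>i\<in>{1..M}. v i \<in> \<theta> i ` K}"
    and \<rho>: "0 < \<rho>" "\<rho> \<le> 1"
    and algorithm:
      "(parallel_iterates D K M \<theta> \<sigma> \<rho> p \<and> 0 < \<sigma> \<and> \<sigma> \<le> 1 / real M \<and> \<alpha> = 1) \<or>
       (sequential_iterates D K M \<theta> \<sigma> \<rho> p \<and> 0 < \<sigma> \<and> \<sigma> \<le> 1 \<and>
          \<alpha> = 1 + real M * \<sigma> * sqrt (2 - \<rho> + 2 * sqrt (1 - \<rho>)))"
    and phat: "is_arg_min D (\<lambda>q. q \<in> K) phat"
    and C\<^sub>\<theta>: "C\<^sub>\<theta> = sqrt (\<Sum>i=1..M. (op_norm V (norm_div \<Omega>) (norm_div \<Omega>) (\<theta> i))\<^sup>2)"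
    and R: "R = (SUP q\<in>{q \<in> K. D q \<le> D (p 0)}. norm_div \<Omega> (q - phat))"
    and \<Phi>: "\<Phi> = sqrt (op_norm W norm norm (B_inv \<Omega> T Ts \<beta>)) *
               op_norm V (norm_div \<Omega>) norm (weak_div \<Omega>) * C\<^sub>\<theta> * R"
    and n\<^sub>0: "n\<^sub>0 = Inf (enat ` {n. D (p n) - D phat < \<Phi>\<^sup>2 * \<alpha>})"
  shows "bdd_above ((\<lambda>q. norm_div \<Omega> (q - phat)) ` {q \<in> K. D q \<le> D (p 0)}) \<and>
    (\<lambda>n. D (p n)) \<longlonglongrightarrow> D phat \<and>
    (\<forall>n. enat n \<le> n\<^sub>0 \<longrightarrow>
       D (p n) - D phat \<le> (1 - \<rho> * \<sigma> / (2 * \<alpha>)) ^ n * (D (p 0) - D phat)) \<and>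
    (\<forall>n. n\<^sub>0 \<le> enat n \<longrightarrow>
       D (p n) - D phat \<le>
         2 * \<Phi>\<^sup>2 / (\<rho> * \<sigma>) * \<alpha>\<^sup>2 * inverse (real n - real (the_enat n\<^sub>0) + 1))"
proof -
  let ?nd = "norm_div \<Omega>"
  obtain c where c: "0 < c" "\<And>u. u \<in> W \<Longrightarrow> c * (norm u)\<^sup>2 \<le> (norm (T u))\<^sup>2 + \<beta> * (norm u)\<^sup>2"
    using coercive by blast
  have sets: "\<Omega> \<in> sets lebesgue" using \<Omega>(1) by simp
  interpret Op: regularized_normal_operator W "L2_on \<Omega>" T Ts \<beta> c
    by unfold_locales (use T Ts params c W L2_on_subspace L2_on_complete[OF sets] in auto)
  have Binv_eq: "B_inv \<Omega> T Ts \<beta> = Op.Binv" by (simp add: B_inv_def W)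
  have V_Hdiv: "V \<subseteq> Hdiv \<Omega>" unfolding V H0div_def by blast
  have V_sub: "subspace V" unfolding V by (rule H0div_subspace[OF \<Omega>(1)])
  have div_in: "weak_div \<Omega> q \<in> W" if "q \<in> V" for q
    using weak_div(1)[OF \<Omega>(1)] V_Hdiv that W by blast
  have div_add: "weak_div \<Omega> (q + r) = weak_div \<Omega> q + weak_div \<Omega> r" if "q \<in> V" "r \<in> V" for q r
    using V_Hdiv that by (intro weak_div_add[OF \<Omega>(1)]) auto
  have div_scale: "weak_div \<Omega> (a *\<^sub>R q) = a *\<^sub>R weak_div \<Omega> q" if "q \<in> V" for a q
    using V_Hdiv that by (intro weak_div_scaleR[OF \<Omega>(1)]) auto
  have g: "Ts g \<in> W" using Op.Ts_in params(3) by blast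
  \<comment> \<open>The seminorm of E q is the energy seminorm of the divergence of q, and f plays
    the role of the data; D then measures the distance between E q and f.\<close>
  define E where "E q = Op.energy_embedding (weak_div \<Omega> q)" for q
  define f where "f = Op.energy_embedding (Ts g)"
  have D_eq: "D q = 1 / 2 * (norm (E q - f))\<^sup>2" if "q \<in> V" for q
    using div_in[OF that] g subspace_diff[OF Op.W(1) div_in[OF that] g]
    by (simp add: D dual_energy_def Binv_eq E_def f_def Op.norm_energy_embedding flip: Op.energy_embedding_diff)
  have K_V: "K \<subseteq> V" unfolding K V dual_constraint_def by blast
  interpret LS: decomposed_least_squares V K E f D M \<theta>
  proof
    show "subspace V" by (rule V_sub)
    show "E (q + r) = E q + E r" if "q \<in> V" "r \<in> V" for q r
      using that by (simp add: E_def div_add div_in Op.energy_embedding_add)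
    show "E (a *\<^sub>R q) = a *\<^sub>R E q" if "q \<in> V" for a q
      using that by (simp add: E_def div_scale div_in Op.energy_embedding_scaleR)
    show "convex K" unfolding K by (rule dual_constraint_convex[OF \<Omega>(1)])
    show "(\<Sum>i=1..M. v i) \<in> K" if "\<And>i. i \<in> {1..M} \<Longrightarrow> v i \<in> \<theta> i ` K" for v
      using that by (subst \<theta>_K) blast
    show "(\<Sum>i=1..M. \<theta> i q) = q" if "q \<in> V" for q using \<theta>_sum that by simp
  qed (use \<theta> K_V D_eq in \<open>auto simp: bounded_linear_between_def\<close>)
  have phat_K: "phat \<in> K" and phat_min: "D phat \<le> D q" if "q \<in> K" for q
    using phat that by (auto simp: is_arg_min_linorder)

  let ?A = "{q \<in> K. D q \<le> D (p 0)}"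
  \<comment> \<open>Membership in K bounds norm q, and the condition D q \<le> D (p 0) bounds the
    divergence of q; C adds both bounds and the two norms belonging to phat.\<close>
  have bdd: "bdd_above ((\<lambda>q. ?nd (q - phat)) ` ?A)"
  proof -
    obtain L where L: "0 \<le> L" "\<And>w. w \<in> W \<Longrightarrow> norm w \<le> L * norm (Op.energy_embedding w)"
      using Op.norm_le_energy_embedding by blast
    define C where "C = sqrt (lam\<^sup>2 * measure lebesgue \<Omega>) + norm phat
      + (L * (norm f + sqrt (2 * D (p 0))) + norm (weak_div \<Omega> phat))"
    have "?nd (q - phat) \<le> C" if q: "q \<in> ?A" for q
    proof -
      have V: "q \<in> V" "phat \<in> V" using q phat_K K_V by auto
      have "norm q \<le> sqrt (lam\<^sup>2 * measure lebesgue \<Omega>)"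
        using dual_constraint_bounded[OF \<Omega>(1,2)] q K by (intro real_le_rsqrt) auto
      then have n: "norm (q - phat) \<le> sqrt (lam\<^sup>2 * measure lebesgue \<Omega>) + norm phat"
        using norm_triangle_ineq4[of q phat] by simp
      have "norm (E q - f) \<le> sqrt (2 * D (p 0))"
        using D_eq[OF V(1)] q by (intro real_le_rsqrt) auto
      then have "norm (E q) \<le> norm f + sqrt (2 * D (p 0))"
        using norm_triangle_sub[of "E q" f] by simp
      then have "norm (weak_div \<Omega> q) \<le> L * (norm f + sqrt (2 * D (p 0)))"
        using L(2)[OF div_in[OF V(1)]] mult_left_mono[OF _ L(1)] unfolding E_def by (meson order_trans)
      moreover have "weak_div \<Omega> (q - phat) = weak_div \<Omega> q - weak_div \<Omega> phat"
        using div_add[OF V(1) subspace_scale[OF V_sub V(2)], of "-1"] div_scale[OF V(2), of "-1"] by simp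
      ultimately have "norm (weak_div \<Omega> (q - phat)) \<le> L * (norm f + sqrt (2 * D (p 0))) + norm (weak_div \<Omega> phat)"
        using norm_triangle_ineq4[of "weak_div \<Omega> q" "weak_div \<Omega> phat"] by simp
      with n norm_div_le[of \<Omega> "q - phat"] show ?thesis by (simp add: C_def)
    qed
    then show ?thesis by (intro bdd_aboveI2)
  qed
  have R_ge: "?nd (q - phat) \<le> R" if "q \<in> K" "D q \<le> D (p 0)" for q
    unfolding R using bdd that by (intro cSUP_upper) auto

  define b where "b = op_norm W norm norm Op.Binv"
  define l where "l = op_norm V ?nd norm (weak_div \<Omega>)"
  define th where "th i = op_norm V ?nd ?nd (\<theta> i)" for i
  have b0: "0 \<le> b"
    unfolding b_def by (rule op_norm_nonneg[OF Op.Binv_bounded _ _ subspace_0[OF Op.W(1)]]) auto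
  have div_bounded: "bounded_linear_between V ?nd W norm (weak_div \<Omega>)"
    unfolding bounded_linear_between_def
    using div_in div_add div_scale norm_weak_div_le_norm_div by (auto intro!: exI[of _ 1])
  have l0: "0 \<le> l"
    unfolding l_def by (rule op_norm_nonneg[OF div_bounded norm_div_nonneg _ subspace_0[OF V_sub]]) auto
  \<comment> \<open>Squaring removes both roots and turns \<Phi> into a sum over i, so the bound
    below can be proved term by term.\<close>
  have \<Phi>2: "\<Phi>\<^sup>2 = (\<Sum>i=1..M. b * l\<^sup>2 * (th i)\<^sup>2 * R\<^sup>2)"
    unfolding \<Phi> C\<^sub>\<theta> Binv_eq b_def[symmetric] l_def[symmetric] th_def[symmetric]
    by (simp add: power_mult_distrib b0 sum_nonneg sum_distrib_left sum_distrib_right)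

  have bound: "(\<Sum>i=1..M. (norm (E (\<theta> i (phat - x))))\<^sup>2) \<le> \<Phi>\<^sup>2" if x: "x \<in> K" "D x \<le> D (p 0)" for x
    unfolding \<Phi>2
  proof (rule sum_mono)
    fix i assume i: "i \<in> {1..M}"
    have V: "x \<in> V" "phat \<in> V" using x phat_K K_V by auto
    have d: "phat - x \<in> V" "x - phat \<in> V" using V subspace_diff[OF V_sub] by auto
    \<comment> \<open>R measures differences q - phat, whereas the algorithms are tested in the
      direction phat - x; the norm is insensitive to the sign.\<close>
    have "weak_div \<Omega> (phat - x) = - weak_div \<Omega> (x - phat)"
      using div_scale[OF d(2), of "-1"] by simp
    then have "?nd (phat - x) = ?nd (x - phat)"
      by (simp add: norm_div_def norm_minus_commute)
    then have nd: "?nd (phat - x) \<le> R" using R_ge[OF x] by simp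
    have \<theta>d: "\<theta> i (phat - x) \<in> V" using LS.\<theta>_in[OF i d(1)] .
    have "?nd (\<theta> i (phat - x)) \<le> th i * ?nd (phat - x)"
      unfolding th_def using \<theta> i d(1) norm_div_nonneg by (intro op_norm_bound[where Y = V]) auto
    also have "\<dots> \<le> th i * R"
    proof -
      have "0 \<le> th i"
        unfolding th_def using \<theta> i norm_div_nonneg by (intro op_norm_nonneg[where Y = V, OF _ _ _ d(1)]) auto
      then show ?thesis using nd by (intro mult_left_mono)
    qed
    finally have 1: "?nd (\<theta> i (phat - x)) \<le> th i * R" .
    have "norm (weak_div \<Omega> (\<theta> i (phat - x))) \<le> l * ?nd (\<theta> i (phat - x))"
      unfolding l_def by (rule op_norm_bound[OF div_bounded norm_div_nonneg \<theta>d])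
    also have "\<dots> \<le> l * (th i * R)" using 1 l0 by (intro mult_left_mono)
    finally have 2: "norm (weak_div \<Omega> (\<theta> i (phat - x))) \<le> l * (th i * R)" .
    have "(norm (E (\<theta> i (phat - x))))\<^sup>2 \<le> b * (norm (weak_div \<Omega> (\<theta> i (phat - x))))\<^sup>2"
      unfolding E_def b_def using Op.norm_energy_embedding_le[OF div_in[OF \<theta>d]] .
    also have "\<dots> \<le> b * (l * (th i * R))\<^sup>2" using 2 b0 by (intro mult_left_mono power_mono) auto
    finally show "(norm (E (\<theta> i (phat - x))))\<^sup>2 \<le> b * l\<^sup>2 * (th i)\<^sup>2 * R\<^sup>2"
      by (simp add: power_mult_distrib mult_ac)
  qed

  \<comment> \<open>From here on the two algorithms differ only in the value of \<kappa>.\<close>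
  have "\<exists>\<kappa> S. 0 \<le> \<kappa> \<and> \<alpha> = 1 + \<kappa> \<and> 0 < \<sigma> \<and> \<sigma> \<le> 1 \<and> LS.iterates_gain (\<sigma> * \<rho>) \<kappa> p S"
    using algorithm
  proof (elim disjE conjE)
    assume *: "parallel_iterates D K M \<theta> \<sigma> \<rho> p" "0 < \<sigma>" "\<sigma> \<le> 1 / real M" "\<alpha> = 1"
    have "1 / real M \<le> 1" using M by simp
    then show ?thesis
      using LS.parallel_iterates_gain[OF *(1) M \<rho> *(2,3)] * by (intro exI[of _ 0]) auto
  next
    assume *: "sequential_iterates D K M \<theta> \<sigma> \<rho> p" "0 < \<sigma>" "\<sigma> \<le> 1"
      "\<alpha> = 1 + real M * \<sigma> * sqrt (2 - \<rho> + 2 * sqrt (1 - \<rho>))"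
    have "0 \<le> real M * \<sigma> * (1 + sqrt (1 - \<rho>))" using * \<rho> by simp
    then show ?thesis
      using LS.sequential_iterates_gain[OF *(1) \<rho> *(2,3) refl] * sequential_alpha_eq[OF \<rho>]
      by (intro exI[of _ "real M * \<sigma> * (1 + sqrt (1 - \<rho>))"]) auto
  qed
  then obtain \<kappa> S where \<kappa>: "0 \<le> \<kappa>" "\<alpha> = 1 + \<kappa>" and \<sigma>: "0 < \<sigma>" "\<sigma> \<le> 1"
    and gain: "LS.iterates_gain (\<sigma> * \<rho>) \<kappa> p S"
    by blast
  have p0: "p 0 \<in> K" using gain by (simp add: LS.iterates_gain_def)
  \<comment> \<open>The supremum runs over a nonempty set of nonnegative numbers, with p 0 as a
    witness.\<close>
  have "0 \<le> R" using R_ge[OF p0 order_refl] norm_div_nonneg[of \<Omega> "p 0 - phat"] by linarith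
  then have \<Phi>0: "0 \<le> \<Phi>"
    unfolding \<Phi> C\<^sub>\<theta> Binv_eq b_def[symmetric] l_def[symmetric] using b0 l0 by (simp add: sum_nonneg)
  have \<tau>: "0 < \<sigma> * \<rho>" "\<sigma> * \<rho> \<le> 1" using \<sigma> \<rho> by (auto intro: mult_le_one)
  note decay = LS.iterates_decay[OF gain \<tau> \<kappa> phat_K[OF p0] phat_min \<Phi>0 bound n\<^sub>0]
  show ?thesis
    using bdd decay by (simp add: mult.commute[of \<rho> \<sigma>])
qed

end
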